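(* For $k>8$, every good transitive non-cyclic homomorphism $\omega\colon B_k\to S_{3k}$ is standard.
   Context: $B_k$ is the braid group with generators $\sigma_1,\dots,\sigma_{k-1}$ and relations $\sigma_i\sigma_j=\sigma_j\sigma_i$ for $|i-j|\ge2$ and $\sigma_i\sigma_{i+1}\sigma_i=\sigma_{i+1}\sigma_i\sigma_{i+1}$. $S_n$ is the symmetric group on $\{1,\dots,n\}$ acting from the left, so $(\sigma\tau)(x)=\sigma(\tau(x))$; permutations of a subset are extended by the identity. $\mathrm{supp}(s)$ is the set of points moved by a permutation $s$. A homomorphism to $S_n$ is transitive if its image acts transitively on $\{1,\dots,n\}$, and cyclic if its image is a cyclic group. Homomorphisms $\phi,\psi\colon G\to H$ are conjugate if there is $h\in H$ with $\psi(g)=h^{-1}\phi(g)h$ for all $g\in G$. A homomorphism $\omega\colon B_k\to S_n$ is good if one of the following holds: (1) $\mathrm{supp}(\omega(\sigma_i))\cap\mathrm{supp}(\omega(\sigma_j))=\emptyset$ for all $1\le i,j\le k-1$ with $|i-j|>1$; (2) $\mathrm{supp}(\omega(\sigma_1))=\cdots=\mathrm{supp}(\omega(\sigma_{k-1}))$. For $n\ge1$: $\bigtriangledown_n=\{0,\dots,n-1\}$; $|a|_n\in\bigtriangledown_n$ is the residue of $a\in\mathbb Z$ modulo $n$; for $i\ge1$ and $q\in\bigtriangledown_n$ put $a^{(n)}_{i,q}=1+n(i-1)+q$; $A^n_i$ is the $n$-cycle $(1+n(i-1),2+n(i-1),\dots,ni)$ (the identity if $n=1$). For a permutation $\sigma$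 of $\{j,\dots,j+r-1\}$ and $t_j,\dots,t_{j+r-1}\in\bigtriangledown_n$, $C^{\sigma,n}_{t_j,\dots,t_{j+r-1}}$ is the permutation of $\{n(j-1)+1,\dots,n(j+r-1)\}$ given by $a^{(n)}_{i,q}\mapsto a^{(n)}_{\sigma(i),\,|q+t_{\sigma(i)}|_n}$ for $j\le i\le j+r-1$, $q\in\bigtriangledown_n$. Model homomorphisms $B_k\to S_{mk}$ ($k>6$, $m\ge1$; here $m=3$): For $l\ge1$ and $1\le i\le k-1$, $\psi_l(\sigma_i)\in S_{lk}$ is the $2l$-cycle $(a^{(l)}_{i,0},a^{(l)}_{i+1,0},a^{(l)}_{i,1},a^{(l)}_{i+1,1},\dots,a^{(l)}_{i,l-1},a^{(l)}_{i+1,l-1})$; it is also regarded as a permutation of $\{l(i-1)+1,\dots,l(i+1)\}$. This defines $\psi_m\colon B_k\to S_{mk}$. For $l\mid m$, $1\le l<m$, and a family $t=(t^i_q)$, $1\le i\le k-1$, $(i-1)l+1\le q\le(i+1)l$, of elements of $\bigtriangledown_{m/l}$ satisfying, for all $1\le i\le k-2$ and $j\in\bigtriangledown_l$, $$t^i_{(i-1)l+1+|1+j|_l}+t^i_{il+1+|1+j|_l}\equiv t^{i+1}_{(i+1)l+1+j}+t^{i+1}_{il+1+|1+j|_l}\pmod{m/l},$$ the homomorphism $\phi_{m,l,t}\colon B_k\to S_{mk}$ is given by $$\phi_{m,l,t}(\sigma_i)=A^{m/l}_1\cdots A^{m/l}_{(i-1)l}\cdot C^{\psi_l(\sigma_i),m/l}_{t^i_{(i-1)l+1},\dots,t^i_{(i+1)l}}\cdot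 A^{m/l}_{(i+1)l+1}\cdots A^{m/l}_{kl}.$$ The model homomorphisms are $\psi_m$ and all these $\phi_{m,l,t}$. A homomorphism $B_k\to S_{mk}$ is standard if it is conjugate to one of the model homomorphisms. *)

theory Defs
  imports "HOL-Algebra.Sym_Groups" "HOL-Algebra.Elementary_Groups" "HOL-Number_Theory.Cong"
begin

section \<open>Groups given by generators and relations\<close>

text \<open>
  A word in the generators \<open>X\<close> is a list of pairs: \<open>(x, True)\<close> stands for \<open>x\<close>, and \<open>(x, False)\<close>
  for the inverse of \<open>x\<close>. A relation \<open>r = s\<close> is a pair \<open>(r, s)\<close> of words.
\<close>

type_synonym 'a word = "('a \<times> bool) list"

definition words :: "'a set \<Rightarrow> 'a word set" where
  "words X = lists (X \<times> UNIV)"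

inductive word_eq :: "'a set \<Rightarrow> ('a word \<times> 'a word) set \<Rightarrow> 'a word \<Rightarrow> 'a word \<Rightarrow> bool"
  for X :: "'a set" and R :: "('a word \<times> 'a word) set" where
  refl: "w \<in> words X \<Longrightarrow> word_eq X R w w"
| sym: "word_eq X R v w \<Longrightarrow> word_eq X R w v"
| trans: "word_eq X R u v \<Longrightarrow> word_eq X R v w \<Longrightarrow> word_eq X R u w"
| cancel: "u \<in> words X \<Longrightarrow> v \<in> words X \<Longrightarrow> x \<in> X \<Longrightarrow>
    word_eq X R (u @ [(x, b), (x, \<not> b)] @ v) (u @ v)"
| rel: "u \<in> words X \<Longrightarrow> v \<in> words X \<Longrightarrow> (r, s) \<in> R \<Longrightarrow> r \<in> words X \<Longrightarrow> s \<in> words X \<Longrightarrow>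
    word_eq X R (u @ r @ v) (u @ s @ v)"

definition word_class :: "'a set \<Rightarrow> ('a word \<times> 'a word) set \<Rightarrow> 'a word \<Rightarrow> 'a word set" where
  "word_class X R w = {v. word_eq X R w v}"

definition presented_group :: "'a set \<Rightarrow> ('a word \<times> 'a word) set \<Rightarrow> 'a word set monoid" where
  "presented_group X R =
    \<lparr>carrier = word_class X R ` words X,
     mult = (\<lambda>U V. \<Union>u\<in>U. \<Union>v\<in>V. word_class X R (u @ v)),
     one = word_class X R []\<rparr>"

lemma words_append [simp]: "u @ v \<in> words X \<longleftrightarrow> u \<in> words X \<and> v \<in> words X"
  by (auto simp: words_def)

lemma words_Nil [simp]: "[] \<in> words X"
  by (simp add: words_def)

lemma words_Cons [simp]: "(x, b) # v \<in> words X \<longleftrightarrow> x \<in> X \<and> v \<in> words X"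
  by (auto simp: words_def)

lemma word_eq_words: "word_eq X R v w \<Longrightarrow> v \<in> words X \<and> w \<in> words X"
  by (induction rule: word_eq.induct) auto

lemma word_eq_context:
  assumes "word_eq X R v w" "p \<in> words X" "q \<in> words X"
  shows "word_eq X R (p @ v @ q) (p @ w @ q)"
  using assms
proof (induction rule: word_eq.induct)
  case (refl w)
  then show ?case by (simp add: word_eq.refl)
next
  case (sym v w)
  then show ?case by (blast intro: word_eq.sym)
next
  case (trans u v w)
  then show ?case by (blast intro: word_eq.trans)
next
  case (cancel u v x b)
  then show ?case
    using word_eq.cancel[of "p @ u" X "v @ q" x R b] by simp
next
  case (rel u v r s)
  then show ?case
    using word_eq.rel[of "p @ u" X "v @ q" r s R] by simp
qed

lemma word_eq_append:
  assumes "word_eq X R u u'" "word_eq X R v v'"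
  shows "word_eq X R (u @ v) (u' @ v')"
proof -
  have "word_eq X R (u @ v) (u' @ v)"
    using word_eq_context[OF assms(1), of "[]" v] word_eq_words[OF assms(2)] by simp
  moreover have "word_eq X R (u' @ v) (u' @ v')"
    using word_eq_context[OF assms(2), of u' "[]"] word_eq_words[OF assms(1)] by simp
  ultimately show ?thesis by (rule word_eq.trans)
qed

lemma word_class_eq_iff:
  assumes "v \<in> words X"
  shows "word_class X R v = word_class X R w \<longleftrightarrow> word_eq X R v w"
  using assms unfolding word_class_def
  by (auto intro: word_eq.refl word_eq.sym word_eq.trans)

lemma presented_group_mult:
  assumes "u \<in> words X" "v \<in> words X"
  shows "word_class X R u \<otimes>\<^bsub>presented_group X R\<^esub> word_class X R v = word_class X R (u @ v)"
proof -
  let ?U = "word_class X R u" and ?V = "word_class X R v"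
  have *: "word_class X R (u' @ v') = word_class X R (u @ v)"
    if "u' \<in> word_class X R u" "v' \<in> word_class X R v" for u' v'
  proof -
    have "word_eq X R (u @ v) (u' @ v')"
      using that unfolding word_class_def by (auto intro: word_eq_append)
    with assms have "word_class X R (u @ v) = word_class X R (u' @ v')"
      by (simp add: word_class_eq_iff)
    then show ?thesis by (rule HOL.sym)
  qed
  have "(\<Union>u'\<in>?U. \<Union>v'\<in>?V. word_class X R (u' @ v')) = (\<Union>u'\<in>?U. \<Union>v'\<in>?V. word_class X R (u @ v))"
    by (intro SUP_cong HOL.refl *)
  also have "\<dots> = word_class X R (u @ v)"
  proof -
    have "u \<in> ?U" "v \<in> ?V" using assms by (simp_all add: word_class_def word_eq.refl)
    then show ?thesis by blast
  qed
  finally show ?thesis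
    by (simp add: presented_group_def)
qed

lemma presented_group_carrier: "carrier (presented_group X R) = word_class X R ` words X"
  by (simp add: presented_group_def)

lemma presented_group_one: "\<one>\<^bsub>presented_group X R\<^esub> = word_class X R []"
  by (simp add: presented_group_def)

definition word_inv :: "'a word \<Rightarrow> 'a word" where
  "word_inv w = rev (map (\<lambda>(x, b). (x, \<not> b)) w)"

lemma word_inv_words: "w \<in> words X \<Longrightarrow> word_inv w \<in> words X"
  by (auto simp: word_inv_def words_def)

lemma word_inv_left: "w \<in> words X \<Longrightarrow> word_eq X R (word_inv w @ w) []"
proof (induction w)
  case Nil
  then show ?case by (simp add: word_inv_def word_eq.refl)
next
  case (Cons a w)
  obtain x b where a: "a = (x, b)" by force
  have w: "x \<in> X" "w \<in> words X" using Cons.prems a by auto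
  have "word_eq X R (word_inv w @ [(x, \<not> b), (x, \<not> \<not> b)] @ w) (word_inv w @ w)"
    using w by (intro word_eq.cancel word_inv_words)
  then have "word_eq X R (word_inv (a # w) @ a # w) (word_inv w @ w)"
    by (simp add: a word_inv_def)
  then show ?case
    using Cons.IH w by (blast intro: word_eq.trans)
qed

lemma presented_group_is_group: "group (presented_group X R)"
proof (rule groupI)
  show "\<exists>y\<in>carrier (presented_group X R). y \<otimes>\<^bsub>presented_group X R\<^esub> x = \<one>\<^bsub>presented_group X R\<^esub>"
    if x: "x \<in> carrier (presented_group X R)" for x
  proof -
    obtain w where w: "w \<in> words X" "x = word_class X R w"
      using x by (auto simp: presented_group_carrier)
    have "word_class X R (word_inv w) \<otimes>\<^bsub>presented_group X R\<^esub> x = \<one>\<^bsub>presented_group X R\<^esub>"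
      using w word_inv_left[OF w(1)]
      by (simp add: presented_group_mult presented_group_one word_inv_words word_class_eq_iff)
    then show ?thesis
      using word_inv_words[OF w(1)] by (auto simp: presented_group_carrier)
  qed
qed (auto simp: presented_group_carrier presented_group_mult presented_group_one)


section \<open>Braid groups\<close>

definition braid_relations :: "nat \<Rightarrow> (nat word \<times> nat word) set" where
  "braid_relations k =
    {([(i, True), (j, True)], [(j, True), (i, True)]) | i j.
       i \<in> {1..k - 1} \<and> j \<in> {1..k - 1} \<and> \<bar>int i - int j\<bar> \<ge> 2} \<union>
    {([(i, True), (i + 1, True), (i, True)], [(i + 1, True), (i, True), (i + 1, True)]) | i.
       i \<in> {1..k - 1} \<and> i + 1 \<in> {1..k - 1}}"

definition braid_group :: "nat \<Rightarrow> nat word set monoid" where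
  "braid_group k = presented_group {1..k - 1} (braid_relations k)"

definition braid_gen :: "nat \<Rightarrow> nat \<Rightarrow> nat word set" where
  "braid_gen k i = word_class {1..k - 1} (braid_relations k) [(i, True)]"

lemma braid_group_is_group: "group (braid_group k)"
  unfolding braid_group_def by (rule presented_group_is_group)

lemma braid_gen_carrier: "i \<in> {1..k - 1} \<Longrightarrow> braid_gen k i \<in> carrier (braid_group k)"
  by (simp add: braid_group_def braid_gen_def presented_group_carrier)

lemma braid_gen_commute:
  assumes "i \<in> {1..k - 1}" "j \<in> {1..k - 1}" "\<bar>int i - int j\<bar> \<ge> 2"
  shows "braid_gen k i \<otimes>\<^bsub>braid_group k\<^esub> braid_gen k j =
         braid_gen k j \<otimes>\<^bsub>braid_group k\<^esub> braid_gen k i"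
proof -
  have "([(i, True), (j, True)], [(j, True), (i, True)]) \<in> braid_relations k"
    using assms unfolding braid_relations_def by blast
  then have "word_eq {1..k - 1} (braid_relations k) [(i, True), (j, True)] [(j, True), (i, True)]"
    using word_eq.rel[OF words_Nil words_Nil, of "[(i, True), (j, True)]" "[(j, True), (i, True)]" "braid_relations k" "{1..k - 1}"]
    using assms by simp
  then show ?thesis
    using assms
    by (simp add: braid_group_def braid_gen_def presented_group_mult word_class_eq_iff)
qed

lemma braid_gen_braid:
  assumes "i \<in> {1..k - 1}" "i + 1 \<in> {1..k - 1}"
  shows "braid_gen k i \<otimes>\<^bsub>braid_group k\<^esub> braid_gen k (i + 1) \<otimes>\<^bsub>braid_group k\<^esub> braid_gen k i =
         braid_gen k (i + 1) \<otimes>\<^bsub>braid_group k\<^esub> braid_gen k i \<otimes>\<^bsub>braid_group k\<^esub> braid_gen k (i + 1)"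
proof -
  have "([(i, True), (i + 1, True), (i, True)], [(i + 1, True), (i, True), (i + 1, True)])
          \<in> braid_relations k"
    using assms unfolding braid_relations_def by blast
  then have "word_eq {1..k - 1} (braid_relations k)
      [(i, True), (i + 1, True), (i, True)] [(i + 1, True), (i, True), (i + 1, True)]"
    using word_eq.rel[OF words_Nil words_Nil, of "[(i, True), (i + 1, True), (i, True)]"
        "[(i + 1, True), (i, True), (i + 1, True)]" "braid_relations k" "{1..k - 1}"]
    using assms by simp
  then show ?thesis
    using assms
    by (simp add: braid_group_def braid_gen_def presented_group_mult word_class_eq_iff)
qed


section \<open>Properties of homomorphisms to symmetric groups\<close>

definition supp :: "('a \<Rightarrow> 'a) \<Rightarrow> 'a set" where
  "supp s = {x. s x \<noteq> x}"

definition transitive_hom :: "('g, 'b) monoid_scheme \<Rightarrow> nat \<Rightarrow> ('g \<Rightarrow> nat \<Rightarrow> nat) \<Rightarrow> bool" where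
  "transitive_hom G n \<omega> \<longleftrightarrow> (\<forall>x\<in>{1..n}. \<forall>y\<in>{1..n}. \<exists>g\<in>carrier G. \<omega> g x = y)"

definition cyclic_hom ::
  "('g, 'b) monoid_scheme \<Rightarrow> ('h, 'c) monoid_scheme \<Rightarrow> ('g \<Rightarrow> 'h) \<Rightarrow> bool" where
  "cyclic_hom G H \<omega> \<longleftrightarrow> cyclic_group (H\<lparr>carrier := \<omega> ` carrier G\<rparr>)"

definition conjugate_homs ::
  "('g, 'b) monoid_scheme \<Rightarrow> ('h, 'c) monoid_scheme \<Rightarrow> ('g \<Rightarrow> 'h) \<Rightarrow> ('g \<Rightarrow> 'h) \<Rightarrow> bool" where
  "conjugate_homs G H \<phi> \<psi> \<longleftrightarrow>
    (\<exists>h\<in>carrier H. \<forall>g\<in>carrier G. \<psi> g = inv\<^bsub>H\<^esub> h \<otimes>\<^bsub>H\<^esub> \<phi> g \<otimes>\<^bsub>H\<^esub> h)"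

definition good_hom :: "nat \<Rightarrow> (nat word set \<Rightarrow> nat \<Rightarrow> nat) \<Rightarrow> bool" where
  "good_hom k \<omega> \<longleftrightarrow>
    (\<forall>i\<in>{1..k - 1}. \<forall>j\<in>{1..k - 1}. \<bar>int i - int j\<bar> > 1 \<longrightarrow>
       supp (\<omega> (braid_gen k i)) \<inter> supp (\<omega> (braid_gen k j)) = {}) \<or>
    (\<forall>i\<in>{1..k - 1}. \<forall>j\<in>{1..k - 1}. supp (\<omega> (braid_gen k i)) = supp (\<omega> (braid_gen k j)))"


section \<open>Model homomorphisms\<close>

text \<open>\<open>block_elem n i q\<close> is $a^{(n)}_{i,q}$; it is used only for \<open>i \<ge> 1\<close> and \<open>q < n\<close>.\<close>

definition block_elem :: "nat \<Rightarrow> nat \<Rightarrow> nat \<Rightarrow> nat" where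
  "block_elem n i q = 1 + n * (i - 1) + q"

definition block_cycle :: "nat \<Rightarrow> nat \<Rightarrow> nat \<Rightarrow> nat" where
  "block_cycle n i = cycle_of_list [1 + n * (i - 1)..<n * i + 1]"

definition block_cycles :: "nat \<Rightarrow> nat list \<Rightarrow> nat \<Rightarrow> nat" where
  "block_cycles n is = foldr (\<circ>) (map (block_cycle n) is) id"

text \<open>
  \<open>block_perm n j r \<sigma> t\<close> is $C^{\sigma,n}_{t_j,\dots,t_{j+r-1}}$, extended by the identity. A point
  \<open>x \<ge> 1\<close> is $a^{(n)}_{i,q}$ for \<open>i = (x - 1) div n + 1\<close> and \<open>q = (x - 1) mod n\<close>; see
  \<open>block_perm_block_elem\<close> below for the formula in terms of \<open>i\<close> and \<open>q\<close>.
\<close>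

definition block_perm :: "nat \<Rightarrow> nat \<Rightarrow> nat \<Rightarrow> (nat \<Rightarrow> nat) \<Rightarrow> (nat \<Rightarrow> nat) \<Rightarrow> nat \<Rightarrow> nat" where
  "block_perm n j r \<sigma> t x =
    (if x \<in> {n * (j - 1) + 1..n * (j + r - 1)}
     then let i = (x - 1) div n + 1; q = (x - 1) mod n
          in block_elem n (\<sigma> i) ((q + t (\<sigma> i)) mod n)
     else x)"

lemma block_perm_block_elem:
  assumes "j \<ge> 1" "i \<in> {j..j + r - 1}" "q < n"
  shows "block_perm n j r \<sigma> t (block_elem n i q) = block_elem n (\<sigma> i) ((q + t (\<sigma> i)) mod n)"
proof -
  obtain d where i: "i = Suc d" using assms by (cases i) auto
  have "n * (j - 1) \<le> n * d" using assms i by (intro mult_le_mono) auto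
  moreover have "n * d + n \<le> n * (j + r - 1)"
    using assms i mult_le_mono[of n n "Suc d" "j + r - 1"] by simp
  moreover have "block_elem n i q = 1 + n * d + q" by (simp add: block_elem_def i)
  ultimately have "block_elem n i q \<in> {n * (j - 1) + 1..n * (j + r - 1)}"
    using \<open>q < n\<close> unfolding atLeastAtMost_iff by linarith
  moreover have "(n * d + q) div n = d" "(n * d + q) mod n = q" using assms by auto
  ultimately show ?thesis
    by (simp add: block_perm_def block_elem_def i)
qed

lemma block_perm_outside:
  "x \<notin> {n * (j - 1) + 1..n * (j + r - 1)} \<Longrightarrow> block_perm n j r \<sigma> t x = x"
  unfolding block_perm_def by (rule if_not_P)

definition psi_gen :: "nat \<Rightarrow> nat \<Rightarrow> nat \<Rightarrow> nat" where
  "psi_gen l i = cycle_of_list (concat (map (\<lambda>q. [block_elem l i q, block_elem l (i + 1) q]) [0..<l]))"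

definition phi_params :: "nat \<Rightarrow> nat \<Rightarrow> nat \<Rightarrow> (nat \<Rightarrow> nat \<Rightarrow> nat) \<Rightarrow> bool" where
  "phi_params k m l t \<longleftrightarrow>
    l dvd m \<and> 1 \<le> l \<and> l < m \<and>
    (\<forall>i\<in>{1..k - 1}. \<forall>q\<in>{(i - 1) * l + 1..(i + 1) * l}. t i q < m div l) \<and>
    (\<forall>i\<in>{1..k - 2}. \<forall>j<l.
       [t i ((i - 1) * l + 1 + (1 + j) mod l) + t i (i * l + 1 + (1 + j) mod l) =
        t (i + 1) ((i + 1) * l + 1 + j) + t (i + 1) (i * l + 1 + (1 + j) mod l)] (mod (m div l)))"

definition phi_gen ::
  "nat \<Rightarrow> nat \<Rightarrow> nat \<Rightarrow> (nat \<Rightarrow> nat \<Rightarrow> nat) \<Rightarrow> nat \<Rightarrow> nat \<Rightarrow> nat" where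
  "phi_gen k m l t i =
    block_cycles (m div l) [1..<(i - 1) * l + 1] \<circ>
    block_perm (m div l) ((i - 1) * l + 1) (2 * l) (psi_gen l i) (t i) \<circ>
    block_cycles (m div l) [(i + 1) * l + 1..<k * l + 1]"

text \<open>
  A homomorphism on the braid group is determined by its values on the generators, so the model
  homomorphisms are described by these values.
\<close>

definition model_hom :: "nat \<Rightarrow> nat \<Rightarrow> (nat word set \<Rightarrow> nat \<Rightarrow> nat) \<Rightarrow> bool" where
  "model_hom k m \<phi> \<longleftrightarrow>
    \<phi> \<in> hom (braid_group k) (sym_group (m * k)) \<and>
    ((\<forall>i\<in>{1..k - 1}. \<phi> (braid_gen k i) = psi_gen m i) \<or>
     (\<exists>l t. phi_params k m l t \<and> (\<forall>i\<in>{1..k - 1}. \<phi> (braid_gen k i) = phi_gen k m l t i)))"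

definition standard_hom :: "nat \<Rightarrow> nat \<Rightarrow> (nat word set \<Rightarrow> nat \<Rightarrow> nat) \<Rightarrow> bool" where
  "standard_hom k m \<omega> \<longleftrightarrow>
    \<omega> \<in> hom (braid_group k) (sym_group (m * k)) \<and>
    (\<exists>\<phi>. model_hom k m \<phi> \<and> conjugate_homs (braid_group k) (sym_group (m * k)) \<omega> \<phi>)"

end

theory Submission
  imports Defs
begin

text \<open>
  Let \<open>s\<^sub>i\<close> be the image of \<open>\<sigma>\<^sub>i\<close>. If far generators have disjoint supports, consecutive supports
  meet in exactly half of their points, and these halves are blocks \<open>D\<^sub>1, \<dots>, D\<^sub>k\<close> such that \<open>s\<^sub>i\<close>
  exchanges \<open>D\<^sub>i\<close> with \<open>D\<^bsub>i+1\<^esub>\<close> and fixes the other points; by transitivity they cover everything, so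
  they have three points each.

  If all supports are equal, they are the whole set by transitivity. Then \<open>t = s\<^bsub>k-1\<^esub>\<close> has at most
  \<open>3k/2\<close> cycles, and \<open>B\<^bsub>k-2\<^esub>\<close> acts on them. An action on so few points is either cyclic or, up to a
  common permutation of the remaining points, the standard action on \<open>k - 2\<close> points; for large \<open>k\<close>
  this is an induction that repeats the passage to cycles, and for \<open>k = 9, 10\<close> one plays an element
  of \<open>5\<close>-power order from \<open>B\<^sub>5\<close> against the commuting generators on the last strands. The cyclic
  case would make \<open>\<omega>\<close> cyclic, since the commutator subgroup cannot act through the abelian group
  generated by \<open>t\<close>. In the standard case all but a few of the \<open>s\<^sub>i\<close> agree at each
  point; their common value \<open>z\<close> centralizes the action, and the \<open>z\<^sup>-\<^sup>1 s\<^sub>i\<close> satisfy the braid relations,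
  now with disjoint supports of far generators.

  Finally, identify all blocks with \<open>D\<^sub>1\<close> along the generators, divided by \<open>z\<close> (put \<open>z = 1\<close> in the
  first case). If \<open>z = 1\<close>, transitivity makes the square of a generator a \<open>3\<close>-cycle on \<open>D\<^sub>1\<close>, which
  gives \<open>\<psi>\<^sub>3\<close>; otherwise \<open>z\<close> is a \<open>3\<close>-cycle on \<open>D\<^sub>1\<close>, and the square commutes with it, hence is a
  power of it, which gives some \<open>\<phi>\<^bsub>3,1,t\<^esub>\<close>.
\<close>

section \<open>Braid groups acting on finite sets\<close>

text \<open>Most counting rests on one device: all pairs of neighbouring generators are
  simultaneously conjugate, and so are all pairs of far ones. A number read off a convenient pair,
  say \<open>s 1\<close> and \<open>s 3\<close>, is thus known for the pair of interest, say
  \<open>s i\<close> and \<open>s (n - 1)\<close>. "Cyclic" appears as equality of all generators.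

  The bound \<open>k > 8\<close> makes 3k/2 smaller than twice the k - 2 strands that remain after
  passing to cycles; this forces the blocks of the quotient action to be single points. The repeated
  passage starts from at least nine remaining strands, hence from k = 11; the cases 9 and 10 leave
  seven strands on at most 13 points and eight strands on at most 15.

  The prime 5 comes from the rotation \<open>delta\<close> of five strands. Its fifth power is
  central, so a suitable power of \<open>delta\<close> that has 5-power order still conjugates
  \<open>s 1\<close> to \<open>s 2\<close>. If that element acts trivially, all generators agree;
  otherwise it has a cycle of at least five points, which a small set cannot afford.\<close>

locale braid_action =
  fixes n :: nat and s :: "nat \<Rightarrow> 'a \<Rightarrow> 'a" and X :: "'a set"
  assumes finite_X: "finite X"
    and perm: "1 \<le> i \<Longrightarrow> i < n \<Longrightarrow> s i permutes X"
    and far: "1 \<le> i \<Longrightarrow> i + 2 \<le> j \<Longrightarrow> j < n \<Longrightarrow> s i (s j x) = s j (s i x)"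
    and braid: "1 \<le> i \<Longrightarrow> Suc i < n \<Longrightarrow> s i (s (Suc i) (s i x)) = s (Suc i) (s i (s (Suc i) x))"

definition gens_equal :: "nat \<Rightarrow> (nat \<Rightarrow> 'a \<Rightarrow> 'a) \<Rightarrow> bool" where
  "gens_equal n s \<longleftrightarrow> (\<forall>i j. 1 \<le> i \<longrightarrow> i < n \<longrightarrow> 1 \<le> j \<longrightarrow> j < n \<longrightarrow> s i = s j)"

text \<open>The two equations say that \<open>w\<close> conjugates the pair \<open>(a, b)\<close> to
  \<open>(a', b')\<close>. The value type is arbitrary, so that cardinalities and truth values are
  treated alike.\<close>

definition conj_inv :: "'a set \<Rightarrow> (('a \<Rightarrow> 'a) \<Rightarrow> ('a \<Rightarrow> 'a) \<Rightarrow> 'b) \<Rightarrow> bool" where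
  "conj_inv X D \<longleftrightarrow> (\<forall>w a b a' b'. w permutes X \<longrightarrow> (\<forall>x. w (a x) = a' (w x)) \<longrightarrow>
     (\<forall>x. w (b x) = b' (w x)) \<longrightarrow> D a b = D a' b')"

definition restr :: "'a set \<Rightarrow> (nat \<Rightarrow> 'a \<Rightarrow> 'a) \<Rightarrow> nat \<Rightarrow> 'a \<Rightarrow> 'a" where
  "restr Z s i x = (if x \<in> Z then s i x else x)"

lemma conj_invD:
  "conj_inv X D \<Longrightarrow> w permutes X \<Longrightarrow> (\<And>x. w (a x) = a' (w x)) \<Longrightarrow> (\<And>x. w (b x) = b' (w x)) \<Longrightarrow>
    D a b = D a' b'"
  unfolding conj_inv_def by blast

text \<open>A set described in terms of \<open>a\<close> and \<open>b\<close> is carried by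
  \<open>w\<close> onto the set for the conjugate pair, so only the equivalence at
  \<open>w x\<close> has to be checked.\<close>

lemma conj_inv_card:
  assumes "\<And>w a b a' b' x. w permutes X \<Longrightarrow> \<forall>x. w (a x) = a' (w x) \<Longrightarrow> \<forall>x. w (b x) = b' (w x) \<Longrightarrow>
      R a' b' (w x) \<longleftrightarrow> R a b x"
  shows "conj_inv X (\<lambda>a b. card {x. R a b x})"
  unfolding conj_inv_def
proof (intro allI impI)
  fix w a b a' b'
  assume h: "w permutes X" "\<forall>x. w (a x) = a' (w x)" "\<forall>x. w (b x) = b' (w x)"
  have "{x. R a' b' x} = w ` {x. R a b x}"
  proof (intro equalityI subsetI)
    fix x assume "x \<in> {x. R a' b' x}"
    moreover obtain u where "x = w u" using permutes_surj[OF h(1)] by (metis surjD)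
    ultimately show "x \<in> w ` {x. R a b x}" using assms[OF h] by auto
  qed (use assms[OF h] in auto)
  moreover have "inj_on w {x. R a b x}" using permutes_inj_on[OF h(1)] by blast
  ultimately show "card {x. R a b x} = card {x. R a' b' x}" by (simp add: card_image)
qed

lemma conj_inv_inter_card: "conj_inv X (\<lambda>a b. card (supp a \<inter> supp b))"
proof -
  have "conj_inv X (\<lambda>a b. card {x. a x \<noteq> x \<and> b x \<noteq> x})"
    by (rule conj_inv_card) (metis permutes_inj injD)
  moreover have "supp a \<inter> supp b = {x. a x \<noteq> x \<and> b x \<noteq> x}" for a b :: "'a \<Rightarrow> 'a"
    by (auto simp: supp_def)
  ultimately show ?thesis by simp
qed

lemma conj_inv_diff_card: "conj_inv X (\<lambda>a b. card {x. a x \<noteq> b x})"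
  by (rule conj_inv_card) (metis permutes_inj injD)

lemma conj_inv_supp_card: "conj_inv X (\<lambda>a b. card (supp a))"
  unfolding supp_def by (rule conj_inv_card) (metis permutes_inj injD)

lemma conj_inv_fix_card: "conj_inv X (\<lambda>a b. card {x. x \<in> X \<and> (a ^^ m) x = x})"
proof (rule conj_inv_card)
  fix w a b a' b' :: "'a \<Rightarrow> 'a" and x
  assume h: "w permutes X" "\<forall>x. w (a x) = a' (w x)"
  have "(a' ^^ m) (w x) = w ((a ^^ m) x)" by (induction m) (use h in auto)
  then show "(w x \<in> X \<and> (a' ^^ m) (w x) = w x) \<longleftrightarrow> (x \<in> X \<and> (a ^^ m) x = x)"
    using h(1) by (metis permutes_in_image permutes_inj injD)
qed

lemma conj_inv_eq: "conj_inv X (\<lambda>a b. a = b)"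
  unfolding conj_inv_def
proof (intro allI impI)
  fix w a b a' b'
  assume h: "w permutes X" "\<forall>x. w (a x) = a' (w x)" "\<forall>x. w (b x) = b' (w x)"
  show "(a = b) = (a' = b')"
  proof
    assume "a = b"
    show "a' = b'"
    proof
      fix x
      obtain u where "x = w u" using permutes_surj[OF h(1)] by (metis surjD)
      then show "a' x = b' x" using h \<open>a = b\<close> by metis
    qed
  next
    assume "a' = b'"
    then show "a = b" using h by (metis ext permutes_inj injD)
  qed
qed

context braid_action
begin

lemma inj: "1 \<le> i \<Longrightarrow> i < n \<Longrightarrow> s i x = s i y \<longleftrightarrow> x = y"
  using perm permutes_inj by (metis injD)

lemma in_X: "1 \<le> i \<Longrightarrow> i < n \<Longrightarrow> s i x \<in> X \<longleftrightarrow> x \<in> X"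
  using perm permutes_in_image by metis

lemma outside: "1 \<le> i \<Longrightarrow> i < n \<Longrightarrow> x \<notin> X \<Longrightarrow> s i x = x"
  using perm permutes_not_in by metis

lemma far_sym:
  "1 \<le> i \<Longrightarrow> 1 \<le> j \<Longrightarrow> i < n \<Longrightarrow> j < n \<Longrightarrow> i + 2 \<le> j \<or> j + 2 \<le> i \<Longrightarrow> s i (s j x) = s j (s i x)"
  using far by metis

lemma sub_action: "m \<le> n \<Longrightarrow> braid_action m s X"
  by unfold_locales (auto simp: finite_X perm braid intro: far)

lemma shift_action: "m + d \<le> n \<Longrightarrow> braid_action m (\<lambda>i. s (i + d)) X"
  by unfold_locales (auto simp: finite_X perm braid intro: far)

lemma restr_action:
  assumes "Z \<subseteq> X" "\<And>i x. 1 \<le> i \<Longrightarrow> i < n \<Longrightarrow> x \<in> Z \<Longrightarrow> s i x \<in> Z"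
  shows "braid_action n (restr Z s) Z"
proof unfold_locales
  show fin: "finite Z" using assms(1) finite_X finite_subset by blast
  show "restr Z s i permutes Z" if "1 \<le> i" "i < n" for i
  proof (rule bij_imp_permutes)
    have "inj_on (restr Z s i) Z" using inj[OF that] by (auto simp: inj_on_def restr_def)
    moreover have "restr Z s i ` Z \<subseteq> Z" using assms(2)[OF that] by (auto simp: restr_def)
    ultimately show "bij_betw (restr Z s i) Z Z"
      using fin by (simp add: bij_betw_def endo_inj_surj)
  qed (auto simp: restr_def)
qed (use assms far braid in \<open>auto simp: restr_def\<close>)

lemma supp_subset: "1 \<le> i \<Longrightarrow> i < n \<Longrightarrow> supp (s i) \<subseteq> X"
  using outside by (auto simp: supp_def)

lemma finite_supp: "1 \<le> i \<Longrightarrow> i < n \<Longrightarrow> finite (supp (s i))"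
  using supp_subset finite_X finite_subset by metis

lemma conj_step:
  assumes "1 \<le> i" "Suc i < n"
  shows "(s i \<circ> s (Suc i)) permutes X" "(s i \<circ> s (Suc i)) (s i x) = s (Suc i) ((s i \<circ> s (Suc i)) x)"
  using assms perm braid by (auto intro: permutes_compose)

lemma conj_step_back:
  assumes "1 \<le> i" "Suc i < n"
  shows "(s (Suc i) \<circ> s i) permutes X" "(s (Suc i) \<circ> s i) (s (Suc i) x) = s i ((s (Suc i) \<circ> s i) x)"
  using assms perm braid by (auto intro: permutes_compose)

lemma single_invariant:
  assumes D: "conj_inv X D" and "1 \<le> i" "i < n"
  shows "D (s i) (s i) = D (s 1) (s 1)"
  using assms(2,3)
proof (induction i rule: dec_induct)
  case (step i)
  have "D (s i) (s i) = D (s (Suc i)) (s (Suc i))"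
    using step by (intro conj_invD[OF D conj_step(1)[of i]] conj_step(2)) auto
  with step show ?case by simp
qed simp

text \<open>Conjugation by a product of three consecutive generators shifts both members of a
  neighbouring pair by one.\<close>

lemma adjacent_invariant:
  assumes D: "conj_inv X D" and "1 \<le> i" "Suc i < n"
  shows "D (s i) (s (Suc i)) = D (s 1) (s 2)"
  using assms(2,3)
proof (induction i rule: dec_induct)
  case base
  then show ?case by (simp add: numeral_2_eq_2)
next
  case (step i)
  let ?w = "s i \<circ> s (Suc i) \<circ> s (Suc (Suc i))"
  have "?w permutes X" using step perm by (intro permutes_compose) auto
  moreover have "?w (s i x) = s (Suc i) (?w x)" for x
    using step far[of i "Suc (Suc i)" x] braid[of i "s (Suc (Suc i)) x"] by auto
  moreover have "?w (s (Suc i) x) = s (Suc (Suc i)) (?w x)" for x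
    using step far[of i "Suc (Suc i)" "s (Suc i) (s (Suc (Suc i)) x)"] braid[of "Suc i" x]
    by auto
  ultimately have "D (s i) (s (Suc i)) = D (s (Suc i)) (s (Suc (Suc i)))"
    by (rule conj_invD[OF D])
  with step show ?case by simp
qed

text \<open>The smaller index is brought to 1, then the larger one to 3. Each shift is a conjugation
  by two neighbouring generators, both of which commute with the other member of the pair.\<close>

lemma far_invariant:
  assumes D: "conj_inv X D" and "1 \<le> i" "i + 2 \<le> j" "j < n"
  shows "D (s i) (s j) = D (s 1) (s 3)"
proof -
  have "D (s i) (s j) = D (s 1) (s j)"
    using assms(2,3)
  proof (induction i rule: dec_induct)
    case (step i)
    have "D (s i) (s j) = D (s (Suc i)) (s j)"
    proof (intro conj_invD[OF D conj_step(1)[of i]] conj_step(2))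
      show "(s i \<circ> s (Suc i)) (s j x) = s j ((s i \<circ> s (Suc i)) x)" for x
        using step \<open>j < n\<close> far[of i j] far[of "Suc i" j] by auto
    qed (use step \<open>j < n\<close> in auto)
    with step show ?case by simp
  qed simp
  also have "3 \<le> j" using assms by simp
  then have "D (s 1) (s j) = D (s 1) (s 3)"
    using assms(4)
  proof (induction j rule: dec_induct)
    case (step j)
    have "D (s 1) (s j) = D (s 1) (s (Suc j))"
    proof (rule conj_invD[OF D conj_step(1)[of j]])
      show "(s j \<circ> s (Suc j)) (s 1 x) = s 1 ((s j \<circ> s (Suc j)) x)" for x
        using step far[of 1 j] far[of 1 "Suc j"] by auto
      show "(s j \<circ> s (Suc j)) (s j x) = s (Suc j) ((s j \<circ> s (Suc j)) x)" for x
        using step by (intro conj_step(2)) auto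
    qed (use step in auto)
    with step show ?case by simp
  qed simp
  finally show ?thesis .
qed

text \<open>Equality is itself an invariant of a pair, so one coincidence of neighbours spreads to
  all of them.\<close>

lemma gens_equal_adjacent:
  assumes "1 \<le> i" "Suc i < n" "s i = s (Suc i)"
  shows "gens_equal n s"
proof -
  have adj: "s j = s (Suc j)" if "1 \<le> j" "Suc j < n" for j
    using adjacent_invariant[OF conj_inv_eq assms(1,2)] adjacent_invariant[OF conj_inv_eq that]
      assms(3) by simp
  have "s j = s 1" if "1 \<le> j" "j < n" for j
    using that
  proof (induction j rule: dec_induct)
    case (step j)
    then show ?case using adj[of j] by simp
  qed simp
  then show ?thesis unfolding gens_equal_def by metis
qed

text \<open>If the generators agree up to a commuting abelian group, then \<open>p = s\<^sub>3 s\<^sub>1\<^sup>-\<^sup>1\<close> and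
  \<open>q = s\<^sub>4 s\<^sub>1\<^sup>-\<^sup>1\<close> commute, but they also satisfy the braid relation, so \<open>p = q\<close>.\<close>

lemma gens_equal_mod_commuting:
  assumes "n \<ge> 5" and t: "\<And>i x. 1 \<le> i \<Longrightarrow> i < n \<Longrightarrow> x \<in> X \<Longrightarrow> s i (t x) = t (s i x)"
    and tX: "\<And>x. x \<in> X \<Longrightarrow> t x \<in> X"
    and mod: "\<And>i j x. 1 \<le> i \<Longrightarrow> i < n \<Longrightarrow> 1 \<le> j \<Longrightarrow> j < n \<Longrightarrow> x \<in> X \<Longrightarrow> \<exists>a. s i x = (t ^^ a) (s j x)"
  shows "gens_equal n s"
proof -
  \<comment> \<open>This is where five strands are needed: \<open>s 3\<close> and \<open>s 4\<close>
    are neighbours, and both are far from \<open>s 1\<close>, so \<open>r\<close> commutes with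
    both.\<close>
  define r where "r = inv_into UNIV (s 1)"
  have s1: "s 1 permutes X" using perm assms(1) by simp
  have r: "s 1 (r x) = x" "r (s 1 x) = x" for x
    using s1 by (simp_all add: r_def permutes_inverses)
  have rX: "r x \<in> X" if "x \<in> X" for x
    using that r(1) in_X[of 1 "r x"] assms(1) by simp
  have s1r: "s i (r x) = r (s i x)" if "i \<in> {3,4}" for i x
  proof -
    have "s 1 (s i (r x)) = s i x" using far[of 1 i "r x"] that assms(1) r(1) by auto
    then show ?thesis by (metis r(2))
  qed
  have tr: "t (r x) = r (t x)" if "x \<in> X" for x
  proof -
    have "s 1 (t (r x)) = t x" using t[of 1 "r x"] r(1) rX[OF that] assms(1) by simp
    then show ?thesis by (metis r(2))
  qed
  define p where "p = s 3 \<circ> r"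
  define q where "q = s 4 \<circ> r"
  have X: "p x \<in> X" "q x \<in> X" if "x \<in> X" for x
    using that rX in_X assms(1) by (auto simp: p_def q_def)
  have pt: "p (t x) = t (p x)" "q (t x) = t (q x)" if "x \<in> X" for x
    using that tr t[of 3 "r x"] t[of 4 "r x"] rX assms(1) by (auto simp: p_def q_def)
  have tnX: "(t ^^ a) x \<in> X" if "x \<in> X" for x a
    by (induction a) (use that tX in auto)
  have ptn: "p ((t ^^ a) x) = (t ^^ a) (p x)" "q ((t ^^ a) x) = (t ^^ a) (q x)" if "x \<in> X" for x a
    by (induction a) (use that pt tnX in auto)
  have pq: "p (q x) = q (p x)" if x: "x \<in> X" for x
  proof -
    obtain a where a: "p x = (t ^^ a) x"
      using mod[of 3 1 "r x"] rX[OF x] r assms(1) by (auto simp: p_def)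
    obtain b where b: "q x = (t ^^ b) x"
      using mod[of 4 1 "r x"] rX[OF x] r assms(1) by (auto simp: q_def)
    have "p (q x) = (t ^^ b) ((t ^^ a) x)" using a b ptn(1)[OF x] by simp
    moreover have "q (p x) = (t ^^ a) ((t ^^ b) x)" using a b ptn(2)[OF x] by simp
    ultimately show ?thesis by (metis add.commute comp_apply funpow_add)
  qed
  \<comment> \<open>The three factors \<open>r\<close> are collected on the right, which leaves the
    braid relation of \<open>s 3\<close> and \<open>s 4\<close>.\<close>
  have br: "p (q (p x)) = q (p (q x))" for x
    using braid[of 3 "r (r (r x))"] assms(1) s1r by (simp add: p_def q_def numeral_eq_Suc)
  have "s 3 x = s 4 x" if x: "x \<in> X" for x
  proof -
    \<comment> \<open>The auxiliary points are chosen so that \<open>q z = s 1 x\<close>.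
      Commutation turns the braid relation at \<open>z\<close> into
      \<open>p (p (q z)) = p (q (q z))\<close>; hence \<open>p\<close> and \<open>q\<close> agree at
      \<open>s 1 x\<close>, which means that \<open>s 3\<close> and \<open>s 4\<close> agree at
      \<open>x\<close>.\<close>
    obtain u where u: "s 4 u = s 1 x"
      using permutes_surj[OF perm[of 4]] assms(1) by (auto simp: surj_def) metis
    have "u \<in> X" using u x in_X[of 4 u] in_X[of 1 x] assms(1) by simp
    define z where "z = s 1 u"
    have z: "z \<in> X" using \<open>u \<in> X\<close> in_X[of 1 u] assms(1) by (simp add: z_def)
    have qz: "q z = s 1 x" using u r by (simp add: q_def z_def)
    have "p (p (q z)) = p (q (q z))"
      using br[of z] pq[OF z] pq[OF X(2)[OF z]] by simp
    then have "p (q z) = q (q z)"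
      using inj[of 3] assms(1) r(1) by (simp add: p_def) (metis r(1))
    then show ?thesis using qz r by (simp add: p_def q_def)
  qed
  moreover have "s 3 x = s 4 x" if "x \<notin> X" for x
    using outside[of 3 x] outside[of 4 x] that assms(1) by simp
  ultimately have "s 3 = s 4" by blast
  then show ?thesis using gens_equal_adjacent[of 3] assms(1) by simp
qed

end

section \<open>Cycles of a commuting permutation\<close>

lemma permutes_funpow_order:
  assumes "t permutes X" "finite X"
  obtains N where "N > 0" "t ^^ N = id"
  using permutation_is_nilpotent[of t] assms permutation_permutes by metis

lemma permutes_funpow: "t permutes X \<Longrightarrow> (t ^^ k) permutes X"
  by (induction k) (simp_all add: permutes_id permutes_compose)

definition cyc :: "('a \<Rightarrow> 'a) \<Rightarrow> 'a \<Rightarrow> 'a set" where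
  "cyc t x = range (\<lambda>k. (t ^^ k) x)"

text \<open>The choice depends only on the set \<open>cyc t x\<close>, so points of one cycle get
  the same representative.\<close>

definition rep :: "('a \<Rightarrow> 'a) \<Rightarrow> 'a \<Rightarrow> 'a" where
  "rep t x = (SOME y. y \<in> cyc t x)"

lemma cyc_self: "x \<in> cyc t x"
  using image_eqI[of x "\<lambda>k. (t ^^ k) x" 0 UNIV] by (simp add: cyc_def)

lemma cyc_funpow: "(t ^^ k) x \<in> cyc t x"
  by (auto simp: cyc_def)

lemma cycE:
  assumes "y \<in> cyc t x"
  obtains k where "y = (t ^^ k) x"
  using assms by (auto simp: cyc_def)

lemma cyc_step:
  assumes "y \<in> cyc t x"
  shows "t y \<in> cyc t x"
proof -
  obtain k where "y = (t ^^ k) x" using assms by (rule cycE)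
  then have "t y = (t ^^ Suc k) x" by simp
  then show ?thesis by (simp only: cyc_funpow)
qed

lemma cyc_step_self: "t x \<in> cyc t x"
  by (simp add: cyc_step cyc_self)

lemma rep_in_cyc: "rep t x \<in> cyc t x"
  unfolding rep_def by (rule someI[of _ x]) (rule cyc_self)

lemma cyc_funpow_subset: "cyc t ((t ^^ m) x) \<subseteq> cyc t x"
proof
  fix z assume "z \<in> cyc t ((t ^^ m) x)"
  then obtain k where "z = (t ^^ (k + m)) x" by (auto simp: funpow_add elim: cycE)
  then show "z \<in> cyc t x" using cyc_funpow by metis
qed

locale finite_perm =
  fixes t :: "'a \<Rightarrow> 'a" and X :: "'a set"
  assumes t: "t permutes X" and fin: "finite X"
begin

lemma t_inj: "t x = t y \<longleftrightarrow> x = y"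
  using permutes_inj[OF t] by (metis injD)

lemma cyc_eq:
  assumes "y \<in> cyc t x"
  shows "cyc t y = cyc t x"
proof -
  obtain k where k: "y = (t ^^ k) x" using assms by (rule cycE)
  obtain N where N: "N > 0" "t ^^ N = id" using permutes_funpow_order[OF t fin] .
  have NN: "(t ^^ (N * m)) z = z" for m z
    using N(2) by (simp add: funpow_mult[symmetric])
  \<comment> \<open>The inverse of \<open>t ^^ k\<close>, written with a natural exponent; the
    subtraction does not truncate because \<open>N > 0\<close>.\<close>
  have "x = (t ^^ (N * k - k)) y"
  proof -
    have "(t ^^ (N * k - k)) y = (t ^^ (N * k - k + k)) x" by (simp add: k funpow_add)
    also have "N * k - k + k = N * k" using N(1) by (cases N) auto
    finally show ?thesis using NN by simp
  qed
  then have "cyc t x \<subseteq> cyc t y"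
    using cyc_funpow_subset by metis
  moreover have "cyc t y \<subseteq> cyc t x"
    unfolding k by (rule cyc_funpow_subset)
  ultimately show ?thesis by blast
qed

lemma cyc_disjoint: "cyc t x \<inter> cyc t y \<noteq> {} \<Longrightarrow> cyc t x = cyc t y"
  using cyc_eq by blast

lemma cyc_sym: "y \<in> cyc t x \<longleftrightarrow> x \<in> cyc t y"
  using cyc_eq cyc_self by metis

lemma rep_eq_iff: "rep t x = rep t y \<longleftrightarrow> y \<in> cyc t x"
proof
  assume "rep t x = rep t y"
  then have "rep t y \<in> cyc t x" using rep_in_cyc by metis
  then show "y \<in> cyc t x" using cyc_eq rep_in_cyc cyc_self by metis
next
  assume "y \<in> cyc t x"
  then show "rep t x = rep t y" using cyc_eq unfolding rep_def by metis
qed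

lemma rep_rep: "rep t (rep t x) = rep t x"
  using rep_eq_iff rep_in_cyc by metis

lemma rep_step: "rep t (t x) = rep t x"
  using rep_eq_iff cyc_step_self by metis

lemma rep_funpow: "rep t ((t ^^ k) x) = rep t x"
  using rep_eq_iff cyc_funpow by metis

lemma funpow_in_X: "(t ^^ k) x \<in> X \<longleftrightarrow> x \<in> X"
  using permutes_in_image[OF permutes_funpow[OF t]] .

lemma cyc_subset: "x \<in> X \<Longrightarrow> cyc t x \<subseteq> X"
  using funpow_in_X by (auto simp: cyc_def)

lemma finite_cyc: "finite (cyc t x)"
proof -
  obtain N where N: "N > 0" "t ^^ N = id" using permutes_funpow_order[OF t fin] .
  have "(t ^^ k) x = (t ^^ (k mod N)) x" for k
  proof -
    have "(t ^^ (k mod N)) (((t ^^ N) ^^ (k div N)) x) = (t ^^ (k mod N + N * (k div N))) x"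
      by (simp only: funpow_mult funpow_add comp_apply)
    then show ?thesis using N(2) by (simp del: mod_mult_div_eq add: mod_mult_div_eq)
  qed
  moreover have "k mod N \<in> {..<N}" for k using N(1) by simp
  ultimately have "cyc t x \<subseteq> (\<lambda>k. (t ^^ k) x) ` {..<N}"
    unfolding cyc_def by blast
  then show ?thesis using finite_subset by blast
qed

lemma supp_t_subset: "supp t \<subseteq> X"
  using permutes_not_in[OF t] by (auto simp: supp_def)

lemma supp_step: "t x \<in> supp t \<longleftrightarrow> x \<in> supp t"
  using t_inj by (auto simp: supp_def)

lemma supp_funpow: "(t ^^ k) x \<in> supp t \<longleftrightarrow> x \<in> supp t"
  by (induction k) (auto simp: supp_step)

lemma cyc_subset_supp: "x \<in> supp t \<Longrightarrow> cyc t x \<subseteq> supp t"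
  using supp_funpow by (auto simp: cyc_def)

lemma rep_in_supp: "rep t x \<in> supp t \<longleftrightarrow> x \<in> supp t"
  using rep_in_cyc[of t x] supp_funpow by (metis cycE)

text \<open>Each nontrivial cycle contains, besides its representative \<open>c\<close>, the
  different point \<open>t c\<close>, which represents no cycle.\<close>

lemma card_reps: "2 * card (rep t ` supp t) \<le> card (supp t)"
proof -
  let ?T = "rep t ` supp t"
  have fs: "finite (supp t)" using supp_t_subset fin finite_subset by blast
  have sub: "?T \<subseteq> supp t" "t ` ?T \<subseteq> supp t" using rep_in_supp supp_step by auto
  have tT: "t c \<notin> ?T" if "c \<in> ?T" for c
  proof
    assume "t c \<in> ?T"
    then have "t c = rep t (t c)" using rep_rep by auto
    also have "\<dots> = c" using that rep_step rep_rep by auto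
    finally show False using that sub(1) by (auto simp: supp_def)
  qed
  have "?T \<inter> t ` ?T = {}"
  proof (intro equals0I, elim IntE imageE[of _ t])
    fix x c assume "x \<in> ?T" "c \<in> ?T" "x = t c"
    with tT[of c] show False by simp
  qed
  then have "card (?T \<union> t ` ?T) = card ?T + card (t ` ?T)"
    using fs sub by (intro card_Un_disjoint) (auto intro: finite_subset)
  moreover have "card (t ` ?T) = card ?T" using t_inj by (simp add: card_image inj_on_def)
  moreover have "card (?T \<union> t ` ?T) \<le> card (supp t)" using fs sub by (intro card_mono) auto
  ultimately show ?thesis by simp
qed

lemma card_cyc_supp: "x \<in> supp t \<Longrightarrow> 2 \<le> card (cyc t x)"
proof -
  assume "x \<in> supp t"
  then have "card {x, t x} = 2" by (auto simp: supp_def)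
  moreover have "{x, t x} \<subseteq> cyc t x" using cyc_self cyc_step_self by auto
  ultimately show ?thesis using card_mono[OF finite_cyc] by metis
qed

end

text \<open>The induced action on the nontrivial cycles of \<open>t\<close>: the cycle of \<open>x\<close> is represented by the
  point \<open>rep t x\<close>, so that the type does not change.\<close>

definition quot :: "('a \<Rightarrow> 'a) \<Rightarrow> (nat \<Rightarrow> 'a \<Rightarrow> 'a) \<Rightarrow> nat \<Rightarrow> 'a \<Rightarrow> 'a" where
  "quot t s i c = (if c \<in> rep t ` supp t then rep t (s i c) else c)"

locale quot_action = braid_action m s X + finite_perm t X
  for m :: nat and s :: "nat \<Rightarrow> 'a \<Rightarrow> 'a" and X :: "'a set" and t :: "'a \<Rightarrow> 'a" +
  assumes comm: "1 \<le> i \<Longrightarrow> i < m \<Longrightarrow> s i (t x) = t (s i x)"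
begin

lemma comm_funpow: "1 \<le> i \<Longrightarrow> i < m \<Longrightarrow> s i ((t ^^ k) x) = (t ^^ k) (s i x)"
  by (induction k) (auto simp: comm)

lemma cyc_image: "1 \<le> i \<Longrightarrow> i < m \<Longrightarrow> s i ` cyc t x = cyc t (s i x)"
  unfolding cyc_def by (simp add: image_image comm_funpow)

lemma in_cyc_iff:
  assumes "1 \<le> i" "i < m"
  shows "s i y \<in> cyc t (s i x) \<longleftrightarrow> y \<in> cyc t x"
  unfolding cyc_image[OF assms, symmetric] using inj[OF assms] by auto

lemma card_cyc: "1 \<le> i \<Longrightarrow> i < m \<Longrightarrow> card (cyc t (s i x)) = card (cyc t x)"
  using card_image[of "s i" "cyc t x"] cyc_image[of i x] inj[of i] by (simp add: inj_on_def)

lemma rep_cong: "1 \<le> i \<Longrightarrow> i < m \<Longrightarrow> rep t (s i (rep t x)) = rep t (s i x)"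
  using rep_eq_iff[of "s i x" "s i (rep t x)"] in_cyc_iff[of i "rep t x" x] rep_in_cyc[of t x] by simp

lemma in_supp: "1 \<le> i \<Longrightarrow> i < m \<Longrightarrow> s i x \<in> supp t \<longleftrightarrow> x \<in> supp t"
  using comm[of i x] inj[of i] by (auto simp: supp_def)

lemma quot_rep:
  assumes "1 \<le> i" "i < m" "x \<in> supp t"
  shows "quot t s i (rep t x) = rep t (s i x)"
  using assms rep_cong by (simp add: quot_def)

lemma quot_action: "braid_action m (quot t s) (rep t ` supp t)"
proof unfold_locales
  let ?T = "rep t ` supp t"
  show fT: "finite ?T" using finite_subset[OF supp_t_subset fin] by simp
  have inT: "quot t s i c \<in> ?T" if i: "1 \<le> i" "i < m" and c: "c \<in> ?T" for i c
  proof -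
    obtain x where "x \<in> supp t" "c = rep t x" using c by blast
    then show ?thesis using i by (simp add: quot_rep in_supp)
  qed
  show "quot t s i permutes ?T" if i: "1 \<le> i" "i < m" for i
  proof (rule bij_imp_permutes)
    have "inj_on (quot t s i) ?T"
    proof (rule inj_onI)
      fix c d assume cd: "c \<in> ?T" "d \<in> ?T" "quot t s i c = quot t s i d"
      then obtain x y where xy: "x \<in> supp t" "y \<in> supp t" "c = rep t x" "d = rep t y" by blast
      then have "rep t (s i x) = rep t (s i y)" using cd(3) by (simp only: quot_rep[OF i])
      then show "c = d" using xy(3,4) rep_eq_iff in_cyc_iff[OF i] by blast
    qed
    then show "bij_betw (quot t s i) ?T ?T"
      using fT inT[OF i] by (simp add: bij_betw_def endo_inj_surj image_subsetI)
  qed (simp only: quot_def if_False)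
  fix i x
  show "quot t s i (quot t s j x) = quot t s j (quot t s i x)" if "1 \<le> i" "i + 2 \<le> j" "j < m" for j
  proof (cases "x \<in> ?T")
    case True
    then obtain y where y: "y \<in> supp t" "x = rep t y" by blast
    have "1 \<le> j" "i < m" using that by auto
    then show ?thesis using that y far[OF that, of y] by (simp add: quot_rep in_supp del: One_nat_def)
  qed (simp only: quot_def if_False)
  show "quot t s i (quot t s (Suc i) (quot t s i x)) = quot t s (Suc i) (quot t s i (quot t s (Suc i) x))"
    if "1 \<le> i" "Suc i < m"
  proof (cases "x \<in> ?T")
    case True
    then obtain y where y: "y \<in> supp t" "x = rep t y" by blast
    have "1 \<le> Suc i" "i < m" using that by auto
    then show ?thesis using that y braid[OF that, of y] by (simp add: quot_rep in_supp del: One_nat_def)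
  qed (simp only: quot_def if_False)
qed

text \<open>Generators that permute the cycles alike differ by a power of \<open>t\<close> at each
  moved point, which is the situation of \<open>gens_equal_mod_commuting\<close>.\<close>

lemma quot_equal_imp_agree:
  assumes eq: "gens_equal m (quot t s)" and "m \<ge> 5"
    and ij: "1 \<le> i" "i < m" "1 \<le> j" "j < m" and x: "x \<in> supp t"
  shows "s i x = s j x"
proof -
  interpret Y: braid_action m "restr (supp t) s" "supp t"
    by (intro restr_action supp_t_subset) (simp only: in_supp)
  have "gens_equal m (restr (supp t) s)"
  proof (rule Y.gens_equal_mod_commuting[where t = t])
    show "restr (supp t) s i (t x) = t (restr (supp t) s i x)"
      if "1 \<le> i" "i < m" "x \<in> supp t" for i x
      using that by (simp add: restr_def supp_step comm)
    show "\<exists>a. restr (supp t) s i x = (t ^^ a) (restr (supp t) s j x)"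
      if h: "1 \<le> i" "i < m" "1 \<le> j" "j < m" "x \<in> supp t" for i j x
    proof -
      have "quot t s i (rep t x) = quot t s j (rep t x)" using eq h unfolding gens_equal_def by metis
      then have "rep t (s j x) = rep t (s i x)" using h by (simp only: quot_rep)
      then have "s i x \<in> cyc t (s j x)" by (simp only: rep_eq_iff)
      then obtain a where "s i x = (t ^^ a) (s j x)" by (rule cycE)
      then show ?thesis using h(5) by (auto simp: restr_def)
    qed
  qed (use \<open>m \<ge> 5\<close> supp_step in auto)
  then have "restr (supp t) s i = restr (supp t) s j" using ij unfolding gens_equal_def by blast
  then show ?thesis using x by (metis restr_def)
qed

end

section \<open>Generators with disjoint supports\<close>

definition standard_on :: "nat \<Rightarrow> (nat \<Rightarrow> 'a \<Rightarrow> 'a) \<Rightarrow> 'a set \<Rightarrow> (nat \<Rightarrow> 'a) \<Rightarrow> bool" where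
  "standard_on n s X a \<longleftrightarrow> inj_on a {1..n} \<and> a ` {1..n} \<subseteq> X \<and>
    (\<forall>i. 1 \<le> i \<longrightarrow> i < n \<longrightarrow> s i (a i) = a (Suc i) \<and> s i (a (Suc i)) = a i) \<and>
    (\<forall>i j. 1 \<le> i \<longrightarrow> i < n \<longrightarrow> 1 \<le> j \<longrightarrow> j \<le> n \<longrightarrow> j \<noteq> i \<longrightarrow> j \<noteq> Suc i \<longrightarrow> s i (a j) = a j) \<and>
    (\<forall>i j x. 1 \<le> i \<longrightarrow> i < n \<longrightarrow> 1 \<le> j \<longrightarrow> j < n \<longrightarrow> x \<notin> a ` {1..n} \<longrightarrow> s i x = s j x)"

definition block_system :: "nat \<Rightarrow> (nat \<Rightarrow> 'a \<Rightarrow> 'a) \<Rightarrow> 'a set \<Rightarrow> (nat \<Rightarrow> 'a set) \<Rightarrow> bool" where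
  "block_system n s X D \<longleftrightarrow>
    (\<forall>i. 1 \<le> i \<longrightarrow> i \<le> n \<longrightarrow> 2 * card (D i) = card (supp (s 1)) \<and> D i \<subseteq> X) \<and>
    (\<forall>i j. 1 \<le> i \<longrightarrow> i < j \<longrightarrow> j \<le> n \<longrightarrow> D i \<inter> D j = {}) \<and>
    (\<forall>i. 1 \<le> i \<longrightarrow> i < n \<longrightarrow>
      supp (s i) = D i \<union> D (Suc i) \<and> s i ` D i = D (Suc i) \<and> s i ` D (Suc i) = D i)"

lemma block_systemD:
  assumes "block_system n s X D"
  shows "1 \<le> i \<Longrightarrow> i \<le> n \<Longrightarrow> 2 * card (D i) = card (supp (s 1))"
    "1 \<le> i \<Longrightarrow> i \<le> n \<Longrightarrow> D i \<subseteq> X"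
    "1 \<le> i \<Longrightarrow> i < j \<Longrightarrow> j \<le> n \<Longrightarrow> D i \<inter> D j = {}"
    "1 \<le> i \<Longrightarrow> i < n \<Longrightarrow> supp (s i) = D i \<union> D (Suc i)"
    "1 \<le> i \<Longrightarrow> i < n \<Longrightarrow> s i ` D i = D (Suc i)"
    "1 \<le> i \<Longrightarrow> i < n \<Longrightarrow> s i ` D (Suc i) = D i"
  using assms by (simp_all add: block_system_def)

context braid_action
begin

lemma supp_step: "1 \<le> i \<Longrightarrow> i < n \<Longrightarrow> s i x \<in> supp (s i) \<longleftrightarrow> x \<in> supp (s i)"
  using inj by (auto simp: supp_def)

lemma far_supp:
  "1 \<le> i \<Longrightarrow> 1 \<le> j \<Longrightarrow> i < n \<Longrightarrow> j < n \<Longrightarrow> i + 2 \<le> j \<or> j + 2 \<le> i \<Longrightarrow>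
    s i x \<in> supp (s j) \<longleftrightarrow> x \<in> supp (s j)"
  using far_sym[of j i x] inj[of i] by (auto simp: supp_def)

lemma supp_image: "1 \<le> i \<Longrightarrow> i < n \<Longrightarrow> s i ` supp (s i) = supp (s i)"
proof -
  assume i: "1 \<le> i" "i < n"
  have "s i ` supp (s i) \<subseteq> supp (s i)" using supp_step[OF i] by auto
  moreover have "inj_on (s i) (supp (s i))" using inj[OF i] by (simp add: inj_on_def)
  ultimately show ?thesis using finite_supp[OF i] by (simp add: endo_inj_surj)
qed

text \<open>If \<open>s (Suc i)\<close> fixed both \<open>x\<close> and \<open>s i x\<close>, the
  braid relation at \<open>x\<close> would reduce to \<open>s i (s i x) = s i x\<close>.\<close>

lemma supp_adjacent:
  assumes "1 \<le> i" "Suc i < n"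
  shows "x \<in> supp (s i) \<Longrightarrow> x \<notin> supp (s (Suc i)) \<Longrightarrow> s i x \<in> supp (s (Suc i))"
    and "x \<in> supp (s (Suc i)) \<Longrightarrow> x \<notin> supp (s i) \<Longrightarrow> s (Suc i) x \<in> supp (s i)"
proof -
  have i: "1 \<le> i" "i < n" "1 \<le> Suc i" using assms by auto
  show "x \<in> supp (s i) \<Longrightarrow> x \<notin> supp (s (Suc i)) \<Longrightarrow> s i x \<in> supp (s (Suc i))"
    using braid[OF assms, of x] inj[OF i(1,2)] by (auto simp: supp_def)
  show "x \<in> supp (s (Suc i)) \<Longrightarrow> x \<notin> supp (s i) \<Longrightarrow> s (Suc i) x \<in> supp (s i)"
    using braid[OF assms, of x] inj[OF i(3) assms(2)] by (auto simp: supp_def)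
qed

lemma card_adjacent_inter:
  assumes i: "1 \<le> i" "Suc i < n"
  shows "card (supp (s i)) \<le> 2 * card (supp (s i) \<inter> supp (s (Suc i)))"
proof -
  let ?S = "\<lambda>i. supp (s i)"
  have i': "i < n" using i by simp
  have "s i ` (?S i - ?S (Suc i)) \<subseteq> ?S i \<inter> ?S (Suc i)"
    using supp_step[OF i(1) i'] supp_adjacent(1)[OF i] by auto
  moreover have "inj_on (s i) (?S i - ?S (Suc i))" using inj[OF i(1) i'] by (simp add: inj_on_def)
  ultimately have "card (?S i - ?S (Suc i)) \<le> card (?S i \<inter> ?S (Suc i))"
    using finite_supp[OF i(1) i'] by (intro card_inj_on_le) auto
  moreover have "card (?S i) = card (?S i - ?S (Suc i)) + card (?S i \<inter> ?S (Suc i))"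
    using finite_supp[OF i(1) i'] by (metis Diff_Int2 Int_absorb card_Diff_subset_Int card_Int_Diff add.commute)
  ultimately show ?thesis by simp
qed

lemma swap_image:
  assumes "1 \<le> i" "i < n" "supp (s i) = A \<union> B" "A \<inter> B = {}" "s i ` A = B"
  shows "s i ` B = A"
proof -
  have "s i ` A \<inter> s i ` B = {}" using assms(4) inj[OF assms(1,2)] by auto
  moreover have "s i ` A \<union> s i ` B = A \<union> B" using supp_image[OF assms(1,2)] assms(3) by auto
  ultimately show ?thesis using assms(4,5) by blast
qed

text \<open>A point of \<open>supp s\<^sub>i\<close> outside \<open>supp s\<^bsub>i+1\<^esub>\<close> is moved into \<open>supp s\<^bsub>i+1\<^esub>\<close>, so consecutive
  supports meet in at least half of their points; disjointness of the far ones gives equality.\<close>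

lemma disjoint_supports_blocks:
  assumes n: "n \<ge> 4"
    and disj: "\<And>i j. 1 \<le> i \<Longrightarrow> i + 2 \<le> j \<Longrightarrow> j < n \<Longrightarrow> supp (s i) \<inter> supp (s j) = {}"
  shows "\<exists>D. block_system n s X D"
proof -
  let ?S = "\<lambda>i. supp (s i)"
  define C where "C i = ?S i \<inter> ?S (Suc i)" for i
  define d where "d = card (?S 1)"
  have d: "card (?S i) = d" if "1 \<le> i" "i < n" for i
    using single_invariant[OF conj_inv_supp_card that] by (simp add: d_def)
  have fC: "finite (C i)" if "1 \<le> i" "i < n" for i using finite_supp[OF that] by (simp add: C_def)
  have low: "d \<le> 2 * card (C i)" if "1 \<le> i" "Suc i < n" for i
    using card_adjacent_inter[OF that] d[of i] that by (simp add: C_def)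
  have CC: "C i \<inter> C (Suc i) = {}" if "1 \<le> i" "Suc (Suc i) < n" for i
    using disj[of i "Suc (Suc i)"] that by (auto simp: C_def)
  have up: "card (C i) + card (C (Suc i)) \<le> d" if "1 \<le> i" "Suc (Suc i) < n" for i
  proof -
    have "card (C i) + card (C (Suc i)) = card (C i \<union> C (Suc i))"
      using CC[OF that] fC that by (simp add: card_Un_disjoint)
    also have "\<dots> \<le> card (?S (Suc i))"
      using that finite_supp by (intro card_mono) (auto simp: C_def)
    finally show ?thesis using d that by simp
  qed
  \<comment> \<open>Two consecutive intersections are disjoint, lie in one support and have at least
    half of its size, so each has exactly half. The last index is paired with its
    predecessor.\<close>
  have cC: "2 * card (C i) = d" if i: "1 \<le> i" "Suc i < n" for i
  proof (cases "Suc (Suc i) < n")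
    case True
    then show ?thesis using low[of i] low[of "Suc i"] up[of i] i by simp
  next
    case False
    then obtain k where k: "i = Suc k" "1 \<le> k" using n by (cases i) auto
    then show ?thesis using low[of k] low[of i] up[of k] i by simp
  qed
  \<comment> \<open>An inner block is the common part of the two supports around it; an end block is
    what the first or the last support has left over.\<close>
  define D where "D i = (if i = 1 then ?S 1 - ?S 2 else if i = n then ?S (n - 1) - ?S (n - 2) else C (i - 1))" for i
  have DC: "D (Suc i) = C i" if "1 \<le> i" "Suc i < n" for i using that by (simp add: D_def)
  have D1: "D 1 = ?S 1 - C 1" by (auto simp: D_def C_def numeral_2_eq_2)
  have Dn: "D n = ?S (n - 1) - C (n - 2)"
  proof -
    have "Suc (n - 2) = n - 1" using n by simp
    then show ?thesis using n by (auto simp: D_def C_def)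
  qed
  have cD: "2 * card (D i) = d" if i: "1 \<le> i" "i \<le> n" for i
  proof -
    have aux: "2 * card (?S j - C k) = d" if "C k \<subseteq> ?S j" "1 \<le> j" "j < n" "1 \<le> k" "Suc k < n" for j k
      using card_Diff_subset[OF fC[of k] that(1)] d[of j] cC[of k] that by simp
    show ?thesis
    proof (cases "i = 1")
      case True
      then show ?thesis using aux[of 1 1] D1 n by (simp add: C_def)
    next
      case i1: False
      show ?thesis
      proof (cases "i = n")
        case True
        have "Suc (n - 2) = n - 1" using n by simp
        then show ?thesis using aux[of "n - 2" "n - 1"] Dn n True by (simp add: C_def)
      next
        case False
        obtain k where "i = Suc k" using i by (cases i) auto
        then show ?thesis using DC[of k] cC[of k] i i1 False by simp
      qed
    qed
  qed
  have S: "?S i = D i \<union> D (Suc i) \<and> D i \<inter> D (Suc i) = {}" if i: "1 \<le> i" "i < n" for i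
  proof -
    consider "i = 1" | "Suc i = n" "i \<noteq> 1" | "i \<noteq> 1" "Suc i < n"
      using i by linarith
    then show ?thesis
    proof cases
      case 1
      then show ?thesis using D1 DC[of 1] n by (auto simp: C_def)
    next
      case 2
      then obtain k where "n = Suc (Suc k)" "i = Suc k" using n by (cases i) auto
      then show ?thesis using Dn DC[of k] n by (auto simp: C_def)
    next
      case c: 3
      obtain k where "i = Suc k" using i by (cases i) auto
      with c i have 3: "i = Suc k" "1 \<le> k" "Suc i < n" by auto
      have "card (C k \<union> C i) = card (?S i)"
        using card_Un_disjoint[OF fC[of k] fC[of i]] CC[of k] 3 cC[of k] cC[of i] d[of i] by simp
      then have "C k \<union> C i = ?S i"
        using 3 finite_supp[of i] by (intro card_subset_eq) (auto simp: C_def)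
      then show ?thesis using DC[of k] DC[of i] 3 CC[of k] by auto
    qed
  qed
  have sub: "D i \<subseteq> X" if "1 \<le> i" "i \<le> n" for i
  proof (cases "i = n")
    case True
    then show ?thesis using S[of "n - 1"] supp_subset[of "n - 1"] n by auto
  next
    case False
    then show ?thesis using S[of i] supp_subset[of i] that by auto
  qed
  have eqD: "s i ` D j = D k" if i: "1 \<le> i" "i < n" and j: "1 \<le> j" "j \<le> n" and k: "1 \<le> k" "k \<le> n"
    and sb: "s i ` D j \<subseteq> D k" for i j k
  proof (rule card_subset_eq[OF _ sb])
    show "finite (D k)" using sub[OF k] finite_X finite_subset by blast
    have "card (s i ` D j) = card (D j)" using inj[OF i] by (simp add: card_image inj_on_def)
    then show "card (s i ` D j) = card (D k)" using cD[OF j] cD[OF k] by simp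
  qed
  have img: "s i ` D i = D (Suc i) \<and> s i ` D (Suc i) = D i" if i: "1 \<le> i" "i < n" for i
  proof (cases "Suc i < n")
    case True
    have Dk: "D (Suc i) = C i" using DC True i by simp
    have "s i ` D i \<subseteq> D (Suc i)"
    proof (rule subsetI)
      fix y assume "y \<in> s i ` D i"
      then obtain x where x: "y = s i x" "x \<in> D i" by auto
      then have "x \<in> ?S i" "x \<notin> ?S (Suc i)" using S[OF i] Dk by (auto simp: C_def)
      then show "y \<in> D (Suc i)"
        using supp_adjacent(1)[of i x] supp_step[OF i] i True x Dk by (auto simp: C_def)
    qed
    then have "s i ` D i = D (Suc i)" using eqD[of i i "Suc i"] i by simp
    then show ?thesis using swap_image[OF i] S[OF i] by blast
  next
    case False
    then have ni: "n = Suc i" using i by simp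
    obtain k where k: "i = Suc k" "1 \<le> k" using ni n by (cases i) auto
    have Dk: "D i = C k" using DC[of k] k ni by simp
    have "s i ` D (Suc i) \<subseteq> D i"
    proof
      fix y assume "y \<in> s i ` D (Suc i)"
      then obtain x where x: "y = s i x" "x \<in> D (Suc i)" by auto
      then have "x \<in> ?S (Suc k)" "x \<notin> ?S k" using S[OF i] Dk k by (auto simp: C_def)
      then show "y \<in> D i"
        using supp_adjacent(2)[of k x] supp_step[OF i] i k ni x Dk by (auto simp: C_def)
    qed
    then have "s i ` D (Suc i) = D i" using eqD[of i "Suc i" i] i by simp
    then show ?thesis using swap_image[OF i, of "D (Suc i)" "D i"] S[OF i] by blast
  qed
  have dis: "D i \<inter> D j = {}" if ij: "1 \<le> i" "i < j" "j \<le> n" for i j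
  proof -
    have iS: "D i \<subseteq> ?S i" using S[of i] ij by auto
    obtain k where k: "j = Suc k" using ij by (cases j) auto
    have jS: "D j \<subseteq> ?S k" using S[of k] ij k by auto
    consider "j = Suc i" | "j = i + 2" | "i + 2 \<le> k" using ij k by linarith
    then show ?thesis
    proof cases
      case 1
      then show ?thesis using S[of i] ij by simp
    next
      case 2
      show ?thesis
      proof (cases "j = n")
        case True
        then have "i = n - 2" using 2 by simp
        moreover obtain k where "n = Suc (Suc k)" using n by (cases n; cases "n - 1") auto
        ultimately have "D j \<inter> ?S i = {}" using Dn True by (auto simp: C_def)
        then show ?thesis using iS by auto
      next
        case False
        then have "D j \<subseteq> ?S j" using S[of j] ij by auto
        then show ?thesis using disj[of i j] 2 ij False iS by fastforce
      qed
    next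
      case 3
      then show ?thesis using disj[of i k] ij k iS jS by fastforce
    qed
  qed
  have "block_system n s X D"
    unfolding block_system_def using cD sub dis S img by (simp add: d_def)
  then show ?thesis by blast
qed

lemma card_UN_blocks:
  fixes D :: "nat \<Rightarrow> 'a set"
  assumes "\<And>i. 1 \<le> i \<Longrightarrow> i \<le> n \<Longrightarrow> D i \<subseteq> X" "\<And>i. 1 \<le> i \<Longrightarrow> i \<le> n \<Longrightarrow> card (D i) = m"
    and "\<And>i j. 1 \<le> i \<Longrightarrow> i < j \<Longrightarrow> j \<le> n \<Longrightarrow> D i \<inter> D j = {}"
  shows "card (\<Union>i\<in>{1..n}. D i) = n * m"
proof -
  have "card (\<Union>i\<in>{1..n}. D i) = (\<Sum>i\<in>{1..n}. card (D i))"
  proof (rule card_UN_disjoint)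
    show "\<forall>i\<in>{1..n}. finite (D i)" using finite_subset[OF assms(1) finite_X] by auto
    show "\<forall>i\<in>{1..n}. \<forall>j\<in>{1..n}. i \<noteq> j \<longrightarrow> D i \<inter> D j = {}"
    proof (intro ballI impI)
      fix i j assume "i \<in> {1..n}" "j \<in> {1..n}" "i \<noteq> j"
      then show "D i \<inter> D j = {}" using assms(3)[of i j] assms(3)[of j i] by (cases "i < j") auto
    qed
  qed simp
  also have "\<dots> = n * m" using assms(2) by simp
  finally show ?thesis .
qed

text \<open>Intersections of far supports all have the same size, and the agreement hypothesis makes
  them one set \<open>A\<close>. The generators coincide on \<open>A\<close>; off \<open>A\<close>
  far supports are disjoint, so there are blocks of \<open>m\<close> points with
  \<open>n * m \<le> card X < 2 * n\<close>. For \<open>m = 0\<close> the generators are equal, for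
  \<open>m = 1\<close> the action is standard.\<close>

lemma equal_off_common_support:
  assumes n: "n \<ge> 7" and card_X: "card X < 2 * n"
    and agree: "\<And>i j x. 1 \<le> i \<Longrightarrow> i + 2 < n \<Longrightarrow> 1 \<le> j \<Longrightarrow> j + 2 < n \<Longrightarrow> x \<in> supp (s (n - 1)) \<Longrightarrow> s i x = s j x"
  shows "gens_equal n s \<or> (\<exists>a. standard_on n s X a)"
proof -
  let ?S = "\<lambda>i. supp (s i)"
  define A where "A = ?S 1 \<inter> ?S (n - 1)"
  have cA: "card (?S i \<inter> ?S j) = card A" if "1 \<le> i" "i + 2 \<le> j" "j < n" for i j
  proof -
    have "card (?S i \<inter> ?S j) = card (?S 1 \<inter> ?S 3)"
      using far_invariant[OF conj_inv_inter_card that] .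
    also have "\<dots> = card A"
      using far_invariant[OF conj_inv_inter_card, of 1 "n - 1"] n by (simp add: A_def)
    finally show ?thesis .
  qed
  have fin: "finite (?S i \<inter> ?S j)" if "1 \<le> i" "i < n" for i j
    using finite_supp[OF that] by simp
  have eqA: "?S i \<inter> ?S j = A" if "1 \<le> i" "i + 2 \<le> j" "j < n" "A \<subseteq> ?S i" "A \<subseteq> ?S j" for i j
    using that cA[of i j] fin[of i j] card_subset_eq[of "?S i \<inter> ?S j" A] by simp
  have sub1: "A \<subseteq> ?S i" if "1 \<le> i" "i + 2 < n" for i
    using agree[of i 1] that n by (auto simp: A_def supp_def)
  have sub2: "A \<subseteq> ?S (n - 1)" by (auto simp: A_def)
  \<comment> \<open>The hypothesis concerns the support of \<open>s (n - 1)\<close> only.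
    Conjugation by \<open>w\<close> carries \<open>s (n - 1)\<close> to \<open>s (n - 2)\<close> and
    leaves \<open>s 1\<close> and \<open>s 3\<close> alone; for \<open>s 3\<close> this uses
    \<open>n \<ge> 7\<close>.\<close>
  have sub3: "A \<subseteq> ?S (n - 2)"
  proof -
    define w where "w = s (n - 1) \<circ> s (n - 2)"
    have n1: "Suc (n - 2) = n - 1" using n by simp
    have w: "w permutes X" "w (s (n - 1) x) = s (n - 2) (w x)" for x
      using conj_step_back[of "n - 2"] n n1 by (simp_all add: w_def)
    have ws: "w (s i x) = s i (w x)" if "i = 1 \<or> i = 3" for i x
      using far[of i "n - 2"] far[of i "n - 1"] that n by (auto simp: w_def)
    have "?S 1 \<inter> ?S (n - 2) \<subseteq> ?S 3"
    proof
      fix y assume y: "y \<in> ?S 1 \<inter> ?S (n - 2)"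
      obtain x where x: "y = w x" using permutes_surj[OF w(1)] by (metis surjD)
      have wi: "w u = w v \<longleftrightarrow> u = v" for u v using permutes_inj[OF w(1)] by (metis injD)
      have "x \<in> ?S (n - 1)" using y x w(2)[of x] wi by (auto simp: supp_def)
      then have "s 1 x = s 3 x" using agree[of 1 3 x] n by simp
      then have "s 1 y = s 3 y" using x ws by metis
      then show "y \<in> ?S 3" using y by (auto simp: supp_def)
    qed
    then have "?S 1 \<inter> ?S (n - 2) \<subseteq> A"
      using eqA[of 1 3] sub1[of 1] sub1[of 3] n by auto
    moreover have "finite A" using fin[of 1 "n - 1"] n by (simp add: A_def)
    ultimately have "?S 1 \<inter> ?S (n - 2) = A" using cA[of 1 "n - 2"] n by (intro card_subset_eq) auto
    then show ?thesis by blast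
  qed
  have sub: "A \<subseteq> ?S i" if i: "1 \<le> i" "i < n" for i
  proof -
    consider "i + 2 < n" | "i = n - 1" | "i = n - 2" using i by linarith
    then show ?thesis using sub1 sub2 sub3 i by cases auto
  qed
  have far_A: "?S i \<inter> ?S j = A" if "1 \<le> i" "i + 2 \<le> j" "j < n" for i j
    using eqA[OF that] sub that by simp
  \<comment> \<open>A generator preserves its own support and that of a far generator, and
    \<open>A\<close> is the intersection of two such supports.\<close>
  have A_inv: "s i x \<in> A \<longleftrightarrow> x \<in> A" if i: "1 \<le> i" "i < n" for i x
  proof -
    define j where "j = (if i \<ge> 3 then 1 else i + 2)"
    have j: "1 \<le> j" "j < n" "i + 2 \<le> j \<or> j + 2 \<le> i" using n i by (auto simp: j_def)
    have "?S i \<inter> ?S j = A" using far_A[of i j] far_A[of j i] i j by auto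
    then show ?thesis using supp_step[OF i] far_supp[of i j x] i j by auto
  qed
  have AX: "A \<subseteq> X" using supp_subset[of 1] n by (auto simp: A_def)
  interpret P: braid_action n "restr A s" A
    using A_inv by (intro restr_action AX) auto
  interpret Q: braid_action n "restr (X - A) s" "X - A"
    using A_inv in_X by (intro restr_action) auto
  have "restr A s 1 = restr A s (Suc 1)"
  proof
    fix x
    show "restr A s 1 x = restr A s (Suc 1) x"
      using agree[of 1 "Suc 1" x] sub2 n by (auto simp: restr_def)
  qed
  then have "gens_equal n (restr A s)"
    using n by (intro P.gens_equal_adjacent[of 1]) auto
  then have eq_A: "s i x = s j x" if "1 \<le> i" "i < n" "1 \<le> j" "j < n" "x \<in> A" for i j x
    using that unfolding gens_equal_def by (metis restr_def)
  have supp_Q: "supp (restr (X - A) s i) = ?S i - A" if "1 \<le> i" "i < n" for i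
    using supp_subset[OF that] by (auto simp: supp_def restr_def)
  have disj: "supp (restr (X - A) s i) \<inter> supp (restr (X - A) s j) = {}" if "1 \<le> i" "i + 2 \<le> j" "j < n" for i j
    using that supp_Q[of i] supp_Q[of j] far_A[OF that] by auto
  have n4: "n \<ge> 4" using n by simp
  obtain D where "block_system n (restr (X - A) s) (X - A) D"
    using Q.disjoint_supports_blocks[OF n4 disj] by blast
  note D = block_systemD[OF this]
  define m where "m = card (D 1)"
  have m: "card (D i) = m" if "1 \<le> i" "i \<le> n" for i
    using D(1)[OF that] D(1)[of 1] n by (simp add: m_def)
  have "n * m = card (\<Union>i\<in>{1..n}. D i)"
    using Q.card_UN_blocks[OF D(2) m D(3)] by simp
  also have "\<dots> \<le> card X"
  proof (intro card_mono finite_X UN_least)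
    show "D i \<subseteq> X" if "i \<in> {1..n}" for i using D(2)[of i] that by auto
  qed
  finally have "n * m < n * 2" using card_X by linarith
  then have m2: "m < 2" by simp
  have fixes_rest: "s i x = x" if "1 \<le> i" "i < n" "x \<notin> A" "x \<notin> D i" "x \<notin> D (Suc i)" for i x
    using supp_Q[of i] D(4)[of i] that by (auto simp: supp_def)
  show ?thesis
  proof (cases "m = 0")
    case True
    have "D i = {}" if "1 \<le> i" "i \<le> n" for i
      using m[OF that] True finite_subset[OF D(2)[OF that]] finite_X by simp
    then have "s i x = s j x" if "1 \<le> i" "i < n" "1 \<le> j" "j < n" for i j x
      using that fixes_rest[of i x] fixes_rest[of j x] eq_A[of i j x] by (cases "x \<in> A") auto
    then show ?thesis unfolding gens_equal_def by blast
  next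
    case False
    then have "m = 1" using m2 by simp
    define a where "a i = (THE x. D i = {x})" for i
    have a: "D i = {a i}" if "1 \<le> i" "i \<le> n" for i
    proof -
      have "card (D i) = 1" using m[OF that] \<open>m = 1\<close> by simp
      then obtain x where "D i = {x}" by (rule card_1_singletonE)
      then show ?thesis by (simp add: a_def)
    qed
    have aA: "a i \<in> X" "a i \<notin> A" if "1 \<le> i" "i \<le> n" for i using D(2)[OF that] a[OF that] by auto
    have dist: "a i \<noteq> a j" if "1 \<le> i" "i \<le> n" "1 \<le> j" "j \<le> n" "i \<noteq> j" for i j
      using D(3)[of i j] D(3)[of j i] a[of i] a[of j] that by (cases "i < j") auto
    have "standard_on n s X a"
      unfolding standard_on_def
    proof (intro conjI allI impI)
      show "inj_on a {1..n}"
      proof (rule inj_onI)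
        fix i j assume "i \<in> {1..n}" "j \<in> {1..n}" "a i = a j"
        then show "i = j" using dist[of i j] by auto
      qed
      show "a ` {1..n} \<subseteq> X" using aA by auto
      fix i assume i: "1 \<le> i" "i < n"
      have "a i \<in> X - A" "a (Suc i) \<in> X - A" using aA[of i] aA[of "Suc i"] i by auto
      then show "s i (a i) = a (Suc i)" "s i (a (Suc i)) = a i"
        using D(5)[OF i] D(6)[OF i] a[of i] a[of "Suc i"] i by (auto simp: restr_def)
      fix j :: nat assume j: "1 \<le> j"
      show "s i (a j) = a j" if "j \<le> n" "j \<noteq> i" "j \<noteq> Suc i"
        using fixes_rest[of i "a j"] aA[of j] a[of i] a[of "Suc i"] dist[of j i] dist[of j "Suc i"] i j that
        by simp
      fix x assume j': "j < n" and x: "x \<notin> a ` {1..n}"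
      have "x \<notin> D k" if "1 \<le> k" "k \<le> n" for k using a[OF that] that x by auto
      then show "s i x = s j x"
        using fixes_rest[of i x] fixes_rest[of j x] eq_A[of i j x] i j j' by (cases "x \<in> A") auto
    qed
    then show ?thesis by blast
  qed
qed

lemma quot_action_far:
  assumes "1 \<le> j" "j < n" "m < j"
  shows "quot_action m s X (s j)"
proof (intro quot_action.intro sub_action finite_perm.intro quot_action_axioms.intro)
  show "s i (s j x) = s j (s i x)" if "1 \<le> i" "i < m" for i x
    using that assms by (intro far) auto
qed (use assms perm finite_X in auto)

lemma quot_action_last: "n \<ge> 2 \<Longrightarrow> quot_action (n - 2) s X (s (n - 1))"
  by (intro quot_action_far) auto

lemma equal_on_cycles:
  assumes n: "n \<ge> 7" and card_X: "card X < 2 * n"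
    and eq: "gens_equal (n - 2) (quot (s (n - 1)) s)"
  shows "gens_equal n s \<or> (\<exists>a. standard_on n s X a)"
proof (rule equal_off_common_support[OF n card_X])
  interpret q: quot_action "n - 2" s X "s (n - 1)" using n by (intro quot_action_last) simp
  show "s i x = s j x" if "1 \<le> i" "i + 2 < n" "1 \<le> j" "j + 2 < n" "x \<in> supp (s (n - 1))" for i j x
    using q.quot_equal_imp_agree[OF eq, of i j x] that n by simp
qed

end

lemma standard_on_card:
  assumes "standard_on n s X a" "finite X"
  shows "n \<le> card X"
proof -
  have "card (a ` {1..n}) = n" using assms(1) by (simp add: standard_on_def card_image)
  moreover have "a ` {1..n} \<subseteq> X" using assms(1) by (simp add: standard_on_def)
  ultimately show ?thesis using card_mono[OF assms(2), of "a ` {1..n}"] by simp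
qed

section \<open>Elements of 5-power order\<close>

lemma funpow_funpow: "(f ^^ m) ((f ^^ k) x) = (f ^^ (m + k)) x"
  by (simp add: funpow_add)

lemma funpow_commute:
  assumes "\<And>x. f (g x) = g (f x)"
  shows "f ((g ^^ k) x) = (g ^^ k) (f x)"
  by (induction k) (simp_all add: assms)

text \<open>Here and below \<open>f\<close> is the class map of an equivalence that \<open>g\<close>
  respects. It will be the identity, \<open>rep\<close> for a permutation commuting with
  \<open>g\<close>, or an orbit map.\<close>

lemma funpow_compat:
  assumes "\<forall>y y'. f y = f y' \<longrightarrow> f (g y) = f (g y')"
  shows "f y = f y' \<Longrightarrow> f ((g ^^ k) y) = f ((g ^^ k) y')"
proof (induction k)
  case (Suc k)
  then have "f (g ((g ^^ k) y)) = f (g ((g ^^ k) y'))" using assms by blast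
  then show ?case by simp
qed simp

text \<open>If \<open>g\<close> has \<open>5\<close>-power order, it is a power of \<open>g\<^sup>i\<close> for every \<open>i\<close> prime to \<open>5\<close>.\<close>

lemma five_power_invariant:
  assumes g: "g ^^ (5 ^ v) = id" and i: "\<not> 5 dvd i"
    and f: "\<forall>y y'. f y = f y' \<longrightarrow> f (g y) = f (g y')"
    and x: "f ((g ^^ i) x) = f x"
  shows "f (g x) = f x"
proof -
  have "prime (5::nat)" by simp
  then have "coprime 5 i" using i by (rule prime_imp_coprime)
  then have "coprime i (5 ^ v)" by (simp add: coprime_commute)
  then obtain u where u: "[i * u = 1] (mod 5 ^ v)" using cong_solve_coprime_nat[of i "5 ^ v"] by auto
  have mult: "f ((g ^^ (i * k)) x) = f x" for k
  proof (induction k)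
    case (Suc k)
    have "f ((g ^^ (i * Suc k)) x) = f ((g ^^ i) ((g ^^ (i * k)) x))" by (simp add: funpow_add)
    also have "\<dots> = f ((g ^^ i) x)" using funpow_compat[OF f Suc] by simp
    finally show ?case using x by simp
  qed simp
  have "(g ^^ (i * u)) x = (g ^^ (i * u mod 5 ^ v)) x"
    using funpow_mod_eq[of "5 ^ v" g x "i * u"] g by simp
  also have "i * u mod 5 ^ v = 1 mod 5 ^ v" using u by (simp add: cong_def)
  also have "(g ^^ (1 mod 5 ^ v)) x = (g ^^ 1) x"
    using funpow_mod_eq[of "5 ^ v" g x 1] g by simp
  finally show ?thesis using mult[of u] by simp
qed

lemma finite_order_cancel:
  assumes g: "g ^^ m = id" and m: "m > 0"
    and f: "\<forall>y y'. f y = f y' \<longrightarrow> f (g y) = f (g y')"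
    and ij: "i \<le> j" and e: "f ((g ^^ i) x) = f ((g ^^ j) x)"
  shows "f ((g ^^ (j - i)) x) = f x"
proof -
  have cancel: "(g ^^ (m * i - i)) ((g ^^ i) y) = y" for y
  proof -
    have "(g ^^ (m * i - i)) ((g ^^ i) y) = (g ^^ (m * i)) y"
      using m by (simp add: funpow_funpow)
    then show ?thesis using g by (simp add: funpow_mult[symmetric])
  qed
  have "(g ^^ j) x = (g ^^ i) ((g ^^ (j - i)) x)"
    unfolding funpow_funpow using ij by simp
  then show ?thesis using funpow_compat[OF f e, of "m * i - i"] cancel by simp
qed

text \<open>Two indices below 5 differ by a number prime to 5, so a repetition would force
  \<open>g\<close> itself to preserve the class of \<open>x\<close>.\<close>

lemma five_power_inj:
  assumes g: "g ^^ (5 ^ v) = id"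
    and f: "\<forall>y y'. f y = f y' \<longrightarrow> f (g y) = f (g y')"
    and x: "f (g x) \<noteq> f x"
  shows "inj_on (\<lambda>i. f ((g ^^ i) x)) {..<5}"
proof (rule linorder_inj_onI)
  fix i j :: nat assume ij: "i < j" "i \<in> {..<5}" "j \<in> {..<5}"
  show "f ((g ^^ i) x) \<noteq> f ((g ^^ j) x)"
  proof
    assume e: "f ((g ^^ i) x) = f ((g ^^ j) x)"
    have "f ((g ^^ (j - i)) x) = f x" using ij(1) by (intro finite_order_cancel[OF g _ f _ e]) auto
    moreover have "\<not> 5 dvd j - i" using ij by (auto dest: dvd_imp_le)
    ultimately show False using five_power_invariant[OF g _ f, of "j - i" x] x by simp
  qed
qed auto

text \<open>A repetition at a distance prime to 5 is excluded as for five indices; one at distance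
  \<open>5 * k\<close> is a repetition for \<open>g ^^ 5\<close> with \<open>k < 5\<close>.\<close>

lemma five_power_inj25:
  assumes g: "g ^^ (5 ^ v) = id"
    and f: "\<forall>y y'. f y = f y' \<longrightarrow> f (g y) = f (g y')"
    and x: "f (g x) \<noteq> f x" and x5: "f ((g ^^ 5) x) \<noteq> f x"
  shows "inj_on (\<lambda>i. f ((g ^^ i) x)) {..<25}"
proof (rule linorder_inj_onI)
  fix i j :: nat assume ij: "i < j" "i \<in> {..<25}" "j \<in> {..<25}"
  have g5: "(g ^^ 5) ^^ (5 ^ v) = id" using g by (metis funpow_mult mult.commute id_funpow)
  have f5: "\<forall>y y'. f y = f y' \<longrightarrow> f ((g ^^ 5) y) = f ((g ^^ 5) y')" using funpow_compat[OF f] by blast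
  show "f ((g ^^ i) x) \<noteq> f ((g ^^ j) x)"
  proof
    assume e: "f ((g ^^ i) x) = f ((g ^^ j) x)"
    have d: "f ((g ^^ (j - i)) x) = f x" using ij(1) by (intro finite_order_cancel[OF g _ f _ e]) auto
    then have "5 dvd j - i" using five_power_invariant[OF g _ f, of "j - i" x] x by blast
    then obtain k where k: "j - i = 5 * k" by blast
    then have "f (((g ^^ 5) ^^ k) x) = f (((g ^^ 5) ^^ 0) x)" using d by (simp add: funpow_mult)
    moreover have "k \<in> {..<5}" "k \<noteq> 0" using k ij by auto
    ultimately show False using inj_onD[OF five_power_inj[OF g5 f5 x5], of k 0] by simp
  qed
qed auto

text \<open>Cycle lengths divide a power of 5; all that is used later is the alternative between 1,
  exactly 5, and at least 25.\<close>

lemma five_power_cyc_card: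
  assumes gX: "finite_perm g X" and g: "g ^^ (5 ^ v) = id" and x: "g x \<noteq> x"
  shows "5 \<le> card (cyc g x)"
    and "card (cyc g x) < 25 \<Longrightarrow> (g ^^ 5) x = x"
    and "(g ^^ 5) x = x \<Longrightarrow> card (cyc g x) = 5 \<and> cyc g x = (\<lambda>i. (g ^^ i) x) ` {..<5}"
proof -
  interpret finite_perm g X by fact
  have inj: "inj_on (\<lambda>i. (g ^^ i) x) {..<5}"
    using five_power_inj[OF g, where f = "\<lambda>y. y" and x = x] x by simp
  have sub: "(\<lambda>i. (g ^^ i) x) ` {..<5} \<subseteq> cyc g x" by (auto simp: cyc_def)
  show "5 \<le> card (cyc g x)"
    using card_mono[OF finite_cyc sub] card_image[OF inj] by simp
  show "(g ^^ 5) x = x" if lt: "card (cyc g x) < 25"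
  proof (rule ccontr)
    assume g5: "(g ^^ 5) x \<noteq> x"
    have "inj_on (\<lambda>i. (g ^^ i) x) {..<25}"
      using five_power_inj25[OF g, where f = "\<lambda>y. y" and x = x] x g5 by simp
    then have "card ((\<lambda>i. (g ^^ i) x) ` {..<25}) = 25" by (simp add: card_image)
    moreover have "(\<lambda>i. (g ^^ i) x) ` {..<25} \<subseteq> cyc g x" by (auto simp: cyc_def)
    ultimately show False using card_mono[OF finite_cyc] lt by (metis not_less)
  qed
  show "card (cyc g x) = 5 \<and> cyc g x = (\<lambda>i. (g ^^ i) x) ` {..<5}" if "(g ^^ 5) x = x"
  proof -
    have "(g ^^ k) x = (g ^^ (k mod 5)) x" for k using funpow_mod_eq[OF that, of k] by simp
    then have "cyc g x \<subseteq> (\<lambda>i. (g ^^ i) x) ` {..<5}"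
      unfolding cyc_def by (auto intro!: image_eqI[of _ _ "_ mod 5"])
    with sub have "cyc g x = (\<lambda>i. (g ^^ i) x) ` {..<5}" by blast
    then show ?thesis using card_image[OF inj] by simp
  qed
qed

context braid_action
begin

text \<open>The braid that rotates five strands. It conjugates each of the first three generators to
  the next one, and its fifth power is the full twist, which is central in the braid group on five
  strands.\<close>

definition delta :: "'a \<Rightarrow> 'a" where
  "delta = s 1 \<circ> s 2 \<circ> s 3 \<circ> s 4"

lemma delta_permutes: "n \<ge> 5 \<Longrightarrow> delta permutes X"
  unfolding delta_def using perm by (intro permutes_compose) auto

lemma delta_conj:
  assumes "n \<ge> 5"
  shows "delta (s 1 x) = s 2 (delta x)" "delta (s 2 x) = s 3 (delta x)" "delta (s 3 x) = s 4 (delta x)"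
proof -
  have b: "s 1 (s 2 (s 1 x)) = s 2 (s 1 (s 2 x))" "s 2 (s 3 (s 2 x)) = s 3 (s 2 (s 3 x))"
    "s 3 (s 4 (s 3 x)) = s 4 (s 3 (s 4 x))" for x
    using assms braid[of 1 x] braid[of 2 x] braid[of 3 x] by (simp_all add: numeral_eq_Suc)
  have f: "s 1 (s 3 x) = s 3 (s 1 x)" "s 1 (s 4 x) = s 4 (s 1 x)" "s 2 (s 4 x) = s 4 (s 2 x)" for x
    using assms far[of 1 3 x] far[of 1 4 x] far[of 2 4 x] by simp_all
  show "delta (s 1 x) = s 2 (delta x)"
    unfolding delta_def comp_apply by (metis b(1) f(1,2))
  show "delta (s 2 x) = s 3 (delta x)"
    unfolding delta_def comp_apply by (metis b(2) f(1,3))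
  show "delta (s 3 x) = s 4 (delta x)"
    unfolding delta_def comp_apply by (metis b(3) f(2,3))
qed

text \<open>Conjugating \<open>s 4\<close> once leads, in the braid group, outside the four
  generators; the second turn leads to \<open>s 1\<close>. Three turns from \<open>s 1\<close> to
  \<open>s 4\<close> and these two make five.\<close>

lemma delta_square_conj:
  assumes "n \<ge> 5"
  shows "delta (delta (s 4 x)) = s 1 (delta (delta x))"
proof -
  have dd: "delta (delta x) = s 2 (s 3 (s 4 (delta (s 4 x))))" for x
  proof -
    have "delta (delta x) = delta (s 1 (s 2 (s 3 (s 4 x))))" by (simp add: delta_def)
    then show ?thesis by (simp only: delta_conj[OF assms])
  qed
  have "s 1 (delta (delta x)) = delta (delta (s 4 x))"
    by (simp only: dd[of x]) (simp add: delta_def)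
  then show ?thesis by simp
qed

lemma delta_five_central:
  assumes "n \<ge> 5"
  shows "(delta ^^ 5) (s 1 x) = s 1 ((delta ^^ 5) x)"
  using delta_conj[OF assms] delta_square_conj[OF assms] by (simp add: numeral_eq_Suc)

text \<open>Let \<open>N = 5 ^ v * q\<close> annihilate \<open>delta\<close>, with \<open>q\<close>
  prime to 5. By Fermat \<open>q ^ 4\<close> is 1 modulo 5, so \<open>delta ^^ (q ^ 4)\<close> is
  \<open>delta\<close> times a power of \<open>delta ^^ 5\<close> and still conjugates
  \<open>s 1\<close> to \<open>s 2\<close>, while its order divides \<open>5 ^ v\<close>.\<close>

lemma five_power_element:
  assumes "n \<ge> 5"
  obtains M v where "(delta ^^ M) ^^ (5 ^ v) = id" "\<And>x. (delta ^^ M) (s 1 x) = s 2 ((delta ^^ M) x)"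
proof -
  obtain N where N: "N > 0" "delta ^^ N = id"
    using permutes_funpow_order[OF delta_permutes[OF assms] finite_X] .
  define v where "v = multiplicity 5 N"
  obtain q where q: "N = 5 ^ v * q" "\<not> 5 dvd q"
    using multiplicity_decompose'[of N 5] N(1) unfolding v_def by auto
  have "[q ^ 4 = 1] (mod 5)"
  proof -
    have "q mod 5 \<in> {1,2,3,4}" using q(2) by (auto simp: dvd_eq_mod_eq_0)
    then have "(q mod 5) ^ 4 mod 5 = 1" by auto
    then show ?thesis by (simp add: cong_def power_mod)
  qed
  moreover have "q ^ 4 \<ge> 1" using q(2) by (cases q) auto
  ultimately obtain k where k: "q ^ 4 = Suc (5 * k)"
    by (metis Suc_eq_plus1 add.commute cong_to_1_nat dvd_def le_add_diff_inverse2)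
  have "(delta ^^ (q ^ 4)) ^^ (5 ^ v) = (delta ^^ N) ^^ (q ^ 3)"
    by (simp add: funpow_mult q(1) power_eq_if ac_simps)
  then have "(delta ^^ (q ^ 4)) ^^ (5 ^ v) = id" using N(2) by simp
  moreover have "(delta ^^ (q ^ 4)) (s 1 x) = s 2 ((delta ^^ (q ^ 4)) x)" for x
  proof -
    have "(delta ^^ (5 * k)) (s 1 x) = s 1 ((delta ^^ (5 * k)) x)"
      using funpow_commute[of "s 1" "delta ^^ 5" k x] delta_five_central[OF assms]
      by (simp add: funpow_mult)
    then show ?thesis using delta_conj(1)[OF assms] by (simp add: k)
  qed
  ultimately show ?thesis using that by blast
qed

end

text \<open>A passage to cycles removes two strands, so five and six strands are the base cases.
  There at most four points leave no room for a cycle of length five, and the element of 5-power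
  order is trivial. For more strands the bound passes to the cycles, and it excludes the standard
  action, which would need \<open>m\<close> points.\<close>

lemma small_action_equal:
  assumes "5 \<le> m" "2 * card X \<le> m + 3" "braid_action m s X"
  shows "gens_equal m s"
  using assms
proof (induction m arbitrary: s X rule: less_induct)
  case (less m)
  interpret braid_action m s X by fact
  show ?case
  proof (cases "m \<le> 6")
    case True
    obtain M v where g: "(delta ^^ M) ^^ (5 ^ v) = id" "\<And>x. (delta ^^ M) (s 1 x) = s 2 ((delta ^^ M) x)"
      using five_power_element[OF less.prems(1)] by blast
    let ?g = "delta ^^ M"
    interpret g: finite_perm ?g X
      using permutes_funpow[OF delta_permutes[OF less.prems(1)]] finite_X by unfold_locales
    have "?g x = x" for x
    proof (rule ccontr)
      assume x: "?g x \<noteq> x"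
      then have "x \<in> X" using g.supp_t_subset by (auto simp: supp_def)
      then have "card (cyc ?g x) \<le> card X" using finite_X g.cyc_subset by (intro card_mono)
      moreover have "5 \<le> card (cyc ?g x)"
        using five_power_cyc_card(1)[OF g.finite_perm_axioms g(1) x] .
      ultimately show False using True less.prems(2) by simp
    qed
    then have "s 1 = s (Suc 1)" using g(2) by (simp add: fun_eq_iff numeral_2_eq_2)
    then show ?thesis using less.prems(1) by (intro gens_equal_adjacent[of 1]) auto
  next
    case False
    interpret q: quot_action "m - 2" s X "s (m - 1)" using False by (intro quot_action_last) simp
    have "2 * card (rep (s (m - 1)) ` supp (s (m - 1))) \<le> card X"
      using q.card_reps card_mono[OF finite_X q.supp_t_subset] by simp
    then have "gens_equal (m - 2) (quot (s (m - 1)) s)"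
      using less.prems False by (intro less.IH[OF _ _ _ q.quot_action]) auto
    then have "gens_equal m s \<or> (\<exists>a. standard_on m s X a)"
      using False less.prems by (intro equal_on_cycles) auto
    then show ?thesis using standard_on_card[OF _ finite_X] less.prems False by fastforce
  qed
qed

lemma card_UN_const:
  assumes "\<And>i. i \<in> I \<Longrightarrow> finite (c i)" "\<And>i. i \<in> I \<Longrightarrow> card (c i) = j" "finite I"
    and "\<And>i k. i \<in> I \<Longrightarrow> k \<in> I \<Longrightarrow> i \<noteq> k \<Longrightarrow> c i \<inter> c k = {}"
  shows "card (\<Union>i\<in>I. c i) = card I * j"
proof -
  have "card (\<Union>i\<in>I. c i) = (\<Sum>i\<in>I. card (c i))"
    using assms(1,3,4) by (intro card_UN_disjoint) simp_all
  then show ?thesis using assms(2) by simp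
qed

lemma gens_equalD:
  "gens_equal n s \<Longrightarrow> 1 \<le> i \<Longrightarrow> i < n \<Longrightarrow> 1 \<le> j \<Longrightarrow> j < n \<Longrightarrow> s i = s j"
  unfolding gens_equal_def by blast

section \<open>Standard action on the cycles of the last generator\<close>

locale standard_quotient = braid_action n s X
  for n :: nat and s :: "nat \<Rightarrow> 'a \<Rightarrow> 'a" and X :: "'a set" +
  fixes a :: "nat \<Rightarrow> 'a" and t c W
  defines t_def: "t \<equiv> s (n - 1)" and c_def: "c b \<equiv> cyc t (a b)" and W_def: "W \<equiv> \<Union>b\<in>{1..n - 2}. c b"
  assumes n: "n \<ge> 9"
    and std: "standard_on (n - 2) (quot t s) (rep t ` supp t) a"
begin

sublocale q: quot_action "n - 2" s X t
  unfolding t_def using n by (intro quot_action_last) simp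

lemma a_in:
  assumes "1 \<le> b" "b \<le> n - 2"
  shows "a b \<in> supp t \<and> rep t (a b) = a b"
proof -
  have "a ` {1..n - 2} \<subseteq> rep t ` supp t" using std by (simp add: standard_on_def)
  then have "a b \<in> rep t ` supp t" using assms by (simp add: image_subset_iff)
  then obtain x where "x \<in> supp t" "a b = rep t x" by (rule imageE)
  then show ?thesis by (simp add: q.rep_in_supp q.rep_rep)
qed

lemma a_inj: "1 \<le> b \<Longrightarrow> b \<le> n - 2 \<Longrightarrow> 1 \<le> b' \<Longrightarrow> b' \<le> n - 2 \<Longrightarrow> a b = a b' \<longleftrightarrow> b = b'"
  using std unfolding standard_on_def inj_on_def by auto

lemma c_disjoint:
  assumes "1 \<le> b" "b \<le> n - 2" "1 \<le> b'" "b' \<le> n - 2" "b \<noteq> b'"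
  shows "c b \<inter> c b' = {}"
proof (rule ccontr)
  assume "c b \<inter> c b' \<noteq> {}"
  then have "cyc t (a b) = cyc t (a b')" unfolding c_def by (rule q.cyc_disjoint)
  then have "rep t (a b) = rep t (a b')" using q.rep_eq_iff[of "a b" "a b'"] cyc_self[of "a b'" t] by simp
  then show False using a_in a_inj assms by simp
qed

lemma c_X: "1 \<le> b \<Longrightarrow> b \<le> n - 2 \<Longrightarrow> c b \<subseteq> X"
  unfolding c_def using a_in[of b] q.supp_t_subset q.cyc_subset by blast

lemma c_finite: "finite (c b)"
  unfolding c_def by (rule q.finite_cyc)

lemma c_step: "t x \<in> c b \<longleftrightarrow> x \<in> c b"
  unfolding c_def q.cyc_sym[of _ "a b"] q.cyc_eq[OF cyc_step_self] ..

lemma c_cyc: "x \<in> c b \<Longrightarrow> c b = cyc t x"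
  unfolding c_def using q.cyc_eq by blast

lemma image_c:
  assumes i: "1 \<le> i" "i + 2 < n" and b: "1 \<le> b" "b \<le> n - 2"
  shows "s i ` c b = c (if b = i then Suc i else if b = Suc i then i else b)"
proof -
  let ?b = "if b = i then Suc i else if b = Suc i then i else b"
  have i': "i < n - 2" using i by simp
  have b': "1 \<le> ?b" "?b \<le> n - 2" using i b by auto
  have "quot t s i (a b) = a ?b" using std i i' b unfolding standard_on_def by auto
  then have "rep t (s i (a b)) = a ?b" using q.quot_rep[OF i(1) i', of "a b"] a_in[OF b] by simp
  also have "\<dots> = rep t (a ?b)" using a_in[OF b'] by simp
  finally have "cyc t (s i (a b)) = cyc t (a ?b)"
    using q.rep_eq_iff[of "s i (a b)" "a ?b"] q.cyc_eq[of "a ?b" "s i (a b)"] by simp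
  then show ?thesis unfolding c_def using q.cyc_image[OF i(1) i'] by simp
qed

lemma s_in_c:
  assumes i: "1 \<le> i" "i + 2 < n" and b: "1 \<le> b" "b \<le> n - 2" and x: "x \<in> c b"
  shows "s i x \<in> c (if b = i then Suc i else if b = Suc i then i else b)"
  using image_c[OF i b] x by blast

definition j where "j = card (c 1)"

lemma card_c: "1 \<le> b \<Longrightarrow> b \<le> n - 2 \<Longrightarrow> card (c b) = j"
proof (induction b rule: dec_induct)
  case base
  then show ?case by (simp add: j_def)
next
  case (step b)
  have "card (s b ` c b) = card (c b)" using step inj[of b] by (intro card_image) (simp add: inj_on_def)
  then show ?case using image_c[of b b] step by simp
qed

lemma card_UN_c:
  assumes "m \<le> n - 2"
  shows "card (\<Union>b\<in>{1..m}. c b) = m * j"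
proof -
  have "card (\<Union>b\<in>{1..m}. c b) = card {1..m} * j"
  proof (rule card_UN_const)
    show "card (c b) = j" if "b \<in> {1..m}" for b using that assms by (intro card_c) auto
    show "c b \<inter> c k = {}" if "b \<in> {1..m}" "k \<in> {1..m}" "b \<noteq> k" for b k
      using that assms by (intro c_disjoint) auto
  qed (simp_all add: c_finite)
  then show ?thesis by simp
qed

lemma j_ge: "j \<ge> 2"
  using q.card_cyc_supp[of "a 1"] a_in[of 1] n by (simp add: j_def c_def)

lemma c_pow:
  assumes i: "1 \<le> i" "i + 2 < n" and b: "1 \<le> b" "b \<le> n - 2" "b \<noteq> i" "b \<noteq> Suc i" and x: "x \<in> c b"
  obtains k where "s i x = (t ^^ k) x"
  using s_in_c[OF i b(1,2) x] b c_cyc[OF x] by (auto elim: cycE)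

text \<open>Both generators preserve \<open>c b\<close> and act at \<open>x\<close> as powers
  \<open>t ^^ p\<close> and \<open>t ^^ r\<close>. The braid relation compares the exponents
  \<open>2 * p + r\<close> and \<open>p + 2 * r\<close>, and \<open>p + r\<close> cancels.\<close>

lemma c_adjacent_eq:
  assumes i: "1 \<le> i" "Suc i + 2 < n" and b: "1 \<le> b" "b \<le> n - 2" "b \<notin> {i, Suc i, Suc (Suc i)}" and x: "x \<in> c b"
  shows "s i x = s (Suc i) x"
proof -
  obtain p where p: "s i x = (t ^^ p) x" using c_pow[of i b x] assms by auto
  obtain r where r: "s (Suc i) x = (t ^^ r) x" using c_pow[of "Suc i" b x] assms by auto
  have si: "s i ((t ^^ k) y) = (t ^^ k) (s i y)" "s (Suc i) ((t ^^ k) y) = (t ^^ k) (s (Suc i) y)" for k y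
    using q.comm_funpow[of i k y] q.comm_funpow[of "Suc i" k y] i by auto
  have "(t ^^ (p + r + p)) x = (t ^^ (r + p + r)) x"
    using braid[of i x] i p r by (simp add: si funpow_funpow ac_simps)
  then have "(t ^^ (p + r)) ((t ^^ p) x) = (t ^^ (p + r)) ((t ^^ r) x)"
    by (simp add: funpow_funpow ac_simps)
  then have "(t ^^ p) x = (t ^^ r) x"
    using permutes_inj[OF permutes_funpow[OF q.t]] by (metis injD)
  then show ?thesis using p r by simp
qed

lemma W_step: "1 \<le> i \<Longrightarrow> i + 2 < n \<Longrightarrow> s i x \<in> W \<longleftrightarrow> x \<in> W"
proof -
  assume i: "1 \<le> i" "i + 2 < n"
  have "s i ` W \<subseteq> W"
  proof
    fix y assume "y \<in> s i ` W"
    then obtain x b where x: "y = s i x" "x \<in> c b" "1 \<le> b" "b \<le> n - 2" unfolding W_def by auto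
    have "1 \<le> (if b = i then Suc i else if b = Suc i then i else b)"
      "(if b = i then Suc i else if b = Suc i then i else b) \<le> n - 2" using i x by auto
    then show "y \<in> W" using s_in_c[OF i x(3,4,2)] x(1) unfolding W_def
      by (intro UN_I[of "if b = i then Suc i else if b = Suc i then i else b"]) simp_all
  qed
  moreover have "finite W" unfolding W_def using c_finite by simp
  moreover have "inj_on (s i) W" using inj[of i] i by (simp add: inj_on_def)
  ultimately have "s i ` W = W" by (simp add: endo_inj_surj)
  moreover have "s i x \<in> s i ` W \<longleftrightarrow> x \<in> W" using inj[of i] i by auto
  ultimately show "s i x \<in> W \<longleftrightarrow> x \<in> W" by simp
qed

lemma tW_step: "t x \<in> W \<longleftrightarrow> x \<in> W"
  unfolding W_def using c_step by auto

lemma W_X: "W \<subseteq> X"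
  unfolding W_def using c_X by (intro UN_least) simp

lemma restr_W_action: "braid_action (n - 2) (restr (X - W) s) (X - W)"
proof (rule q.restr_action)
  show "s i x \<in> X - W" if "1 \<le> i" "i < n - 2" "x \<in> X - W" for i x
    using that in_X[of i x] W_step[of i x] by simp
qed simp

lemma agree_off_W:
  assumes "gens_equal (n - 2) (restr (X - W) s)"
    and "1 \<le> i" "i + 2 < n" "1 \<le> k" "k + 2 < n" "x \<notin> W"
  shows "s i x = s k x"
proof (cases "x \<in> X")
  case True
  have "restr (X - W) s i = restr (X - W) s k"
    using assms(2-5) by (intro gens_equalD[OF assms(1)]) auto
  then have "restr (X - W) s i x = restr (X - W) s k x" by simp
  then show ?thesis using True assms(6) by (simp add: restr_def)
next
  case False
  then show ?thesis using outside assms by simp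
qed

text \<open>\<open>W\<close> has at least \<open>2 * (n - 2)\<close> points, so at most three are
  left, too few for \<open>n - 2\<close> strands with different generators.\<close>

lemma agree_off_W_small:
  assumes "card X < 2 * n" "1 \<le> i" "i + 2 < n" "1 \<le> k" "k + 2 < n" "x \<notin> W"
  shows "s i x = s k x"
proof (rule agree_off_W[OF small_action_equal[OF _ _ restr_W_action] assms(2-6)])
  have "card W = (n - 2) * j" unfolding W_def by (rule card_UN_c) simp
  then have "card W \<ge> (n - 2) * 2" using j_ge by simp
  moreover have "card (X - W) = card X - card W"
    using W_X finite_X finite_subset by (intro card_Diff_subset) blast+
  ultimately show "2 * card (X - W) \<le> n - 2 + 3" using assms(1) n by simp
qed (use n in simp)

text \<open>Every point of \<open>X\<close> lies on a nontrivial cycle of \<open>t\<close>. Those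
  off \<open>W\<close> are permuted alike by the generators, which therefore differ there by powers
  of \<open>t\<close>.\<close>

lemma agree_off_W_full:
  assumes "supp t = X" "1 \<le> i" "i + 2 < n" "1 \<le> k" "k + 2 < n" "x \<notin> W"
  shows "s i x = s k x"
proof (rule agree_off_W[OF _ assms(2-6)])
  interpret Y: braid_action "n - 2" "restr (X - W) s" "X - W" by (rule restr_W_action)
  have tXW: "t x \<in> X - W \<longleftrightarrow> x \<in> X - W" for x
    using tW_step q.supp_step assms(1) by simp
  show "gens_equal (n - 2) (restr (X - W) s)"
  proof (rule Y.gens_equal_mod_commuting[where t = t])
    show "restr (X - W) s i (t x) = t (restr (X - W) s i x)"
      if "1 \<le> i" "i < n - 2" "x \<in> X - W" for i x
      using that tXW q.comm unfolding restr_def by simp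
    show "\<exists>m. restr (X - W) s i x = (t ^^ m) (restr (X - W) s k x)"
      if h: "1 \<le> i" "i < n - 2" "1 \<le> k" "k < n - 2" "x \<in> X - W" for i k x
    proof -
      have x: "x \<in> supp t" using h assms(1) by simp
      have "rep t x \<notin> a ` {1..n - 2}"
      proof
        assume "rep t x \<in> a ` {1..n - 2}"
        then obtain b where b: "b \<in> {1..n - 2}" "rep t x = a b" by blast
        then have "x \<in> c b" unfolding c_def using q.cyc_sym rep_in_cyc by metis
        then show False using h(5) b(1) unfolding W_def by blast
      qed
      then have "quot t s i (rep t x) = quot t s k (rep t x)"
        using std h(1-4) unfolding standard_on_def by blast
      then have "rep t (s k x) = rep t (s i x)" using q.quot_rep h(1-4) x by simp
      then have "s i x \<in> cyc t (s k x)" by (simp only: q.rep_eq_iff)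
      then obtain m where "s i x = (t ^^ m) (s k x)" by (rule cycE)
      then show ?thesis using h(5) unfolding restr_def by auto
    qed
  qed (use n tXW in auto)
qed

end

locale standard_cycles = standard_quotient n s X a t c W
  for n :: nat and s :: "nat \<Rightarrow> 'a \<Rightarrow> 'a" and X :: "'a set" and a t c W +
  assumes off: "\<And>i j x. 1 \<le> i \<Longrightarrow> i + 2 < n \<Longrightarrow> 1 \<le> j \<Longrightarrow> j + 2 < n \<Longrightarrow> x \<notin> W \<Longrightarrow> s i x = s j x"
begin

definition E where "E i = {x. s i x \<noteq> t x}"

text \<open>The pair \<open>s i\<close>, \<open>t\<close> is far, so the count may be made for
  \<open>s 1\<close> and \<open>s 3\<close>. These agree on the later cycles by
  \<open>c_adjacent_eq\<close>; on each of \<open>c 1\<close> to \<open>c 4\<close> one of them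
  leaves the cycle and the other preserves it.\<close>

lemma card_E:
  assumes "1 \<le> i" "i + 2 < n"
  shows "card (E i) = 4 * j"
proof -
  have "card (E i) = card {x. s 1 x \<noteq> s 3 x}"
    using far_invariant[OF conj_inv_diff_card, of i "n - 1"] assms by (simp add: E_def t_def)
  also have "{x. s 1 x \<noteq> s 3 x} = (\<Union>b\<in>{1..4}. c b)"
  proof (intro equalityI subsetI)
    fix x assume x: "x \<in> {x. s 1 x \<noteq> s 3 x}"
    then have "x \<in> W" using off[of 1 3 x] n by auto
    then obtain b where b: "x \<in> c b" "1 \<le> b" "b \<le> n - 2" unfolding W_def by auto
    show "x \<in> (\<Union>b\<in>{1..4}. c b)"
    proof (cases "b \<le> 4")
      case False
      have "s 1 x = s (Suc 1) x" using c_adjacent_eq[of 1 b x] b n False by simp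
      moreover have "s 2 x = s 3 x" using c_adjacent_eq[of 2 b x] b n False by simp
      ultimately show ?thesis using x by (simp add: numeral_2_eq_2)
    qed (use b in auto)
  next
    fix x assume "x \<in> (\<Union>b\<in>{1..4}. c b)"
    then obtain b where b0: "b \<in> {1..4}" "x \<in> c b" by blast
    then have b: "b = 1 \<or> b = 2 \<or> b = 3 \<or> b = 4" "x \<in> c b" by auto
    have bn: "1 \<le> b" "b \<le> n - 2" using b(1) n by auto
    have "s 1 x \<in> c (if b = 1 then 2 else if b = 2 then 1 else b)"
      using s_in_c[OF _ _ bn b(2), of 1] n by (auto simp: numeral_2_eq_2 split: if_splits)
    moreover have "s 3 x \<in> c (if b = 3 then 4 else if b = 4 then 3 else b)"
      using s_in_c[OF _ _ bn b(2), of 3] n by (auto split: if_splits)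
    ultimately show "x \<in> {x. s 1 x \<noteq> s 3 x}"
      using b(1) n c_disjoint[of 1 2] c_disjoint[of 3 4] by (elim disjE) (auto simp: disjoint_iff)
  qed
  also have "card (\<Union>b\<in>{1..4}. c b) = 4 * j"
    using n by (intro card_UN_c) simp
  finally show ?thesis by simp
qed

lemma finite_E: "1 \<le> i \<Longrightarrow> i + 2 < n \<Longrightarrow> finite (E i)"
  using card_E[of i] j_ge by (intro card_ge_0_finite) simp

lemma c_sub_E: "1 \<le> i \<Longrightarrow> i + 2 < n \<Longrightarrow> c i \<union> c (Suc i) \<subseteq> E i"
proof
  fix x assume i: "1 \<le> i" "i + 2 < n" and x: "x \<in> c i \<union> c (Suc i)"
  have d: "c i \<inter> c (Suc i) = {}" using c_disjoint[of i "Suc i"] i by simp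
  show "x \<in> E i"
  proof (cases "x \<in> c i")
    case True
    then have "s i x \<in> c (Suc i)" using s_in_c[of i i x] i by simp
    moreover have "t x \<in> c i" using True c_step by simp
    ultimately show ?thesis using d by (auto simp: E_def)
  next
    case False
    then have x': "x \<in> c (Suc i)" using x by simp
    then have "s i x \<in> c i" using s_in_c[of i "Suc i" x] i by simp
    moreover have "t x \<in> c (Suc i)" using x' c_step by simp
    ultimately show ?thesis using d by (auto simp: E_def)
  qed
qed

lemma E_c_all:
  assumes "1 \<le> i" "i + 2 < n" "x \<in> E i" "x \<in> c b"
  shows "c b \<subseteq> E i"
proof
  fix y assume "y \<in> c b"
  then obtain k where k: "y = (t ^^ k) x" using c_cyc[OF assms(4)] by (auto elim: cycE)
  have "s i y = (t ^^ k) (s i x)" using q.comm_funpow[of i k x] assms k by simp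
  moreover have "t y = (t ^^ k) (t x)" using k by (simp add: funpow_swap1)
  ultimately show "y \<in> E i"
    using assms(3) permutes_inj[OF permutes_funpow[OF q.t, of k]] unfolding E_def by (auto dest: injD)
qed

text \<open>Generators \<open>s b\<close> with \<open>b \<ge> 3\<close> commute with
  \<open>s 1\<close> and \<open>t\<close>, so they preserve \<open>E 1\<close> and spread an
  intersection with one \<open>c b\<close> to \<open>c 3\<close>, \<open>c 4\<close> and
  \<open>c 5\<close>. Together with \<open>c 1\<close> and \<open>c 2\<close> these are five whole
  cycles inside \<open>E 1\<close>, which has room for four.\<close>

lemma E1_c: "3 \<le> b \<Longrightarrow> b \<le> n - 2 \<Longrightarrow> c b \<inter> E 1 = {}"
proof (rule ccontr)
  assume b: "3 \<le> b" "b \<le> n - 2" "c b \<inter> E 1 \<noteq> {}"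
  have move: "x \<in> E 1 \<Longrightarrow> s b x \<in> E 1" if "3 \<le> b" "b + 2 < n" for b x
  proof -
    have "b < n - 2" using that by simp
    then show "x \<in> E 1 \<Longrightarrow> s b x \<in> E 1"
      using far[of 1 b x] q.comm[of b x] inj[of b "s 1 x" "t x"] that by (simp add: E_def)
  qed
  have up: "c (Suc b) \<inter> E 1 \<noteq> {}" if h: "3 \<le> b" "Suc b \<le> n - 2" "c b \<inter> E 1 \<noteq> {}" for b
  proof -
    obtain x where x: "x \<in> c b" "x \<in> E 1" using h(3) by blast
    then have "s b x \<in> c (Suc b)" "s b x \<in> E 1" using move[of b x] s_in_c[of b b x] h(1,2) by simp_all
    then show ?thesis by blast
  qed
  have down: "c b \<inter> E 1 \<noteq> {}" if h: "3 \<le> b" "Suc b \<le> n - 2" "c (Suc b) \<inter> E 1 \<noteq> {}" for b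
  proof -
    obtain x where x: "x \<in> c (Suc b)" "x \<in> E 1" using h(3) by blast
    then have "s b x \<in> c b" "s b x \<in> E 1" using move[of b x] s_in_c[of b "Suc b" x] h(1,2) by simp_all
    then show ?thesis by blast
  qed
  have c3: "c 3 \<inter> E 1 \<noteq> {}"
    using b
  proof (induction b rule: dec_induct)
    case (step m)
    then show ?case using down[of m] by simp
  qed
  have c4: "c 4 \<inter> E 1 \<noteq> {}" using up[of 3] c3 n by simp
  have c5: "c 5 \<inter> E 1 \<noteq> {}" using up[of 4] c4 n by simp
  have "c b \<subseteq> E 1" if b5: "b \<in> {1..5}" for b
  proof -
    consider "b = 1" | "b = 2" | "b = 3" | "b = 4" | "b = 5"
      using b5 unfolding atLeastAtMost_iff by linarith
    then show ?thesis
      using c_sub_E[of 1] E_c_all[of 1] c3 c4 c5 n by cases (auto simp: numeral_2_eq_2)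
  qed
  then have "card (\<Union>b\<in>{1..5}. c b) \<le> card (E 1)"
    using n by (intro card_mono finite_E UN_least) auto
  moreover have "card (\<Union>b\<in>{1..5}. c b) = 5 * j"
    using n by (intro card_UN_c) simp
  ultimately show False using card_E[of 1] n j_ge by simp
qed

text \<open>Off \<open>W\<close> the generators \<open>s i\<close> with \<open>i + 2 < n\<close>
  agree, so every such \<open>E i\<close> yields this same set (see \<open>U_eq\<close>).\<close>

definition U where "U = E 1 - W"

lemma U_eq: "1 \<le> i \<Longrightarrow> i + 2 < n \<Longrightarrow> E i - W = U"
  using off[of i 1] n unfolding U_def E_def by auto

lemma card_cc: "1 \<le> i \<Longrightarrow> i + 2 < n \<Longrightarrow> card (c i \<union> c (Suc i)) = 2 * j"
  using card_Un_disjoint[OF c_finite c_finite c_disjoint[of i "Suc i"]] card_c by simp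

lemma cc_sub_W: "1 \<le> i \<Longrightarrow> i + 2 < n \<Longrightarrow> c i \<union> c (Suc i) \<subseteq> W"
proof -
  assume "1 \<le> i" "i + 2 < n"
  then have "i \<in> {1..n - 2}" "Suc i \<in> {1..n - 2}" by auto
  then show ?thesis unfolding W_def by blast
qed

lemma card_U: "card U = 2 * j"
proof -
  have "E 1 \<subseteq> (c 1 \<union> c 2) \<union> U"
  proof
    fix x assume x: "x \<in> E 1"
    show "x \<in> (c 1 \<union> c 2) \<union> U"
    proof (cases "x \<in> W")
      case True
      then obtain b where b: "x \<in> c b" "1 \<le> b" "b \<le> n - 2" unfolding W_def by auto
      then have "\<not> 3 \<le> b" using E1_c[of b] x by auto
      then have "b = 1 \<or> b = 2" using b by auto
      then show ?thesis using b by auto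
    qed (use x in \<open>auto simp: U_def\<close>)
  qed
  moreover have "(c 1 \<union> c 2) \<union> U \<subseteq> E 1" using c_sub_E[of 1] n by (auto simp: U_def numeral_2_eq_2)
  ultimately have "E 1 = (c 1 \<union> c 2) \<union> U" by blast
  moreover have "(c 1 \<union> c 2) \<inter> U = {}" using cc_sub_W[of 1] n by (auto simp: U_def numeral_2_eq_2)
  moreover have "finite U" using finite_E[of 1] n by (simp add: U_def)
  ultimately have "card (E 1) = card (c 1 \<union> c 2) + card U"
    using c_finite by (simp add: card_Un_disjoint)
  then show ?thesis using card_E[of 1] card_cc[of 1] n by (simp add: numeral_2_eq_2)
qed

lemma E_eq:
  assumes i: "1 \<le> i" "i + 2 < n"
  shows "E i = c i \<union> c (Suc i) \<union> U"
proof -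
  have sub: "c i \<union> c (Suc i) \<union> U \<subseteq> E i" using c_sub_E[OF i] U_eq[OF i] by auto
  have "(c i \<union> c (Suc i)) \<inter> U = {}" using cc_sub_W[OF i] by (auto simp: U_def)
  moreover have "finite U" using finite_E[of 1] n by (simp add: U_def)
  ultimately have "card (c i \<union> c (Suc i) \<union> U) = 4 * j"
    using c_finite card_U card_cc[OF i] by (simp add: card_Un_disjoint)
  then show ?thesis using card_subset_eq[OF finite_E[OF i] sub] card_E[OF i] by simp
qed

text \<open>The common value of all but a few generators at each point: it centralizes the action, and
  dividing it out makes the supports of far generators disjoint.\<close>

definition z where "z x = (if x \<in> c 1 \<union> c 2 then t x else s 1 x)"

lemma z_W: "x \<in> W \<Longrightarrow> z x = t x"
proof -
  assume "x \<in> W"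
  then obtain b where b: "x \<in> c b" "1 \<le> b" "b \<le> n - 2" unfolding W_def by auto
  then consider "b = 1" | "b = 2" | "3 \<le> b" by linarith
  then show "z x = t x" using b E1_c[of b] by cases (auto simp: z_def E_def)
qed

lemma z_off: "x \<notin> W \<Longrightarrow> 1 \<le> i \<Longrightarrow> i + 2 < n \<Longrightarrow> z x = s i x"
  using off[of 1 i x] cc_sub_W[of 1] n by (auto simp: z_def numeral_2_eq_2)

lemma s_z: "1 \<le> i \<Longrightarrow> i + 2 < n \<Longrightarrow> s i x \<noteq> z x \<longleftrightarrow> x \<in> c i \<union> c (Suc i)"
proof (cases "x \<in> W")
  case True
  assume i: "1 \<le> i" "i + 2 < n"
  have "s i x \<noteq> z x \<longleftrightarrow> x \<in> E i" using z_W[OF True] by (simp add: E_def)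
  then show ?thesis using E_eq[OF i] True by (auto simp: U_def)
next
  case False
  assume i: "1 \<le> i" "i + 2 < n"
  then show ?thesis using z_off[OF False i] cc_sub_W[OF i] False by auto
qed

lemma z_permutes: "z permutes X"
proof (rule bij_imp_permutes)
  have P: "s 1 x \<in> c 1 \<union> c 2 \<longleftrightarrow> x \<in> c 1 \<union> c 2" for x
  proof -
    have "s 1 ` (c 1 \<union> c 2) = c 1 \<union> c 2"
      using image_c[of 1 1] image_c[of 1 2] n by (auto simp: image_Un numeral_2_eq_2)
    moreover have "s 1 x \<in> s 1 ` (c 1 \<union> c 2) \<longleftrightarrow> x \<in> c 1 \<union> c 2" using inj[of 1] n by auto
    ultimately show ?thesis by simp
  qed
  have "inj_on z X"
  proof (rule inj_onI)
    fix x y assume "z x = z y"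
    then show "x = y"
      using P[of x] P[of y] c_step[of x] c_step[of y] inj[of 1] q.t_inj n unfolding z_def
      by (auto split: if_splits)
  qed
  moreover have "z ` X \<subseteq> X"
    using in_X[of 1] in_X[of "n - 1"] n by (auto simp: z_def t_def)
  ultimately show "bij_betw z X X" using finite_X by (simp add: bij_betw_def endo_inj_surj)
  show "z x = x" if "x \<notin> X" for x
  proof -
    have "c 1 \<subseteq> X" "c 2 \<subseteq> X" using c_X n by simp_all
    then show ?thesis using outside[of 1 x] that n by (auto simp: z_def)
  qed
qed

text \<open>On \<open>W\<close> the map \<open>z\<close> is \<open>t\<close>; off \<open>W\<close>
  it equals any of the generators \<open>s i\<close> with \<open>i + 2 < n\<close>, so the index can
  be chosen far from \<open>l\<close>. Only \<open>l = n - 2\<close> resists, because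
  \<open>s l\<close> need not preserve \<open>W\<close>.\<close>

lemma z_commute:
  assumes l: "1 \<le> l" "l < n"
  shows "z (s l x) = s l (z x)"
proof -
  consider "l + 2 < n" | "l = n - 1" | "l = n - 2" using l by linarith
  then show ?thesis
  proof cases
    case 1
    show ?thesis
    proof (cases "x \<in> W")
      case True
      then have "s l x \<in> W" using W_step 1 l by simp
      then show ?thesis using z_W True q.comm[of l x] 1 l by simp
    next
      case False
      define i where "i = (if l \<le> 2 then 4 else 1::nat)"
      have i: "1 \<le> i" "i + 2 < n" "i + 2 \<le> l \<or> l + 2 \<le> i" using n by (auto simp: i_def)
      have "s l x \<notin> W" using W_step 1 l False by simp
      then show ?thesis using z_off[OF _ i(1,2)] False far_sym[of i l x] i l by simp
    qed
  next
    case 2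
    then have lt: "s l = t" by (simp add: t_def)
    show ?thesis
    proof (cases "x \<in> W")
      case True
      then show ?thesis using z_W tW_step lt by simp
    next
      case False
      then show ?thesis using z_off[of _ 1] tW_step lt q.comm[of 1 x] n by simp
    qed
  next
    case 3
    \<comment> \<open>The sets \<open>C 1\<close>, \<open>C 3\<close>, \<open>C 5\<close> are
      disjoint, so one of them misses both \<open>x\<close> and \<open>s l x\<close>. At these two
      points \<open>z\<close> is the corresponding generator, which is far from
      \<open>s (n - 2)\<close> because \<open>n \<ge> 9\<close>.\<close>
    define C where "C i = c i \<union> c (Suc i)" for i
    have "C 1 \<inter> C 3 = {}" "C 1 \<inter> C 5 = {}" "C 3 \<inter> C 5 = {}"
      unfolding C_def using n by (simp_all add: Int_Un_distrib Int_Un_distrib2 c_disjoint)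
    then have "\<not> (y \<in> C 1 \<and> y \<in> C 3)" "\<not> (y \<in> C 1 \<and> y \<in> C 5)" "\<not> (y \<in> C 3 \<and> y \<in> C 5)" for y
      by (simp_all add: disjoint_iff)
    from this[of x] this[of "s l x"]
    have "\<exists>i\<in>{1,3,5}. x \<notin> C i \<and> s l x \<notin> C i"
      by (simp only: bex_simps) argo
    then obtain i where i: "i \<in> {1,3,5}" "x \<notin> C i" "s l x \<notin> C i" by (elim bexE conjE)
    have i': "1 \<le> i" "i + 2 < n" "i + 2 \<le> l" using i(1) n 3 by auto
    have "z x = s i x" "z (s l x) = s i (s l x)"
      using s_z[OF i'(1,2), of x] s_z[OF i'(1,2), of "s l x"] i(2,3) unfolding C_def by simp_all
    then show ?thesis using far[OF i'(1,3) l(2)] by simp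
  qed
qed

lemma central_factor:
  "\<exists>z y D. z permutes X \<and>
     (\<forall>i x. 1 \<le> i \<longrightarrow> i < n \<longrightarrow> s i x = z (y i x) \<and> y i (z x) = z (y i x)) \<and>
     braid_action n y X \<and> block_system n y X D \<and> 2 \<le> card (D 1)"
proof -
  define u where "u = inv_into UNIV z"
  have u: "u (z x) = x" "z (u x) = x" for x
    using z_permutes by (simp_all add: u_def permutes_inverses)
  define y where "y i = u \<circ> s i" for i
  have y: "y i x = u (s i x)" for i x by (simp add: y_def)
  have us: "s i (u x) = u (s i x)" if "1 \<le> i" "i < n" for i x
    using z_commute[OF that, of "u x"] u by metis
  interpret y: braid_action n y X
  proof unfold_locales
    show "y i permutes X" if "1 \<le> i" "i < n" for i
      unfolding y_def u_def using perm[OF that] permutes_inv[OF z_permutes] by (rule permutes_compose)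
    fix i x
    show "y i (y k x) = y k (y i x)" if h: "1 \<le> i" "i + 2 \<le> k" "k < n" for k
    proof -
      have "1 \<le> k" "i < n" using h by auto
      then show ?thesis using h far[OF h, of x] by (simp add: y us)
    qed
    show "y i (y (Suc i) (y i x)) = y (Suc i) (y i (y (Suc i) x))" if h: "1 \<le> i" "Suc i < n"
    proof -
      have "1 \<le> Suc i" "i < n" using h by auto
      then show ?thesis using h braid[OF h] by (simp add: y us)
    qed
  qed (rule finite_X)
  have supp_y: "supp (y i) = c i \<union> c (Suc i)" if "1 \<le> i" "i + 2 < n" for i
  proof -
    have "y i x \<noteq> x \<longleftrightarrow> s i x \<noteq> z x" for x using u by (metis y)
    then show ?thesis using s_z[OF that] by (auto simp: supp_def)
  qed
  \<comment> \<open>Disjointness is visible for this pair only through the known supports; conjugacy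
    of far pairs extends it to pairs involving the last two generators.\<close>
  have "supp (y 1) \<inter> supp (y 3) = {}"
    using supp_y[of 1] supp_y[of 3] n c_disjoint by (simp add: Int_Un_distrib Int_Un_distrib2)
  then have far_y: "supp (y i) \<inter> supp (y k) = {}" if "1 \<le> i" "i + 2 \<le> k" "k < n" for i k
    using y.far_invariant[OF conj_inv_inter_card that] y.finite_supp[of i] that by simp
  obtain D where D: "block_system n y X D"
    using y.disjoint_supports_blocks[OF _ far_y] n by auto
  have "card (D 1) = j"
    using block_systemD(1)[OF D, of 1] supp_y[of 1] card_cc[of 1] n by simp
  moreover have "s i x = z (y i x) \<and> y i (z x) = z (y i x)" if "1 \<le> i" "i < n" for i x
    by (simp add: y u z_commute[OF that, symmetric])
  ultimately have "z permutes X \<and>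
     (\<forall>i x. 1 \<le> i \<longrightarrow> i < n \<longrightarrow> s i x = z (y i x) \<and> y i (z x) = z (y i x)) \<and>
     braid_action n y X \<and> block_system n y X D \<and> 2 \<le> card (D 1)"
    using z_permutes y.braid_action_axioms D j_ge by simp
  then show ?thesis by (intro exI)
qed

end

section \<open>Actions on fewer than twice as many points as strands\<close>

context braid_action
begin

lemma card_blocks:
  assumes "block_system n y X D" "n \<ge> 1"
  shows "card (\<Union>i\<in>{1..n}. D i) = n * card (D 1)" "n * card (D 1) \<le> card X"
proof -
  note D = block_systemD[OF assms(1)]
  have cD: "card (D i) = card (D 1)" if "1 \<le> i" "i \<le> n" for i
    using D(1)[OF that] D(1)[of 1] assms(2) by simp
  show eq: "card (\<Union>i\<in>{1..n}. D i) = n * card (D 1)"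
    by (rule card_UN_blocks[OF D(2) cD D(3)])
  have "(\<Union>i\<in>{1..n}. D i) \<subseteq> X" using D(2) by (intro UN_least) simp
  then show "n * card (D 1) \<le> card X" using eq card_mono[OF finite_X] by metis
qed

text \<open>Two passages to cycles leave \<open>n - 4\<close> strands on at most (n - 1)/2 points,
  which is exactly within the bound of \<open>small_action_equal\<close>. A standard action on the
  cycles of \<open>?t\<close> cannot occur: it would give \<open>n\<close> disjoint blocks of at
  least two points.\<close>

lemma fewer_than_2n_points:
  assumes n: "n \<ge> 9" and card_X: "card X < 2 * n"
  shows "gens_equal n s \<or> (\<exists>a. standard_on n s X a)"
proof -
  let ?t = "s (n - 1)"
  interpret q: quot_action "n - 2" s X ?t using n by (intro quot_action_last) simp
  let ?T = "rep ?t ` supp ?t"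
  have "2 * card ?T \<le> card X"
    using q.card_reps card_mono[OF finite_X q.supp_t_subset] by simp
  then have cT: "card ?T < n" using card_X by linarith
  interpret Q: braid_action "n - 2" "quot ?t s" ?T by (rule q.quot_action)
  let ?u = "quot ?t s (n - 2 - 1)"
  interpret q2: quot_action "n - 2 - 2" "quot ?t s" ?T ?u
    using n by (intro Q.quot_action_last) simp
  have "2 * card (rep ?u ` supp ?u) \<le> card ?T"
    using q2.card_reps card_mono[OF Q.finite_X q2.supp_t_subset] by simp
  then have "2 * card (rep ?u ` supp ?u) \<le> n - 2 - 2 + 3" using n cT by linarith
  then have "gens_equal (n - 2 - 2) (quot ?u (quot ?t s))"
    using n by (intro small_action_equal[OF _ _ q2.quot_action]) simp_all
  then have "gens_equal (n - 2) (quot ?t s) \<or> (\<exists>a. standard_on (n - 2) (quot ?t s) ?T a)"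
    using n cT by (intro Q.equal_on_cycles) auto
  then show ?thesis
  proof
    assume "gens_equal (n - 2) (quot ?t s)"
    then show ?thesis using n card_X by (intro equal_on_cycles) auto
  next
    assume "\<exists>a. standard_on (n - 2) (quot ?t s) ?T a"
    then obtain a where a: "standard_on (n - 2) (quot ?t s) ?T a" ..
    interpret sq: standard_quotient n s X a ?t "\<lambda>b. cyc ?t (a b)" "\<Union>b\<in>{1..n - 2}. cyc ?t (a b)"
      by unfold_locales (use n a in auto)
    interpret sc: standard_cycles n s X a ?t "\<lambda>b. cyc ?t (a b)" "\<Union>b\<in>{1..n - 2}. cyc ?t (a b)"
      by unfold_locales (rule sq.agree_off_W_small[OF card_X])
    obtain y D where "block_system n y X D" "2 \<le> card (D 1)"
      using sc.central_factor by (elim exE conjE)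
    then have "n * 2 \<le> n * card (D 1)" "n * card (D 1) \<le> card X"
      using card_blocks(2)[of y D] n by simp_all
    then show ?thesis using card_X by linarith
  qed
qed

end

section \<open>Orbit counts and auxiliary facts for eight and nine strands\<close>

context finite_perm
begin

lemma supp_reps: "supp t = (\<Union>c\<in>rep t ` supp t. cyc t c)"
proof (intro equalityI subsetI)
  fix x assume x: "x \<in> supp t"
  have "x \<in> cyc t (rep t x)" using rep_in_cyc cyc_sym by metis
  then show "x \<in> (\<Union>c\<in>rep t ` supp t. cyc t c)" using x by blast
next
  fix x assume "x \<in> (\<Union>c\<in>rep t ` supp t. cyc t c)"
  then obtain y where y: "y \<in> supp t" "x \<in> cyc t (rep t y)" by blast
  then show "x \<in> supp t" using cyc_subset_supp[of "rep t y"] rep_in_supp[of y] by blast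
qed

lemma reps_disjoint:
  assumes "c \<in> rep t ` supp t" "d \<in> rep t ` supp t" "c \<noteq> d"
  shows "cyc t c \<inter> cyc t d = {}"
proof (rule ccontr)
  assume "cyc t c \<inter> cyc t d \<noteq> {}"
  then have "cyc t c = cyc t d" by (rule cyc_disjoint)
  then have "d \<in> cyc t c" using cyc_self by metis
  then have "rep t c = rep t d" by (simp only: rep_eq_iff)
  then show False using assms rep_rep by auto
qed

lemma finite_supp_t: "finite (supp t)"
  using finite_subset[OF supp_t_subset fin] .

lemma card_cycles:
  assumes "C \<subseteq> rep t ` supp t"
  shows "card (\<Union>c\<in>C. cyc t c) = (\<Sum>c\<in>C. card (cyc t c))"
proof (rule card_UN_disjoint)
  show "finite C" using finite_subset[OF assms] finite_supp_t by simp
  show "\<forall>c\<in>C. \<forall>d\<in>C. c \<noteq> d \<longrightarrow> cyc t c \<inter> cyc t d = {}"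
    using assms reps_disjoint by blast
qed (simp add: finite_cyc)

lemma card_supp_ge:
  assumes "\<And>x. x \<in> supp t \<Longrightarrow> k \<le> card (cyc t x)"
  shows "k * card (rep t ` supp t) \<le> card (supp t)"
proof -
  have "card (rep t ` supp t) * k \<le> (\<Sum>c\<in>rep t ` supp t. card (cyc t c))"
    by (rule sum_bounded_below[of _ k, simplified]) (use assms rep_in_supp in auto)
  then show ?thesis using card_cycles[of "rep t ` supp t"] supp_reps by (simp add: mult.commute)
qed

lemma cyc_image_commute:
  assumes "\<And>x. g (t x) = t (g x)"
  shows "g ` cyc t x = cyc t (g x)"
  using funpow_commute[of g t] assms unfolding cyc_def by (simp add: image_image)

lemma rep_commute_iff:
  assumes "\<And>x. g (t x) = t (g x)" "\<And>x y. g x = g y \<longleftrightarrow> x = y"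
  shows "rep t (g x) = rep t (g y) \<longleftrightarrow> rep t x = rep t y"
proof -
  have "g y \<in> cyc t (g x) \<longleftrightarrow> y \<in> cyc t x"
    unfolding cyc_image_commute[of g x, OF assms(1), symmetric] using assms(2) by auto
  then show ?thesis by (simp only: rep_eq_iff)
qed

end

context braid_action
begin

text \<open>The quotient of two conjugate permutations is even, hence not a transposition.\<close>

lemma adjacent_differ_card:
  assumes i: "1 \<le> i" "Suc i < n" and neq: "s i \<noteq> s (Suc i)"
  shows "3 \<le> card {x. s i x \<noteq> s (Suc i) x}"
proof (rule ccontr)
  let ?p = "s i" and ?q = "s (Suc i)"
  let ?M = "{x. ?p x \<noteq> ?q x}"
  have pq: "?p permutes X" "?q permutes X" using perm i by auto
  define u where "u = inv_into UNIV ?q"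
  have u: "u (?q x) = x" "?q (u x) = x" for x using pq(2) by (simp_all add: u_def permutes_inverses)
  define r where "r = u \<circ> ?p"
  have r: "r permutes X" unfolding r_def u_def using pq permutes_inv by (intro permutes_compose)
  have qr: "?p = ?q \<circ> r" using u by (auto simp: r_def)
  have moved: "r x \<noteq> x \<longleftrightarrow> x \<in> ?M" for x
    using u(1)[of x] u(2)[of "?p x"] by (auto simp: r_def)
  have perms: "permutation ?p" "permutation ?q" "permutation r"
    using pq r finite_X permutation_permutes by blast+
  have fM: "finite ?M"
    using finite_subset[OF _ finite_X, of ?M] permutes_not_in[OF pq(1)] permutes_not_in[OF pq(2)] by force
  assume "\<not> 3 \<le> card ?M"
  then consider "card ?M = 0" | "card ?M = 1" | "card ?M = 2" by linarith
  then show False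
  proof cases
    case 1
    then have "?M = {}" using fM by simp
    then show False using neq by auto
  next
    case 2
    then obtain a where a: "?M = {a}" by (rule card_1_singletonE)
    then have "r a \<noteq> a" using moved[of a] by simp
    then have "r (r a) \<noteq> r a" using permutes_inj[OF r] by (auto dest: injD)
    then show False using a moved[of "r a"] \<open>r a \<noteq> a\<close> by blast
  next
    case 3
    then obtain a b where ab: "?M = {a, b}" "a \<noteq> b" by (auto simp: card_2_iff)
    have "r permutes {a, b}"
    proof (rule permutes_superset[OF r])
      fix x assume "x \<in> X - {a, b}"
      then show "r x = x" using moved[of x] ab(1) by blast
    qed
    then have "r = id \<or> r = Transposition.transpose a b" by (simp add: permutes_doubleton_iff)
    moreover have "r \<noteq> id" using moved[of a] ab by auto
    ultimately have "sign r = - 1" using ab(2) by (simp add: sign_swap_id)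
    moreover have "sign ?p = sign ?q"
    proof -
      have "?p \<circ> ?q \<circ> ?p = ?q \<circ> ?p \<circ> ?q" using braid[OF i] by auto
      then have "sign (?p \<circ> ?q \<circ> ?p) = sign (?q \<circ> ?p \<circ> ?q)" by simp
      then have "sign ?q * sign ?p = 1" using perms by (simp add: sign_compose permutation_compose)
      then show ?thesis by (auto simp: sign_def split: if_splits)
    qed
    moreover have "sign ?p = sign ?q * sign r" using qr perms sign_compose by metis
    ultimately show False by (auto simp: sign_def split: if_splits)
  qed
qed

lemma delta_far: "n \<ge> 5 \<Longrightarrow> 6 \<le> k \<Longrightarrow> k < n \<Longrightarrow> delta (s k x) = s k (delta x)"
  using far[of 1 k] far[of 2 k] far[of 3 k] far[of 4 k] by (simp add: delta_def)

end

text \<open>Permutations in a braid relation have the same sign; even permutations of three points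
  commute, and commuting ones in a braid relation are equal. So \<open>p\<close> and
  \<open>q\<close> are different transpositions, and the points are named after them. The proof runs
  through the possible values.\<close>

lemma three_points:
  assumes p: "p permutes Y" and q: "q permutes Y" and Y: "card Y = 3"
    and neq: "\<And>x. x \<in> Y \<Longrightarrow> p x \<noteq> q x"
    and br: "\<And>x. x \<in> Y \<Longrightarrow> p (q (p x)) = q (p (q x))"
    and q1: "\<exists>x\<in>Y. q x \<noteq> x"
  obtains a b c where "Y = {a, b, c}" "a \<noteq> b" "a \<noteq> c" "b \<noteq> c" "q a = a" "q b = c" "q c = b" "p a = b"
proof -
  obtain a b c where Yabc: "Y = {a, b, c}" and d: "a \<noteq> b" "a \<noteq> c" "b \<noteq> c"
    using Y by (auto simp: card_3_iff)
  have inj: "p x = p y \<longleftrightarrow> x = y" "q x = q y \<longleftrightarrow> x = y" for x y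
    using permutes_inj[OF p] permutes_inj[OF q] by (auto dest: injD)
  have vals: "p x \<in> {a,b,c}" "q x \<in> {a,b,c}" if "x \<in> {a,b,c}" for x
    using that permutes_in_image[OF p] permutes_in_image[OF q] Yabc by auto
  have dd: "b \<noteq> a" "c \<noteq> a" "c \<noteq> b" using d by auto
  have ne: "p a \<noteq> q a" "p b \<noteq> q b" "p c \<noteq> q c" using neq Yabc by auto
  have i: "p a \<noteq> p b" "p a \<noteq> p c" "p b \<noteq> p c" "q a \<noteq> q b" "q a \<noteq> q c" "q b \<noteq> q c"
    using inj d by auto
  have b3: "p (q (p a)) = q (p (q a))" "p (q (p b)) = q (p (q b))" "p (q (p c)) = q (p (q c))"
    using br Yabc by auto
  have q1': "q a \<noteq> a \<or> q b \<noteq> b \<or> q c \<noteq> c" using q1 Yabc by auto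
  have pv: "p a = a \<or> p a = b \<or> p a = c" "p b = a \<or> p b = b \<or> p b = c" "p c = a \<or> p c = b \<or> p c = c"
    and qv: "q a = a \<or> q a = b \<or> q a = c" "q b = a \<or> q b = b \<or> q b = c" "q c = a \<or> q c = b \<or> q c = c"
    using vals by auto
  have "q a = a \<and> q b = c \<and> q c = b \<and> p a \<noteq> a \<or> q b = b \<and> q a = c \<and> q c = a \<and> p b \<noteq> b \<or>
      q c = c \<and> q a = b \<and> q b = a \<and> p c \<noteq> c"
    using qv pv i ne b3 q1' d dd by (elim disjE) simp_all
  then show thesis
  proof (elim disjE conjE)
    assume h: "q a = a" "q b = c" "q c = b" "p a \<noteq> a"
    then show thesis using pv(1) that[of a b c] that[of a c b] Yabc d dd by auto
  next
    assume h: "q b = b" "q a = c" "q c = a" "p b \<noteq> b"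
    then show thesis using pv(2) that[of b a c] that[of b c a] Yabc d dd by auto
  next
    assume h: "q c = c" "q a = b" "q b = a" "p c \<noteq> c"
    then show thesis using pv(3) that[of c a b] that[of c b a] Yabc d dd by auto
  qed
qed

context quot_action
begin

text \<open>\<open>g\<close> conjugates \<open>s 1\<close> to \<open>s 2\<close>; if it fixed every
  cycle of \<open>t\<close>, the two would permute the cycles alike.\<close>

lemma cycle_moved:
  assumes "3 \<le> m" and gt: "\<And>x. g (t x) = t (g x)" and g_inj: "\<And>x y. g x = g y \<longleftrightarrow> x = y"
    and g12: "\<And>x. g (s 1 x) = s 2 (g x)" and neq: "\<not> gens_equal m (quot t s)"
  shows "\<exists>x\<in>supp t. rep t (g x) \<noteq> rep t x"
proof (rule ccontr)
  assume "\<not> ?thesis"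
  then have fixed: "rep t (g x) = rep t x" if "x \<in> supp t" for x using that by blast
  interpret Q: braid_action m "quot t s" "rep t ` supp t" by (rule quot_action)
  have "quot t s 1 c = quot t s (Suc 1) c" for c
  proof (cases "c \<in> rep t ` supp t")
    case True
    then obtain x where x: "x \<in> supp t" "c = rep t x" by blast
    have gx: "g x \<in> supp t" using x(1) gt g_inj unfolding supp_def by (auto simp flip: gt)
    have "quot t s 2 c = rep t (s 2 (g x))"
      using quot_rep[of 2 "g x"] gx fixed[OF x(1)] x(2) assms(1) by simp
    also have "\<dots> = rep t (s 1 x)"
      using fixed[of "s 1 x"] in_supp[of 1 x] x(1) assms(1) by (simp flip: g12)
    also have "\<dots> = quot t s 1 c" using quot_rep[of 1 x] x assms(1) by simp
    finally show ?thesis by (simp add: numeral_2_eq_2)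
  next
    case False
    then show ?thesis by (simp add: quot_def)
  qed
  then have "quot t s 1 = quot t s (Suc 1)" by blast
  then show False using Q.gens_equal_adjacent[of 1] neq assms(1) by simp
qed

end

context braid_action
begin

lemma five_power_commuting:
  assumes "n \<ge> 5"
  obtains g v where "g permutes X" "g ^^ (5 ^ v) = id" "\<And>x. g (s 1 x) = s 2 (g x)"
    "\<And>k x. 6 \<le> k \<Longrightarrow> k < n \<Longrightarrow> g (s k x) = s k (g x)"
proof -
  obtain M v where g: "(delta ^^ M) ^^ (5 ^ v) = id" "\<And>x. (delta ^^ M) (s 1 x) = s 2 ((delta ^^ M) x)"
    using five_power_element[OF assms] by blast
  show thesis
  proof (rule that[of "delta ^^ M" v])
    show "(delta ^^ M) permutes X" by (rule permutes_funpow[OF delta_permutes[OF assms]])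
    show "(delta ^^ M) (s k x) = s k ((delta ^^ M) x)" if "6 \<le> k" "k < n" for k x
      by (rule funpow_commute[of "s k" delta, OF delta_far[OF assms that, symmetric], symmetric])
  qed (rule g(1), rule g(2))
qed

end

text \<open>The recurrence has characteristic polynomial \<open>X^2 - X + 1\<close>, with value 1 at
  1 and 3 at -1, and it gives \<open>E3 = - E0\<close>. As 2 and 3 are invertible modulo 5, a
  solution of period 1, 2 or 3 vanishes.\<close>

lemma mod_5_recurrence:
  fixes E0 E1 E2 E3 :: nat
  assumes "(E0 + E2) mod 5 = E1 mod 5" "(E1 + E3) mod 5 = E2 mod 5"
    and "E1 mod 5 = E0 mod 5 \<and> E2 mod 5 = E1 mod 5 \<or>
      E2 mod 5 = E0 mod 5 \<and> E3 mod 5 = E1 mod 5 \<or> E3 mod 5 = E0 mod 5"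
  shows "E0 mod 5 = 0"
proof -
  have dvd: "a mod 5 = b mod 5 \<Longrightarrow> \<exists>k. int a = int b + 5 * k" for a b :: nat
  proof -
    assume "a mod 5 = b mod 5"
    then have "int a mod 5 = int b mod 5" by (metis of_nat_mod of_nat_numeral)
    then have "5 dvd int a - int b" by (simp add: mod_eq_dvd_iff)
    then obtain k where "int a - int b = 5 * k" by (rule dvdE)
    then have "int a = int b + 5 * k" by linarith
    then show ?thesis ..
  qed
  obtain k1 k2 where k: "int E0 + int E2 = int E1 + 5 * k1" "int E1 + int E3 = int E2 + 5 * k2"
    using dvd[OF assms(1)] dvd[OF assms(2)] by auto
  have "\<exists>l. int E0 = 5 * l"
    using assms(3)
  proof (elim disjE conjE)
    assume "E1 mod 5 = E0 mod 5" "E2 mod 5 = E1 mod 5"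
    then obtain k3 k4 where "int E1 = int E0 + 5 * k3" "int E2 = int E1 + 5 * k4"
      using dvd by blast
    then have "int E0 = 5 * (k1 - k4)" using k by (simp add: algebra_simps)
    then show ?thesis ..
  next
    assume "E2 mod 5 = E0 mod 5" "E3 mod 5 = E1 mod 5"
    then obtain k3 k4 where "int E2 = int E0 + 5 * k3" "int E3 = int E1 + 5 * k4"
      using dvd by blast
    then have "3 * int E0 = 5 * (2 * k1 - k3 + k2 - k4)" using k by (simp add: algebra_simps)
    then have "int E0 = 5 * (2 * (2 * k1 - k3 + k2 - k4) - int E0)" by (simp add: algebra_simps)
    then show ?thesis ..
  next
    assume "E3 mod 5 = E0 mod 5"
    then obtain k3 where "int E3 = int E0 + 5 * k3" using dvd by blast
    then have "2 * int E0 = 5 * (k1 + k2 - k3)" using k by (simp add: algebra_simps)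
    then have "int E0 = 5 * (3 * (k1 + k2 - k3) - int E0)" by (simp add: algebra_simps)
    then show ?thesis ..
  qed
  then have "5 dvd int E0" by (metis dvd_triv_left)
  then have "5 dvd E0" by (metis int_dvd_int_iff of_nat_numeral)
  then show ?thesis by simp
qed

section \<open>Actions of eight strands\<close>

text \<open>The element \<open>g\<close> of the first five strands commutes with the last three, so that the group
  generated by \<open>s\<^sub>6\<close> and \<open>s\<^sub>7\<close> acts on the few orbits of \<open>g\<close>.\<close>

locale eight_strands = braid_action 8 s X
  for s :: "nat \<Rightarrow> 'a \<Rightarrow> 'a" and X :: "'a set" +
  fixes g v x0
  assumes card_X: "card X \<le> 15"
    and neq: "\<not> gens_equal 6 (quot (s 7) s)"
    and gX: "g permutes X" and g_order: "g ^^ (5 ^ v) = id"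
    and g_far: "\<And>k x. 6 \<le> k \<Longrightarrow> k < 8 \<Longrightarrow> g (s k x) = s k (g x)"
    and x0: "x0 \<in> supp (s 7)" "rep (s 7) (g x0) \<noteq> rep (s 7) x0"
begin

sublocale q: quot_action 6 s X "s 7"
  by (intro quot_action_far) auto

sublocale G: finite_perm g X
  by unfold_locales (simp_all add: gX finite_X)

text \<open>Three strands, with the indices shifted: generators 1 and 2 are \<open>s 6\<close> and
  \<open>s 7\<close>.\<close>

sublocale o: quot_action 3 "\<lambda>i. s (i + 5)" X g
proof (intro quot_action.intro shift_action quot_action_axioms.intro G.finite_perm_axioms)
  show "s (i + 5) (g x) = g (s (i + 5) x)" if "1 \<le> i" "i < 3" for i x
    using that by (simp add: g_far)
qed simp

sublocale O: braid_action 3 "quot g (\<lambda>i. s (i + 5))" "rep g ` supp g"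
  by (rule o.quot_action)

lemma g67: "g (s 6 x) = s 6 (g x)" "g (s 7 x) = s 7 (g x)"
  by (simp_all add: g_far)

lemma g_cyc:
  assumes "x \<in> supp g"
  shows "(g ^^ 5) x = x" "card (cyc g x) = 5" "cyc g x = (\<lambda>i. (g ^^ i) x) ` {..<5}"
proof -
  have gx: "g x \<noteq> x" using assms by (simp add: supp_def)
  have "card (cyc g x) \<le> card X"
    using assms G.supp_t_subset G.cyc_subset finite_X by (intro card_mono) auto
  then show "(g ^^ 5) x = x"
    using five_power_cyc_card(2)[OF G.finite_perm_axioms g_order gx] card_X by simp
  from five_power_cyc_card(3)[OF G.finite_perm_axioms g_order gx this]
  show "card (cyc g x) = 5" "cyc g x = (\<lambda>i. (g ^^ i) x) ` {..<5}" by (rule conjunct1, rule conjunct2)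
qed

lemma card_orbits: "5 * card (rep g ` supp g) \<le> card (supp g)" "card (rep g ` supp g) \<le> 3"
proof -
  show "5 * card (rep g ` supp g) \<le> card (supp g)"
    using G.card_supp_ge[of 5] g_cyc(2) by simp
  then show "card (rep g ` supp g) \<le> 3"
    using card_mono[OF finite_X G.supp_t_subset] card_X by simp
qed

lemma x0_g: "x0 \<in> supp g"
  using x0(2) by (auto simp: supp_def)

lemma inj_x0: "inj_on (\<lambda>i. rep (s 7) ((g ^^ i) x0)) {..<5}"
proof (rule five_power_inj[OF g_order])
  show "\<forall>y y'. rep (s 7) y = rep (s 7) y' \<longrightarrow> rep (s 7) (g y) = rep (s 7) (g y')"
    using q.rep_commute_iff[of g] g67(2) G.t_inj by blast
qed (rule x0(2))

text \<open>The five points of the orbit of \<open>x0\<close> under \<open>g\<close> lie on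
  different cycles of \<open>s 7\<close>, so a power of \<open>s 7\<close> that stays in this orbit
  fixes \<open>x0\<close>.\<close>

lemma t_funpow_x0:
  assumes "(s 7 ^^ k) x0 \<in> cyc g x0"
  shows "(s 7 ^^ k) x0 = x0"
proof -
  obtain i where i: "i < 5" "(s 7 ^^ k) x0 = (g ^^ i) x0"
    using assms g_cyc(3)[OF x0_g] by auto
  then have "rep (s 7) ((g ^^ i) x0) = rep (s 7) ((g ^^ 0) x0)"
    using q.rep_funpow[of k x0] by simp
  then have "i = 0" using inj_onD[OF inj_x0, of i 0] i(1) by simp
  then show ?thesis using i(2) by simp
qed

lemma t_moves: "rep g (s 7 x0) \<noteq> rep g x0"
proof
  assume "rep g (s 7 x0) = rep g x0"
  then have "s 7 x0 \<in> cyc g x0" using G.rep_eq_iff by metis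
  then have "s 7 x0 = x0" using t_funpow_x0[of 1] by simp
  then show False using x0(1) by (simp add: supp_def)
qed

lemma O_rep:
  assumes "x \<in> supp g"
  shows "quot g (\<lambda>i. s (i + 5)) 1 (rep g x) = rep g (s 6 x)"
    "quot g (\<lambda>i. s (i + 5)) 2 (rep g x) = rep g (s 7 x)"
  using o.quot_rep[of 1 x] o.quot_rep[of 2 x] assms by simp_all

lemma supp_g_step: "s 6 x \<in> supp g \<longleftrightarrow> x \<in> supp g" "s 7 x \<in> supp g \<longleftrightarrow> x \<in> supp g"
  using o.in_supp[of 1 x] o.in_supp[of 2 x] by simp_all

text \<open>Pigeonhole: there are at most three nontrivial orbits of \<open>g\<close>, and
  \<open>s 7\<close> permutes them.\<close>

lemma returns:
  assumes x: "x \<in> supp g"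
  shows "\<exists>k\<in>{1,2,3}. (s 7 ^^ k) x \<in> cyc g x"
proof -
  have tk: "(s 7 ^^ k) x \<in> supp g" for k
    by (induction k) (use x supp_g_step(2) in auto)
  have "\<not> inj_on (\<lambda>k. rep g ((s 7 ^^ k) x)) {..3}"
  proof
    assume "inj_on (\<lambda>k. rep g ((s 7 ^^ k) x)) {..3}"
    then have "card ((\<lambda>k. rep g ((s 7 ^^ k) x)) ` {..3}) = 4" by (simp add: card_image)
    moreover have "(\<lambda>k. rep g ((s 7 ^^ k) x)) ` {..3} \<subseteq> rep g ` supp g" using tk by auto
    ultimately have "4 \<le> card (rep g ` supp g)"
      using card_mono[of "rep g ` supp g" "(\<lambda>k. rep g ((s 7 ^^ k) x)) ` {..3}"] G.finite_supp_t by simp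
    then show False using card_orbits(2) by simp
  qed
  then obtain i k where ik: "i < k" "k \<le> 3" "rep g ((s 7 ^^ i) x) = rep g ((s 7 ^^ k) x)"
    by (auto simp: inj_on_def) (metis linorder_neqE_nat)
  have comm: "(s 7 ^^ i) (g y) = g ((s 7 ^^ i) y)" for y
    by (rule funpow_commute[of g "s 7", OF g67(2), symmetric])
  have "(s 7 ^^ k) x = (s 7 ^^ i) ((s 7 ^^ (k - i)) x)"
    unfolding funpow_funpow using ik(1) by simp
  then have "rep g ((s 7 ^^ i) ((s 7 ^^ (k - i)) x)) = rep g ((s 7 ^^ i) x)" using ik(3) by simp
  then have "rep g ((s 7 ^^ (k - i)) x) = rep g x"
    using G.rep_commute_iff[of "s 7 ^^ i"] comm permutes_inj[OF permutes_funpow[OF q.t]] by (metis injD)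
  then have "(s 7 ^^ (k - i)) x \<in> cyc g x" using G.rep_eq_iff by metis
  moreover have "k - i \<in> {1,2,3}" using ik by auto
  ultimately show ?thesis by blast
qed

text \<open>At each point \<open>s 6\<close> is a power of \<open>g\<close> after
  \<open>s 7\<close>. Modulo 5 the exponent is constant on orbits of \<open>g\<close>; along
  \<open>s 7\<close> it satisfies the recurrence of \<open>mod_5_recurrence\<close> by the braid
  relation and is periodic by \<open>returns\<close>. Hence it vanishes.\<close>

lemma agree_on_supp_g:
  assumes eq: "quot g (\<lambda>i. s (i + 5)) 1 = quot g (\<lambda>i. s (i + 5)) 2" and x: "x \<in> supp g"
  shows "s 6 x = s 7 x"
proof -
  have "\<exists>e. s 6 y = (g ^^ e) (s 7 y)" if "y \<in> supp g" for y
  proof -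
    have "rep g (s 7 y) = rep g (s 6 y)" using O_rep[OF that] eq by simp
    then have "s 6 y \<in> cyc g (s 7 y)" by (simp only: G.rep_eq_iff)
    then show ?thesis by (auto elim: cycE)
  qed
  then obtain e where e: "\<And>y. y \<in> supp g \<Longrightarrow> s 6 y = (g ^^ e y) (s 7 y)" by metis
  have gk: "s 6 ((g ^^ k) y) = (g ^^ k) (s 6 y)" "s 7 ((g ^^ k) y) = (g ^^ k) (s 7 y)" for k y
    by (rule funpow_commute[of "s 6" g, OF g67(1)[symmetric]],
        rule funpow_commute[of "s 7" g, OF g67(2)[symmetric]])
  have per: "a mod 5 = b mod 5" if w: "w \<in> supp g" and ab: "(g ^^ a) w = (g ^^ b) w" for a b w
  proof -
    have eq5: "(g ^^ (a mod 5)) w = (g ^^ (b mod 5)) w"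
      by (simp only: funpow_mod_eq[OF g_cyc(1)[OF w]] ab)
    have "card ((\<lambda>i. (g ^^ i) w) ` {..<5}) = 5" using g_cyc(2)[OF w] by (simp only: g_cyc(3)[OF w])
    then have "inj_on (\<lambda>i. (g ^^ i) w) {..<5}" by (intro eq_card_imp_inj_on) simp_all
    from inj_onD[OF this eq5] show ?thesis by simp
  qed
  have rel: "(e y + e (s 7 (s 7 y))) mod 5 = e (s 7 y) mod 5" if y: "y \<in> supp g" for y
  proof -
    have y': "s 7 y \<in> supp g" "s 7 (s 7 y) \<in> supp g" "s 7 (s 7 (s 7 y)) \<in> supp g"
      using y supp_g_step by simp_all
    have "s 6 (s 7 (s 6 y)) = (g ^^ (e y + e (s 7 (s 7 y)))) (s 7 (s 7 (s 7 y)))"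
      by (simp only: e[OF y] gk e[OF y'(2)] funpow_funpow)
    moreover have "s 7 (s 6 (s 7 y)) = (g ^^ e (s 7 y)) (s 7 (s 7 (s 7 y)))"
      by (simp only: e[OF y'(1)] gk)
    moreover have "s 6 (s 7 (s 6 y)) = s 7 (s 6 (s 7 y))" using braid[of 6 y] by simp
    ultimately show ?thesis using per[OF y'(3)] by metis
  qed
  have inv: "e z mod 5 = e y mod 5" if y: "y \<in> supp g" and z: "z \<in> cyc g y" for y z
  proof -
    obtain k where k: "z = (g ^^ k) y" using z by (rule cycE)
    have zs: "z \<in> supp g" using k y G.supp_funpow by simp
    have "(g ^^ e z) (s 7 z) = s 6 z" using e[OF zs] by simp
    also have "\<dots> = (g ^^ (k + e y)) (s 7 y)" by (simp only: k gk e[OF y] funpow_funpow)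
    also have "\<dots> = (g ^^ e y) (s 7 z)" by (simp only: k gk funpow_funpow add.commute)
    finally show ?thesis by (rule per[rotated]) (simp only: supp_g_step zs)
  qed
  obtain k where k: "k \<in> {1,2,3}" "(s 7 ^^ k) x \<in> cyc g x" using returns[OF x] by blast
  have k': "(s 7 ^^ k) (s 7 x) \<in> cyc g (s 7 x)"
  proof -
    obtain i where "(s 7 ^^ k) x = (g ^^ i) x" using k(2) by (rule cycE)
    then have "s 7 ((s 7 ^^ k) x) = (g ^^ i) (s 7 x)" by (simp only: gk)
    then have "(s 7 ^^ k) (s 7 x) = (g ^^ i) (s 7 x)" by (simp only: funpow_swap1)
    then show ?thesis by (simp only: cyc_funpow)
  qed
  have x': "s 7 x \<in> supp g" by (simp only: supp_g_step x)
  have "e x mod 5 = 0"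
  proof (rule mod_5_recurrence[OF rel[OF x] rel[OF x']])
    show "e (s 7 x) mod 5 = e x mod 5 \<and> e (s 7 (s 7 x)) mod 5 = e (s 7 x) mod 5 \<or>
      e (s 7 (s 7 x)) mod 5 = e x mod 5 \<and> e (s 7 (s 7 (s 7 x))) mod 5 = e (s 7 x) mod 5 \<or>
      e (s 7 (s 7 (s 7 x))) mod 5 = e x mod 5"
    proof -
      have E: "e ((s 7 ^^ k) x) mod 5 = e x mod 5" "e ((s 7 ^^ k) (s 7 x)) mod 5 = e (s 7 x) mod 5"
        by (rule inv[OF x k(2)], rule inv[OF x' k'])
      consider "k = Suc 0" | "k = Suc (Suc 0)" | "k = Suc (Suc (Suc 0))"
        using k(1) by (auto simp: numeral_2_eq_2 numeral_3_eq_3)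
      then show ?thesis
        by cases (use E in \<open>simp_all only: funpow.simps comp_apply id_apply simp_thms\<close>)
    qed
  qed
  then have "(g ^^ e x) (s 7 x) = s 7 x"
    using funpow_mod_eq[OF g_cyc(1)[OF x'], of "e x"] by (simp only: funpow_0)
  then show ?thesis by (simp only: e[OF x])
qed

text \<open>Otherwise \<open>s 6\<close> and \<open>s 7\<close>, and by conjugacy \<open>s 1\<close>
  and \<open>s 2\<close>, differ in at most 15 - 10 points, since \<open>g\<close> moves at least
  two orbits. But \<open>s 1\<close> and \<open>s 2\<close> differ on at least three cycles of
  \<open>s 7\<close>, each of at least two points.\<close>

lemma not_equal_on_orbits: "quot g (\<lambda>i. s (i + 5)) 1 \<noteq> quot g (\<lambda>i. s (i + 5)) 2"
proof
  assume eq: "quot g (\<lambda>i. s (i + 5)) 1 = quot g (\<lambda>i. s (i + 5)) 2"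
  let ?T = "rep (s 7) ` supp (s 7)" and ?S = "quot (s 7) s"
  interpret Q: braid_action 6 ?S ?T by (rule q.quot_action)
  have "card {rep g x0, rep g (s 7 x0)} \<le> card (rep g ` supp g)"
    using x0_g supp_g_step(2) G.finite_supp_t by (intro card_mono) auto
  then have "10 \<le> card (supp g)" using card_orbits(1) t_moves by simp
  moreover have "card (X - supp g) = card X - card (supp g)"
    using G.supp_t_subset G.finite_supp_t by (rule card_Diff_subset[rotated])
  ultimately have "card (X - supp g) \<le> 5" using card_X by simp
  moreover have "{x. s 6 x \<noteq> s 7 x} \<subseteq> X - supp g"
    using agree_on_supp_g[OF eq] outside[of 6] outside[of 7] by force
  then have "card {x. s 6 x \<noteq> s 7 x} \<le> card (X - supp g)" using finite_X by (intro card_mono) auto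
  ultimately have le5: "card {x. s 1 x \<noteq> s 2 x} \<le> 5"
    using adjacent_invariant[OF conj_inv_diff_card, of 6] by simp
  let ?M = "{c. ?S 1 c \<noteq> ?S 2 c}"
  have "?S 1 \<noteq> ?S (Suc 1)" using Q.gens_equal_adjacent[of 1] neq by auto
  then have M3: "3 \<le> card ?M" using Q.adjacent_differ_card[of 1] by (simp add: numeral_2_eq_2)
  have MT: "?M \<subseteq> ?T" by (auto simp: quot_def split: if_splits)
  have "(\<Sum>c\<in>?M. 2) \<le> (\<Sum>c\<in>?M. card (cyc (s 7) c))"
  proof (rule sum_mono)
    fix c assume "c \<in> ?M"
    then have "c \<in> supp (s 7)" using MT q.rep_in_supp by blast
    then show "2 \<le> card (cyc (s 7) c)" by (rule q.card_cyc_supp)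
  qed
  also have "\<dots> = card (\<Union>c\<in>?M. cyc (s 7) c)" using q.card_cycles[OF MT] by simp
  also have "\<dots> \<le> card {x. s 1 x \<noteq> s 2 x}"
  proof (rule card_mono)
    have "{x. s 1 x \<noteq> s 2 x} \<subseteq> X" using outside[of 1] outside[of 2] by force
    then show "finite {x. s 1 x \<noteq> s 2 x}" using finite_X finite_subset by blast
    show "(\<Union>c\<in>?M. cyc (s 7) c) \<subseteq> {x. s 1 x \<noteq> s 2 x}"
    proof (intro UN_least subsetI CollectI)
      fix c y assume c: "c \<in> ?M" and y: "y \<in> cyc (s 7) c"
      obtain x where x: "x \<in> supp (s 7)" "c = rep (s 7) x" using c MT by blast
      have cy: "c = rep (s 7) y" using y x(2) q.rep_rep q.rep_eq_iff by metis
      then have ys: "y \<in> supp (s 7)" using x q.rep_in_supp by metis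
      show "s 1 y \<noteq> s 2 y"
        using c q.quot_rep[of 1 y] q.quot_rep[of 2 y] ys cy by auto
    qed
  qed
  finally show False using le5 M3 by simp
qed

text \<open>There remain three orbits of five points, filling \<open>X\<close>, on which
  \<open>s 6\<close> and \<open>s 7\<close> act as two transpositions. The numbers of fixed points
  of \<open>s 7\<close> and of its square must be multiples of 3, yet either \<open>s 7\<close> has
  5 or its square has 10.\<close>

lemma contradiction: False
proof -
  let ?p = "quot g (\<lambda>i. s (i + 5)) 1" and ?q = "quot g (\<lambda>i. s (i + 5)) 2" and ?Y = "rep g ` supp g"
  have fY: "finite ?Y" using G.finite_supp_t by simp
  have sub: "{c. ?p c \<noteq> ?q c} \<subseteq> ?Y" by (auto simp: quot_def split: if_splits)
  have ge: "3 \<le> card {c. ?p c \<noteq> ?q c}"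
    using O.adjacent_differ_card[of 1] not_equal_on_orbits by (simp add: numeral_2_eq_2)
  then have Y3: "card ?Y = 3" using card_mono[OF fY sub] card_orbits(2) by simp
  then have all: "{c. ?p c \<noteq> ?q c} = ?Y" using card_subset_eq[OF fY sub] ge card_mono[OF fY sub] by simp
  have pY: "?p permutes ?Y" "?q permutes ?Y" using O.perm[of 1] O.perm[of 2] by simp_all
  have neq': "?p c \<noteq> ?q c" if "c \<in> ?Y" for c using all that by blast
  have br: "?p (?q (?p c)) = ?q (?p (?q c))" for c
    using O.braid[of 1 c] by (simp add: numeral_2_eq_2)
  have mv: "\<exists>c\<in>?Y. ?q c \<noteq> c"
  proof (rule bexI)
    show "?q (rep g x0) \<noteq> rep g x0" using O_rep(2)[OF x0_g] t_moves by simp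
    show "rep g x0 \<in> ?Y" using x0_g by (rule imageI)
  qed
  obtain a b c where abc: "?Y = {a, b, c}" "a \<noteq> b" "a \<noteq> c" "b \<noteq> c"
    "?q a = a" "?q b = c" "?q c = b" "?p a = b"
    using three_points[OF pY Y3 neq' br mv] by blast
  have rep_self: "rep g d = d" "d \<in> supp g" if "d \<in> ?Y" for d
    using that G.rep_rep G.rep_in_supp by auto
  have X_g: "supp g = X"
    using card_orbits(1) Y3 card_X card_mono[OF finite_X G.supp_t_subset]
    by (intro card_subset_eq[OF finite_X G.supp_t_subset]) simp
  have X_un: "X = cyc g a \<union> cyc g b \<union> cyc g c"
  proof -
    have "supp g = (\<Union>d\<in>{a, b, c}. cyc g d)" using G.supp_reps unfolding abc(1) .
    then show ?thesis unfolding X_g by (simp add: Un_assoc)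
  qed
  have disj: "cyc g a \<inter> cyc g b = {}" "cyc g a \<inter> cyc g c = {}" "cyc g b \<inter> cyc g c = {}"
    using G.reps_disjoint abc by auto
  have in_Y: "a \<in> ?Y" "b \<in> ?Y" "c \<in> ?Y" using abc(1) by auto
  \<comment> \<open>The count is made for \<open>s 1\<close>, which commutes with \<open>s 6\<close>
    and \<open>s 7\<close>. These preserve the fixed points of its powers and permute the three
    orbits transitively, so every orbit has the same share.\<close>
  have div3: "3 dvd card {x. x \<in> X \<and> (s 7 ^^ m) x = x}" for m
  proof -
    define F where "F = {x. x \<in> X \<and> (s 1 ^^ m) x = x}"
    have move: "card (F \<inter> cyc g d) = card (F \<inter> cyc g (quot g (\<lambda>i. s (i + 5)) i d))"
      if i: "i = 1 \<or> i = 2" and d: "d \<in> ?Y" for i d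
    proof -
      let ?w = "s (i + 5)"
      have i': "1 \<le> i" "i < 3" using i by auto
      have w1: "?w ((s 1 ^^ m) x) = (s 1 ^^ m) (?w x)" for x
      proof (rule funpow_commute[of ?w "s 1"])
        show "?w (s 1 y) = s 1 (?w y)" for y using i far_sym[of "i + 5" 1 y] by auto
      qed
      have wi: "?w x = ?w y \<longleftrightarrow> x = y" for x y using i inj[of "i + 5"] by auto
      have wF: "?w x \<in> F \<longleftrightarrow> x \<in> F" for x
        using in_X[of "i + 5" x] i w1[of x] wi by (auto simp: F_def)
      have "?w ` (F \<inter> cyc g d) = F \<inter> cyc g (?w d)"
        unfolding o.cyc_image[OF i', symmetric] using wF wi by (auto simp: image_iff)
      moreover have "cyc g (?w d) = cyc g (quot g (\<lambda>i. s (i + 5)) i d)"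
        using o.quot_rep[OF i' rep_self(2)[OF d]] rep_self(1)[OF d]
          G.cyc_eq[OF rep_in_cyc[of g "?w d"]] by simp
      moreover have "card (?w ` (F \<inter> cyc g d)) = card (F \<inter> cyc g d)"
        using wi by (simp add: card_image inj_on_def)
      ultimately show ?thesis by simp
    qed
    have "card (F \<inter> cyc g a) = card (F \<inter> cyc g b)" "card (F \<inter> cyc g b) = card (F \<inter> cyc g c)"
      using move[of 1 a] move[of 2 b] in_Y abc by simp_all
    moreover have "F = (F \<inter> cyc g a) \<union> (F \<inter> cyc g b) \<union> (F \<inter> cyc g c)"
      using X_un by (auto simp: F_def)
    moreover have "finite F" using finite_X by (simp add: F_def)
    then have "card ((F \<inter> cyc g a) \<union> (F \<inter> cyc g b) \<union> (F \<inter> cyc g c)) =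
        card (F \<inter> cyc g a) + card (F \<inter> cyc g b) + card (F \<inter> cyc g c)"
      using disj by (subst card_Un_disjoint | force)+
    ultimately have "card F = 3 * card (F \<inter> cyc g a)" by simp
    then show ?thesis
      using single_invariant[OF conj_inv_fix_card, of 7 m] by (simp add: F_def)
  qed
  have ag: "a \<in> supp g" "b \<in> supp g" "c \<in> supp g"
    by (rule rep_self(2)[OF in_Y(1)], rule rep_self(2)[OF in_Y(2)], rule rep_self(2)[OF in_Y(3)])
  have "rep g (s 7 a) = rep g a" using O_rep(2)[OF ag(1)] rep_self(1)[OF in_Y(1)] abc(5) by simp
  then have "s 7 a \<in> cyc g a" using G.rep_eq_iff[of a "s 7 a"] by simp
  then obtain e where e: "e < 5" "s 7 a = (g ^^ e) a" using g_cyc(3)[OF ag(1)] by auto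
  have tk: "s 7 ((g ^^ k) y) = (g ^^ k) (s 7 y)" for k y
    by (rule funpow_commute[of "s 7" g, OF g67(2)[symmetric]])
  have te: "s 7 y = (g ^^ e) y" if y: "y \<in> cyc g a" for y
  proof -
    obtain k where "y = (g ^^ k) a" using y by (rule cycE)
    then show ?thesis by (simp only: tk e(2) funpow_funpow add.commute)
  qed
  have t_swap: "s 7 y \<in> cyc g c" if "y \<in> cyc g b" for y
  proof -
    have "rep g y = b" using that G.rep_eq_iff[of b y] rep_self(1)[OF in_Y(2)] by simp
    moreover have "y \<in> supp g" using G.cyc_subset_supp[OF ag(2)] that by blast
    ultimately have "rep g (s 7 y) = rep g c"
      using O_rep(2)[of y] abc(6) rep_self(1)[OF in_Y(3)] by simp
    then show ?thesis using G.rep_eq_iff[of c "s 7 y"] by simp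
  qed
  have t_swap': "s 7 y \<in> cyc g b" if "y \<in> cyc g c" for y
  proof -
    have "rep g y = c" using that G.rep_eq_iff[of c y] rep_self(1)[OF in_Y(3)] by simp
    moreover have "y \<in> supp g" using G.cyc_subset_supp[OF ag(3)] that by blast
    ultimately have "rep g (s 7 y) = rep g b"
      using O_rep(2)[of y] abc(7) rep_self(1)[OF in_Y(2)] by simp
    then show ?thesis using G.rep_eq_iff[of b "s 7 y"] by simp
  qed
  have nofix: "s 7 y \<noteq> y" if "y \<in> cyc g b \<union> cyc g c" for y
    using that t_swap[of y] t_swap'[of y] disj by auto
  show False
  proof (cases "e = 0")
    case True
    then have "{x. x \<in> X \<and> (s 7 ^^ 1) x = x} = cyc g a"
      using X_un te nofix by auto
    then show False using div3[of 1] g_cyc(2)[OF ag(1)] by simp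
  next
    case False
    \<comment> \<open>For \<open>e \<noteq> 0\<close> the square of \<open>s 7\<close> is
      \<open>g ^^ (e + e)\<close> on the orbit of \<open>a\<close>, without fixed points, and the
      identity on the other two orbits. The latter starts from \<open>x0\<close>, whose orbit
      returns after two steps.\<close>
    have "(s 7 ^^ 2) x0 = x0"
    proof (rule t_funpow_x0)
      have "rep g x0 \<in> ?Y" "rep g x0 \<noteq> a" using x0_g t_moves O_rep(2)[OF x0_g] abc(5) by auto
      then have "rep g x0 = b \<or> rep g x0 = c" using abc(1) by auto
      then have "?q (?q (rep g x0)) = rep g x0" using abc by auto
      then have "rep g (s 7 (s 7 x0)) = rep g x0"
        using O_rep(2)[OF x0_g] O_rep(2)[of "s 7 x0"] x0_g supp_g_step(2) by simp
      then show "(s 7 ^^ 2) x0 \<in> cyc g x0"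
        using G.rep_eq_iff[of x0 "s 7 (s 7 x0)"] by (simp add: numeral_2_eq_2)
    qed
    then have t2: "s 7 (s 7 x0) = x0" by (simp add: numeral_2_eq_2)
    have x0bc: "x0 \<in> cyc g b \<and> cyc g c = cyc g (s 7 x0) \<or> x0 \<in> cyc g c \<and> cyc g b = cyc g (s 7 x0)"
    proof -
      have "x0 \<notin> cyc g a"
      proof
        assume "x0 \<in> cyc g a"
        then have "s 7 x0 \<in> cyc g x0" by (simp only: te cyc_funpow)
        then show False using t_moves G.rep_eq_iff[of x0 "s 7 x0"] by simp
      qed
      then have "x0 \<in> cyc g b \<or> x0 \<in> cyc g c" using X_un x0_g X_g by auto
      then show ?thesis using t_swap[of x0] t_swap'[of x0] G.cyc_eq by auto
    qed
    have sq: "s 7 (s 7 y) = y" if "y \<in> cyc g b \<union> cyc g c" for y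
    proof -
      have "y \<in> cyc g x0 \<or> y \<in> cyc g (s 7 x0)" using that x0bc G.cyc_eq by auto
      then obtain k where "y = (g ^^ k) x0 \<or> y = (g ^^ k) (s 7 x0)" by (auto elim: cycE)
      then show ?thesis using t2 tk by auto
    qed
    have "s 7 (s 7 y) \<noteq> y" if y: "y \<in> cyc g a" for y
    proof
      assume "s 7 (s 7 y) = y"
      then have "(g ^^ (e + e)) y = y" by (simp only: te[OF y] tk funpow_funpow)
      moreover have "\<not> 5 dvd e + e" using e(1) False by presburger
      ultimately have "g y = y"
        using five_power_invariant[OF g_order, where f = "\<lambda>y. y" and x = y and i = "e + e"] by auto
      moreover have "y \<in> supp g" using G.cyc_subset_supp[OF ag(1)] y by blast
      ultimately show False by (simp add: supp_def)
    qed
    then have "{x. x \<in> X \<and> (s 7 ^^ 2) x = x} = cyc g b \<union> cyc g c"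
      using X_un sq by (auto simp: numeral_2_eq_2)
    moreover have "card (cyc g b \<union> cyc g c) = 10"
      using card_Un_disjoint[OF G.finite_cyc G.finite_cyc disj(3)] g_cyc(2) ag by simp
    ultimately show False using div3[of 2] by simp
  qed
qed

end

text \<open>The case \<open>k = 10\<close>: a generator moving 30 points has at most 15 nontrivial
  cycles, on which eight strands act.\<close>

lemma (in braid_action) at_most_15_points:
  assumes n: "n = 8" and card_X: "card X \<le> 15"
  shows "gens_equal n s \<or> (\<exists>a. standard_on n s X a)"
proof (rule equal_on_cycles)
  show "gens_equal (n - 2) (quot (s (n - 1)) s)"
  proof (rule ccontr)
    assume neq: "\<not> gens_equal (n - 2) (quot (s (n - 1)) s)"
    have n5: "n \<ge> 5" using n by simp
    obtain g v where g: "g permutes X" "g ^^ (5 ^ v) = id" "\<And>x. g (s 1 x) = s 2 (g x)"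
      "\<And>k x. 6 \<le> k \<Longrightarrow> k < n \<Longrightarrow> g (s k x) = s k (g x)"
      using five_power_commuting[OF n5] by blast
    interpret q: quot_action "n - 2" s X "s (n - 1)" using n by (intro quot_action_last) simp
    have "\<exists>x\<in>supp (s (n - 1)). rep (s (n - 1)) (g x) \<noteq> rep (s (n - 1)) x"
      using n g permutes_inj[OF g(1)] by (intro q.cycle_moved[OF _ _ _ _ neq]) (auto dest: injD)
    then obtain x where x: "x \<in> supp (s (n - 1))" "rep (s (n - 1)) (g x) \<noteq> rep (s (n - 1)) x" by blast
    interpret e: eight_strands s X g v x
      using braid_action_axioms n card_X neq g x
      by (intro eight_strands.intro eight_strands_axioms.intro) auto
    show False by (rule e.contradiction)
  qed
qed (use n card_X in auto)

text \<open>A fixed point \<open>e\<close> of \<open>s\<^sub>2\<close> gives \<open>s\<^sub>1 (s\<^sub>2 (s\<^sub>1 e)) = s\<^sub>2 (s\<^sub>1 e)\<close>, and likewise for \<open>s\<^sub>3\<close>; if \<open>s\<^sub>1\<close>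
  and \<open>s\<^sub>3\<close> have the same unique fixed point, they agree at \<open>e\<close>.\<close>

lemma (in braid_action) no_klein_orbit:
  assumes n: "n = 4" and card_X: "card X \<le> 5" and w: "w \<in> X"
    and dist: "distinct [w, s 3 w, s 1 w, s 1 (s 3 w)]"
    and q2: "s 3 (s 3 w) = w"
  shows False
proof -
  define p where "p = s 1"
  define q where "q = s 3"
  define r where "r = s 2"
  have dist: "distinct [w, q w, p w, p (q w)]" and q2: "q (q w) = w"
    using dist q2 by (simp_all add: p_def q_def)
  define F where "F = {w, q w, p w, p (q w)}"
  have pX: "p x \<in> X \<longleftrightarrow> x \<in> X" "q x \<in> X \<longleftrightarrow> x \<in> X" "r x \<in> X \<longleftrightarrow> x \<in> X" for x
    using in_X n by (simp_all add: p_def q_def r_def)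
  have inj': "p x = p y \<longleftrightarrow> x = y" "q x = q y \<longleftrightarrow> x = y" "r x = r y \<longleftrightarrow> x = y" for x y
    using inj n by (simp_all add: p_def q_def r_def)
  have pq: "q (p x) = p (q x)" for x using far[of 1 3 x] n by (simp add: p_def q_def)
  have FX: "F \<subseteq> X" using w pX by (simp add: F_def)
  have cF: "card F = 4" using dist by (simp add: F_def)
  have fF: "finite F" by (simp add: F_def)
  have "card (X - F) \<le> 1" using card_Diff_subset[OF fF FX] cF card_X by simp
  then have one: "x = y" if "x \<in> X - F" "y \<in> X - F" for x y
    using that finite_X by (simp add: card_le_Suc0_iff_eq)
  have qF: "q x \<in> F" if "x \<in> F" for x using that by (auto simp: F_def pq q2)
  have qq_F: "q (q x) = x" if "x \<in> F" for x using that by (auto simp: F_def pq q2)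
  have q_out: "q x = x" if "x \<in> X - F" for x
  proof (rule one)
    have "q x \<notin> F"
    proof
      assume h: "q x \<in> F"
      then have "q (q x) = x" using qq_F[OF h] inj'(2) by simp
      then show False using qF[OF h] that by simp
    qed
    then show "q x \<in> X - F" using that pX by simp
  qed (rule that)
  have q_fix: "q x = x \<longleftrightarrow> x \<in> X - F" if "x \<in> X" for x
    using q_out[of x] that dist by (auto simp: F_def pq q2)
  have qq: "q (q x) = x" if "x \<in> X" for x
    using qq_F[of x] q_out[of x] that by (cases "x \<in> F") auto
  \<comment> \<open>The number of fixed points of the square is the same for all generators, and the
    square of \<open>q\<close> fixes all of \<open>X\<close>.\<close>
  have inv2: "s i (s i x) = x" if i: "i = 1 \<or> i = 2" and x: "x \<in> X" for i x
  proof -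
    have "card {x. x \<in> X \<and> (s i ^^ 2) x = x} = card {x. x \<in> X \<and> (q ^^ 2) x = x}"
      using single_invariant[OF conj_inv_fix_card, of i 2] single_invariant[OF conj_inv_fix_card, of 3 2] i n
      by (auto simp: q_def)
    also have "{x. x \<in> X \<and> (q ^^ 2) x = x} = X" using qq by (auto simp: numeral_2_eq_2)
    finally have "{x. x \<in> X \<and> (s i ^^ 2) x = x} = X"
      using finite_X by (intro card_subset_eq) auto
    then show ?thesis using x by (auto simp: numeral_2_eq_2)
  qed
  have pp: "p (p x) = x" if "x \<in> X" for x using inv2[of 1 x] that by (simp add: p_def)
  have rr: "r (r x) = x" if "x \<in> X" for x using inv2[of 2 x] that by (simp add: r_def)
  have wX: "w \<in> X" "q w \<in> X" "p w \<in> X" "p (q w) \<in> X" using w pX by simp_all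
  have pF: "p x \<in> F" if "x \<in> F" for x using that pp wX by (auto simp: F_def)
  have p_out: "p x = x" if "x \<in> X - F" for x
  proof (rule one)
    show "p x \<in> X - F" using pF[of "p x"] pp[of x] that pX by auto
  qed (rule that)
  have p_fix: "p x = x \<longleftrightarrow> x \<in> X - F" if "x \<in> X" for x
    using p_out[of x] that dist pp wX by (auto simp: F_def)
  have pnq: "p x \<noteq> q x" if "x \<in> F" for x
    using that dist pp[OF wX(1)] pp[OF wX(2)] by (auto simp: F_def pq q2)
  have b1: "p (r (p x)) = r (p (r x))" for x using braid[of 1 x] n by (simp add: p_def r_def numeral_2_eq_2)
  have b2: "r (q (r x)) = q (r (q x))" for x using braid[of 2 x] n by (simp add: q_def r_def)
  have r_nofix: "r e \<noteq> e" if e: "e \<in> F" for e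
  proof
    assume re: "r e = e"
    have eX: "e \<in> X" using e FX by blast
    have "p (r (p e)) = r (p e)" using b1[of e] re by simp
    then have 1: "r (p e) \<in> X - F" using p_fix pX eX by simp
    have "q (r (q e)) = r (q e)" using b2[of e] re by simp
    then have 2: "r (q e) \<in> X - F" using q_fix pX eX by simp
    have "r (p e) = r (q e)" using one[OF 1 2] .
    then show False using inj'(3) pnq[OF e] by simp
  qed
  have r_out: "r x = x" if x: "x \<in> X - F" for x
  proof -
    have "{y. y \<in> X \<and> (q ^^ 1) y = y} = X - F" using q_fix by auto
    then have c: "card {y. y \<in> X \<and> (r ^^ 1) y = y} = card (X - F)"
      using single_invariant[OF conj_inv_fix_card, of 2 1] single_invariant[OF conj_inv_fix_card, of 3 1] n
      by (simp add: q_def r_def)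
    have sub: "{y. y \<in> X \<and> (r ^^ 1) y = y} \<subseteq> X - F" using r_nofix by auto
    have "{y. y \<in> X \<and> (r ^^ 1) y = y} = X - F"
      using finite_X by (intro card_subset_eq[OF _ sub c]) simp
    then show ?thesis using x by auto
  qed
  have rF: "r x \<in> F" if x: "x \<in> F" for x
  proof (rule ccontr)
    assume "r x \<notin> F"
    then have "r (r x) = r x" using r_out[of "r x"] x FX pX by blast
    then show False using inj'(3) r_nofix[OF x] by simp
  qed
  \<comment> \<open>On the four points of \<open>F\<close> the involution \<open>r\<close> has no
    fixed point, so it is determined by \<open>r w\<close>. It agrees there with \<open>q\<close>,
    with \<open>p\<close>, or with \<open>p \<circ> q\<close>: the first two make all generators
    equal, the last contradicts the braid relation with \<open>p\<close>.\<close>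
  have rw: "r w = q w \<or> r w = p w \<or> r w = p (q w)"
    using rF[of w] r_nofix[of w] by (auto simp: F_def)
  have eq_if: False if i: "i = 1 \<or> i = 3" and eqF: "\<And>x. x \<in> F \<Longrightarrow> s i x = r x" for i
  proof -
    have "s i x = r x" for x
    proof (cases "x \<in> X")
      case True
      then show ?thesis using eqF[of x] r_out[of x] p_out[of x] q_out[of x] i
        by (cases "x \<in> F") (auto simp: p_def q_def)
    next
      case False
      then show ?thesis using outside[of i x] outside[of 2 x] i n by (auto simp: r_def)
    qed
    then have "s i = r" by blast
    then have "gens_equal n s"
      using gens_equal_adjacent[of 1] gens_equal_adjacent[of 2] i n
      by (auto simp: r_def numeral_2_eq_2 numeral_3_eq_3)
    then have "p = q" unfolding p_def q_def by (rule gens_equalD) (use n in auto)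
    then show False using dist by simp
  qed
  have others: "r (q w) \<in> F" "r (p w) \<in> F" "r (p (q w)) \<in> F"
    using rF by (simp_all add: F_def)
  note nofix = r_nofix[of "q w"] r_nofix[of "p w"] r_nofix[of "p (q w)"]
  have FF: "q w \<in> F" "p w \<in> F" "p (q w) \<in> F" by (simp_all add: F_def)
  have d: "w \<noteq> q w" "w \<noteq> p w" "w \<noteq> p (q w)" "q w \<noteq> p w" "q w \<noteq> p (q w)" "p w \<noteq> p (q w)"
    using dist by auto
  have rinj: "r (q w) \<noteq> r w" "r (p w) \<noteq> r w" "r (p (q w)) \<noteq> r w" "r (q w) \<noteq> r (p w)"
    "r (q w) \<noteq> r (p (q w))" "r (p w) \<noteq> r (p (q w))"
    using inj'(3) d by auto
  show False
    using rw
  proof (elim disjE)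
    assume h: "r w = q w"
    then have h1: "r (q w) = w" using rr[OF w] by simp
    have h2: "r (p w) = p (q w)" using others(2) nofix(2)[OF FF(2)] h h1 rinj unfolding F_def by auto
    then have h3: "r (p (q w)) = p w" using rr[OF wX(3)] by simp
    show False by (rule eq_if[of 3]) (use h h1 h2 h3 in \<open>auto simp: F_def pq q2 simp flip: q_def\<close>)
  next
    assume h: "r w = p w"
    then have h1: "r (p w) = w" using rr[OF w] by simp
    have h2: "r (q w) = p (q w)" using others(1) nofix(1)[OF FF(1)] h h1 rinj unfolding F_def by auto
    then have h3: "r (p (q w)) = q w" using rr[OF wX(2)] by simp
    show False
      by (rule eq_if[of 1]) (use h h1 h2 h3 pp[OF w] pp[OF wX(2)] in \<open>auto simp: F_def simp flip: p_def[unfolded One_nat_def]\<close>)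
  next
    assume h: "r w = p (q w)"
    then have h1: "r (p (q w)) = w" using rr[OF w] by simp
    have h2: "r (p w) = q w" using others(2) nofix(2)[OF FF(2)] h h1 rinj unfolding F_def by auto
    then have h3: "r (q w) = p w" using rr[OF wX(3)] by simp
    have "p (q w) = p w" using b1[of w] h h2 h3 pp[OF wX(2)] by simp
    then show False using d by simp
  qed
qed

section \<open>Actions of nine strands\<close>

text \<open>The case \<open>k = 9\<close>. The point \<open>x0\<close> represents a cycle of
  \<open>s 8\<close>, and \<open>moved\<close> says that \<open>g\<close> does not preserve the
  orbit of this cycle under the permutation that \<open>s 6\<close> induces on cycles. This puts
  five disjoint copies of the orbit of \<open>x0\<close> under \<open>s 6\<close> and
  \<open>s 8\<close> into 27 points.\<close>

locale nine_strands = braid_action 9 s X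
  for s :: "nat \<Rightarrow> 'a \<Rightarrow> 'a" and X :: "'a set" +
  fixes g v x0
  assumes card_X: "card X \<le> 27"
    and gX: "g permutes X" and g_order: "g ^^ (5 ^ v) = id"
    and g_far: "\<And>k x. 6 \<le> k \<Longrightarrow> k < 9 \<Longrightarrow> g (s k x) = s k (g x)"
    and x0: "x0 \<in> supp (s 8)" "rep (s 8) x0 = x0" "quot (s 8) s 6 x0 \<noteq> x0"
    and moved: "rep (quot (s 8) s 6) (rep (s 8) (g x0)) \<noteq> rep (quot (s 8) s 6) x0"
begin

sublocale q: quot_action 7 s X "s 8"
  by (intro quot_action_far) auto

sublocale G: finite_perm g X
  by unfold_locales (simp_all add: gX finite_X)

sublocale P: finite_perm "s 6" X
  by unfold_locales (simp_all add: perm finite_X)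

sublocale o: quot_action 4 "\<lambda>i. s (i + 5)" X g
proof (intro quot_action.intro shift_action quot_action_axioms.intro G.finite_perm_axioms)
  show "s (i + 5) (g x) = g (s (i + 5) x)" if "1 \<le> i" "i < 4" for i x
    using that by (simp add: g_far)
qed simp

sublocale O: braid_action 4 "quot g (\<lambda>i. s (i + 5))" "rep g ` supp g"
  by (rule o.quot_action)

lemma g_comm: "g (s 6 x) = s 6 (g x)" "g (s 8 x) = s 8 (g x)"
  by (simp_all add: g_far)

lemma pt_comm: "s 6 (s 8 x) = s 8 (s 6 x)"
  using far[of 6 8 x] by simp

text \<open>The orbit of \<open>x\<close> under the commuting permutations \<open>s 6\<close> and
  \<open>s 8\<close>; natural exponents suffice because both have finite order.\<close>

definition F where "F x = range (\<lambda>(k, l). (s 6 ^^ k) ((s 8 ^^ l) x))"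

lemma F_I: "(s 6 ^^ k) ((s 8 ^^ l) x) \<in> F x"
  unfolding F_def by (rule range_eqI[of _ _ "(k, l)"]) simp

lemma F_E:
  assumes "y \<in> F x"
  obtains k l where "y = (s 6 ^^ k) ((s 8 ^^ l) x)"
  using assms unfolding F_def by auto

lemma F_self: "x \<in> F x"
  using F_I[of 0 0 x] by simp

lemma g_pt: "g ((s 6 ^^ k) ((s 8 ^^ l) x)) = (s 6 ^^ k) ((s 8 ^^ l) (g x))"
  by (simp only: funpow_commute[of g "s 6", OF g_comm(1)] funpow_commute[of g "s 8", OF g_comm(2)])

lemma F_g: "F (g x) = g ` F x"
  unfolding F_def by (simp add: image_image g_pt case_prod_beta)

lemma F_eq_of_funpow:
  assumes "w permutes X" "\<And>x. F (w x) \<subseteq> F x"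
  shows "F (w x) = F x"
proof -
  obtain N where N: "N > 0" "w ^^ N = id" using permutes_funpow_order[OF assms(1) finite_X] .
  have sub: "F ((w ^^ k) y) \<subseteq> F y" for k y
    by (induction k) (use assms(2) in auto)
  have "x = (w ^^ (N - 1)) (w x)"
    using N by (metis Suc_diff_1 comp_apply funpow_Suc_right id_apply)
  then have "F x \<subseteq> F (w x)" using sub[of "N - 1" "w x"] by simp
  then show ?thesis using assms(2) by blast
qed

lemma F_t: "F (s 8 x) = F x"
proof (rule F_eq_of_funpow[OF q.t])
  show "F (s 8 x) \<subseteq> F x" for x
  proof
    fix y assume "y \<in> F (s 8 x)"
    then obtain k l where "y = (s 6 ^^ k) ((s 8 ^^ l) (s 8 x))" by (rule F_E)
    then have "y = (s 6 ^^ k) ((s 8 ^^ Suc l) x)" by (simp add: funpow_swap1)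
    then show "y \<in> F x" by (simp only: F_I)
  qed
qed

lemma F_p: "F (s 6 x) = F x"
proof (rule F_eq_of_funpow[OF P.t])
  show "F (s 6 x) \<subseteq> F x" for x
  proof
    fix y assume "y \<in> F (s 6 x)"
    then obtain k l where "y = (s 6 ^^ k) ((s 8 ^^ l) (s 6 x))" by (rule F_E)
    then have "y = (s 6 ^^ k) (s 6 ((s 8 ^^ l) x))"
      by (simp only: funpow_commute[of "s 6" "s 8", OF pt_comm])
    then have "y = (s 6 ^^ Suc k) ((s 8 ^^ l) x)" by (simp add: funpow_swap1)
    then show "y \<in> F x" by (simp only: F_I)
  qed
qed

lemma F_mem:
  assumes "y \<in> F x"
  shows "F y = F x"
proof -
  have "F ((s 8 ^^ l) x) = F x" for l by (induction l) (simp_all add: F_t)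
  moreover have "F ((s 6 ^^ k) z) = F z" for k z by (induction k) (simp_all add: F_p)
  ultimately show ?thesis using assms by (metis F_E)
qed

lemma F_disjoint: "F x \<inter> F y \<noteq> {} \<Longrightarrow> F x = F y"
  using F_mem by (metis disjoint_iff)

lemma x0_X: "x0 \<in> X"
  using x0(1) q.supp_t_subset by blast

lemma F_X:
  assumes "x \<in> X"
  shows "F x \<subseteq> X"
proof
  fix y assume "y \<in> F x"
  then obtain k l where "y = (s 6 ^^ k) ((s 8 ^^ l) x)" by (rule F_E)
  then show "y \<in> X" using assms P.funpow_in_X q.funpow_in_X by simp
qed

lemma F_rep:
  assumes "y \<in> F x0"
  shows "y \<in> supp (s 8)" "rep (quot (s 8) s 6) (rep (s 8) y) = rep (quot (s 8) s 6) x0"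
proof -
  interpret Q: braid_action 7 "quot (s 8) s" "rep (s 8) ` supp (s 8)" by (rule q.quot_action)
  interpret U: finite_perm "quot (s 8) s 6" "rep (s 8) ` supp (s 8)"
    using Q.perm[of 6] Q.finite_X by unfold_locales auto
  obtain k l where y: "y = (s 6 ^^ k) ((s 8 ^^ l) x0)" using assms by (rule F_E)
  define z where "z = (s 8 ^^ l) x0"
  have z: "z \<in> supp (s 8)" "rep (s 8) z = x0"
    using x0 q.supp_funpow q.rep_funpow by (simp_all add: z_def)
  have "(s 6 ^^ k) z \<in> supp (s 8) \<and>
      rep (quot (s 8) s 6) (rep (s 8) ((s 6 ^^ k) z)) = rep (quot (s 8) s 6) x0"
  proof (induction k)
    case (Suc k)
    let ?y = "(s 6 ^^ k) z"
    have "s 6 ?y \<in> supp (s 8)" using Suc q.in_supp[of 6 ?y] by simp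
    moreover have "rep (s 8) (s 6 ?y) = quot (s 8) s 6 (rep (s 8) ?y)"
      using q.quot_rep[of 6 ?y] Suc by simp
    ultimately show ?case using Suc U.rep_step by simp
  qed (use z in simp)
  then show "y \<in> supp (s 8)" "rep (quot (s 8) s 6) (rep (s 8) y) = rep (quot (s 8) s 6) x0"
    by (simp_all add: y z_def)
qed

lemma F_compat: "\<forall>y y'. F y = F y' \<longrightarrow> F (g y) = F (g y')"
  by (simp add: F_g)

lemma F_moved:
  assumes "y \<in> F x0"
  shows "F (g y) \<noteq> F y"
proof
  assume "F (g y) = F y"
  then have "F (g x0) = F x0" using F_compat F_mem[OF assms] by metis
  then have "g x0 \<in> F x0" using F_self by metis
  then show False using F_rep(2) moved by blast
qed

lemma card_F:
  assumes "inj_on (\<lambda>i. F ((g ^^ i) x0)) {..<N}"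
  shows "N * card (F x0) \<le> 27"
proof -
  have img: "F ((g ^^ i) x0) = (g ^^ i) ` F x0" for i
    by (induction i) (simp_all add: F_g image_comp)
  have sub: "F ((g ^^ i) x0) \<subseteq> X" for i using F_X G.funpow_in_X x0_X by simp
  have "card (\<Union>i\<in>{..<N}. F ((g ^^ i) x0)) = card {..<N} * card (F x0)"
  proof (rule card_UN_const)
    show "finite (F ((g ^^ i) x0))" for i using finite_subset[OF sub finite_X] .
    show "card (F ((g ^^ i) x0)) = card (F x0)" for i
      unfolding img using permutes_inj_on[OF permutes_funpow[OF gX]] by (rule card_image)
    show "F ((g ^^ i) x0) \<inter> F ((g ^^ k) x0) = {}" if "i \<in> {..<N}" "k \<in> {..<N}" "i \<noteq> k" for i k
      using F_disjoint inj_onD[OF assms _ that(1,2)] that(3) by blast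
  qed simp
  moreover have "card (\<Union>i\<in>{..<N}. F ((g ^^ i) x0)) \<le> card X"
    using sub finite_X by (intro card_mono UN_least) auto
  ultimately show ?thesis using card_X by simp
qed

lemma F_X0: "F x0 \<subseteq> X" "finite (F x0)"
  using F_X[OF x0_X] finite_subset[OF F_X[OF x0_X] finite_X] by simp_all

lemma card_F_le: "card (F x0) \<le> 5"
  using card_F[OF five_power_inj[OF g_order F_compat F_moved[OF F_self]]] by simp

text \<open>\<open>F x0\<close> has at most five points but contains two different cycles of
  \<open>s 8\<close> of equal length, so this length is two.\<close>

lemma t_cycle: "cyc (s 8) x0 = {x0, s 8 x0}" "s 8 (s 8 x0) = x0" "rep (s 8) (s 6 x0) \<noteq> rep (s 8) x0"
proof -
  let ?C = "cyc (s 8)"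
  show neq: "rep (s 8) (s 6 x0) \<noteq> rep (s 8) x0" using q.quot_rep[of 6 x0] x0 by simp
  have sub: "?C y \<subseteq> F y" for y
    using F_I[of 0] unfolding cyc_def by auto
  have "?C x0 \<union> ?C (s 6 x0) \<subseteq> F x0"
    by (rule Un_least) (use sub[of x0] sub[of "s 6 x0"] in \<open>simp_all only: F_p\<close>)
  then have "card (?C x0 \<union> ?C (s 6 x0)) \<le> 5" by (rule order_trans[OF card_mono[OF F_X0(2)] card_F_le])
  moreover have "?C x0 \<inter> ?C (s 6 x0) = {}"
  proof (rule ccontr)
    assume "?C x0 \<inter> ?C (s 6 x0) \<noteq> {}"
    then have "?C x0 = ?C (s 6 x0)" by (rule q.cyc_disjoint)
    then have "s 6 x0 \<in> ?C x0" using cyc_self by metis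
    then show False using neq q.rep_eq_iff by metis
  qed
  then have "card (?C x0 \<union> ?C (s 6 x0)) = card (?C x0) + card (?C (s 6 x0))"
    by (rule card_Un_disjoint[OF q.finite_cyc q.finite_cyc])
  moreover have "card (?C (s 6 x0)) = card (?C x0)" by (rule q.card_cyc) auto
  ultimately have "card (?C x0) \<le> 2" by simp
  moreover have c2: "card {x0, s 8 x0} = 2" using x0(1) by (auto simp: supp_def)
  moreover have "{x0, s 8 x0} \<subseteq> ?C x0" using cyc_self cyc_step_self by auto
  ultimately show C: "?C x0 = {x0, s 8 x0}"
    using card_mono[OF q.finite_cyc, of "{x0, s 8 x0}" x0]
    by (intro card_subset_eq[OF q.finite_cyc, symmetric]) simp_all
  have "s 8 (s 8 x0) \<in> ?C x0" by (intro cyc_step cyc_step_self)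
  moreover have "s 8 (s 8 x0) \<noteq> s 8 x0" using q.t_inj x0(1) by (simp add: supp_def)
  ultimately show "s 8 (s 8 x0) = x0" using C by blast
qed

text \<open>If \<open>g ^^ 5\<close> moved \<open>F x0\<close>, there would be 25 disjoint copies of
  at least two points each. If it preserves \<open>F x0\<close> but moves \<open>x0\<close>, the
  orbit of \<open>x0\<close> under it fills \<open>F x0\<close>; then \<open>s 8 x0\<close> is
  \<open>(?h ^^ c) x0\<close> with \<open>c\<close> prime to 5, and \<open>s 8 (s 8 x0) = x0\<close>
  is impossible.\<close>

lemma g5_x0: "(g ^^ 5) x0 = x0"
proof (rule ccontr)
  let ?h = "g ^^ 5"
  assume neq: "?h x0 \<noteq> x0"
  have h: "?h ^^ (5 ^ v) = id" using g_order by (metis funpow_mult mult.commute id_funpow)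
  have F5: "F (?h x0) = F x0"
  proof (rule ccontr)
    assume "F (?h x0) \<noteq> F x0"
    then have "25 * card (F x0) \<le> 27"
      using card_F[OF five_power_inj25[OF g_order F_compat F_moved[OF F_self]]] by simp
    moreover have "{x0, s 8 x0} \<subseteq> F x0" using F_self[of x0] F_I[of 0 1 x0] by simp
    then have "card {x0, s 8 x0} \<le> card (F x0)" by (rule card_mono[OF F_X0(2)])
    ultimately show False using x0(1) by (simp add: supp_def split: if_splits)
  qed
  have hk: "F ((?h ^^ k) x0) = F x0" for k
  proof (induction k)
    case (Suc k)
    have "F (?h ((?h ^^ k) x0)) = F (?h x0)" using funpow_compat[OF F_compat Suc] .
    then show ?case using F5 by simp
  qed simp
  have "inj_on (\<lambda>i. (?h ^^ i) x0) {..<5}"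
    using five_power_inj[OF h, of "\<lambda>y. y" x0] neq by simp
  then have "card ((\<lambda>i. (?h ^^ i) x0) ` {..<5}) = 5" by (simp add: card_image)
  moreover have sub: "(\<lambda>i. (?h ^^ i) x0) ` {..<5} \<subseteq> F x0" using hk F_self by blast
  ultimately have "(\<lambda>i. (?h ^^ i) x0) ` {..<5} = F x0"
    using card_F_le card_mono[OF F_X0(2) sub] by (intro card_subset_eq[OF F_X0(2) sub]) simp
  moreover have "s 8 x0 \<in> F x0" using F_I[of 0 1 x0] by simp
  ultimately have "s 8 x0 \<in> (\<lambda>i. (?h ^^ i) x0) ` {..<5}" by simp
  then obtain c where c: "c < 5" "s 8 x0 = (?h ^^ c) x0" by auto
  have "c \<noteq> 0"
  proof
    assume "c = 0"
    then have "s 8 x0 = x0" using c(2) by simp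
    then show False using x0(1) by (simp add: supp_def)
  qed
  have th: "s 8 ((?h ^^ c) x0) = (?h ^^ c) (s 8 x0)"
    unfolding funpow_mult by (rule funpow_commute[of "s 8" g, OF g_comm(2)[symmetric]])
  have "s 8 (s 8 x0) = (?h ^^ (c + c)) x0"
    using th c(2) by (simp only: funpow_funpow)
  then have "(?h ^^ (c + c)) x0 = x0" using t_cycle(2) by simp
  moreover have "\<not> 5 dvd c + c" using c(1) \<open>c \<noteq> 0\<close> by presburger
  ultimately show False using five_power_invariant[OF h, of "c + c" "\<lambda>y. y" x0] neq by simp
qed

text \<open>A power of \<open>g\<close> leading from one point of \<open>F x0\<close> to another
  preserves \<open>F x0\<close>, so its exponent is divisible by 5; but \<open>g ^^ 5\<close> fixes
  \<open>F x0\<close> pointwise.\<close>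

lemma rep_g_inj:
  assumes "y \<in> F x0" "y' \<in> F x0" "rep g y = rep g y'"
  shows "y = y'"
proof -
  have "y' \<in> cyc g y" using assms(3) by (simp only: G.rep_eq_iff)
  then obtain i where i: "y' = (g ^^ i) y" by (rule cycE)
  have g5: "(g ^^ 5) y = y"
  proof -
    obtain k l where y: "y = (s 6 ^^ k) ((s 8 ^^ l) x0)" using assms(1) by (rule F_E)
    have "(g ^^ m) ((s 6 ^^ k) ((s 8 ^^ l) x)) = (s 6 ^^ k) ((s 8 ^^ l) ((g ^^ m) x))" for m x
      by (induction m) (simp_all add: g_pt)
    then show ?thesis using y g5_x0 by simp
  qed
  have "F ((g ^^ i) y) = F y" using i F_mem[OF assms(1)] F_mem[OF assms(2)] by simp
  then have "5 dvd i" using five_power_invariant[OF g_order _ F_compat, of i y] F_moved[OF assms(1)] by blast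
  then have "(g ^^ i) y = y" using funpow_mod_eq[OF g5, of i] by simp
  then show ?thesis using i by simp
qed

text \<open>\<open>g\<close> has at most 27/5, hence at most five, nontrivial orbits, on which
  \<open>s 6\<close>, \<open>s 7\<close>, \<open>s 8\<close> act as four strands. The orbits of
  \<open>x0\<close>, \<open>s 8 x0\<close>, \<open>s 6 x0\<close> and \<open>s 6 (s 8 x0)\<close>
  are different, which \<open>no_klein_orbit\<close> forbids.\<close>

lemma contradiction: False
proof -
  have x0_g: "x0 \<in> supp g" using F_moved[OF F_self] by (auto simp: supp_def)
  have in_g: "s k x \<in> supp g \<longleftrightarrow> x \<in> supp g" if "k = 6 \<or> k = 8" for k x
    using o.in_supp[of 1 x] o.in_supp[of 3 x] that by auto
  have O_rep: "quot g (\<lambda>i. s (i + 5)) 1 (rep g x) = rep g (s 6 x)"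
    "quot g (\<lambda>i. s (i + 5)) 3 (rep g x) = rep g (s 8 x)" if "x \<in> supp g" for x
    using o.quot_rep[of 1 x] o.quot_rep[of 3 x] that by simp_all
  have "5 * card (rep g ` supp g) \<le> card (supp g)"
  proof (rule G.card_supp_ge)
    show "5 \<le> card (cyc g x)" if "x \<in> supp g" for x
      using five_power_cyc_card(1)[OF G.finite_perm_axioms g_order] that by (simp add: supp_def)
  qed
  also have "\<dots> \<le> 27" using card_mono[OF finite_X G.supp_t_subset] card_X by simp
  finally have card_le: "card (rep g ` supp g) \<le> 5" by simp
  have mem: "x0 \<in> F x0" "s 8 x0 \<in> F x0" "s 6 x0 \<in> F x0" "s 6 (s 8 x0) \<in> F x0"
    using F_self[of x0] F_I[of 0 1 x0] F_I[of 1 0 x0] F_I[of 1 1 x0] by simp_all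
  have d1: "x0 \<noteq> s 8 x0" using x0(1) by (auto simp: supp_def)
  have "s 6 x0 \<notin> cyc (s 8) x0" using t_cycle(3) q.rep_eq_iff by metis
  then have d2: "s 6 x0 \<noteq> x0" "s 6 x0 \<noteq> s 8 x0" using t_cycle(1) by auto
  have d3: "s 6 (s 8 x0) \<noteq> x0" "s 6 (s 8 x0) \<noteq> s 8 x0"
    using d2 pt_comm[of x0] q.t_inj t_cycle(2) by metis+
  have d4: "s 6 (s 8 x0) \<noteq> s 6 x0" using d1 P.t_inj by simp
  have dist: "distinct [rep g x0, rep g (s 8 x0), rep g (s 6 x0), rep g (s 6 (s 8 x0))]"
    using rep_g_inj mem d1 d2 d3 d4 by auto
  show False
  proof (rule O.no_klein_orbit[OF HOL.refl card_le, of "rep g x0"])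
    show "rep g x0 \<in> rep g ` supp g" using x0_g by (rule imageI)
  qed (use dist O_rep x0_g in_g t_cycle(2) in simp_all)
qed

end

lemma (in braid_action) nine_strands_quot:
  assumes n: "n = 9" and card_X: "card X \<le> 27"
  shows "gens_equal 7 (quot (s 8) s) \<or>
    (\<exists>a. standard_on 7 (quot (s 8) s) (rep (s 8) ` supp (s 8)) a)"
proof -
  let ?t = "s 8" and ?S = "quot (s 8) s"
  let ?T = "rep ?t ` supp ?t" and ?u = "quot (s 8) s 6"
  interpret q: quot_action 7 s X ?t using n by (intro quot_action_far) auto
  interpret Q: braid_action 7 ?S ?T by (rule q.quot_action)
  interpret q2: quot_action 5 ?S ?T ?u by (intro Q.quot_action_far) auto
  \<comment> \<open>At most 13 cycles, fewer than twice the seven remaining strands, as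
    \<open>equal_on_cycles\<close> demands.\<close>
  have cT: "card ?T < 14"
    using q.card_reps card_mono[OF finite_X q.supp_t_subset] card_X by linarith
  have "gens_equal 5 (quot ?u ?S)"
  proof (rule ccontr)
    assume neq: "\<not> gens_equal 5 (quot ?u ?S)"
    have n5: "n \<ge> 5" using n by simp
    obtain g v where g: "g permutes X" "g ^^ (5 ^ v) = id" "\<And>x. g (s 1 x) = s 2 (g x)"
      "\<And>k x. 6 \<le> k \<Longrightarrow> k < n \<Longrightarrow> g (s k x) = s k (g x)"
      using five_power_commuting[OF n5] by blast
    have gt: "g (?t x) = ?t (g x)" for x using g(4)[of 8] n by simp
    have gi: "g x = g y \<longleftrightarrow> x = y" for x y using permutes_inj[OF g(1)] by (auto dest: injD)
    have g_supp: "g x \<in> supp ?t \<longleftrightarrow> x \<in> supp ?t" for x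
      using gi by (auto simp: supp_def simp flip: gt)
    \<comment> \<open>The permutation induced by \<open>g\<close> on the cycles of
      \<open>s 8\<close>. It plays the role of \<open>g\<close> in \<open>cycle_moved\<close> for
      the second passage to cycles, those of \<open>?u\<close>.\<close>
    define G where "G c = (if c \<in> ?T then rep ?t (g c) else c)" for c
    have G_rep: "G (rep ?t x) = rep ?t (g x)" if "x \<in> supp ?t" for x
      using that q.rep_commute_iff[OF gt gi, of "rep ?t x" x] q.rep_rep by (simp add: G_def)
    have G_T: "G c \<in> ?T \<longleftrightarrow> c \<in> ?T" for c
    proof (cases "c \<in> ?T")
      case True
      then obtain x where "x \<in> supp ?t" "c = rep ?t x" by blast
      then show ?thesis using G_rep g_supp by simp
    qed (simp add: G_def)
    have S_rep: "?S i (rep ?t x) = rep ?t (s i x)" if "1 \<le> i" "i < 7" "x \<in> supp ?t" for i x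
      using q.quot_rep that by simp
    have G_S: "G (?S i c) = ?S k (G c)"
      if i: "1 \<le> i" "i < 7" "1 \<le> k" "k < 7" "\<And>x. g (s i x) = s k (g x)" for i k c
    proof (cases "c \<in> ?T")
      case True
      then obtain x where "x \<in> supp ?t" "c = rep ?t x" by blast
      then show ?thesis using i G_rep S_rep g_supp q.in_supp[of i x] by simp
    next
      case False
      then show ?thesis by (simp add: G_def quot_def)
    qed
    have G_inj: "G c = G d \<longleftrightarrow> c = d" for c d
    proof (cases "c \<in> ?T \<and> d \<in> ?T")
      case True
      then obtain x y where "x \<in> supp ?t" "c = rep ?t x" "y \<in> supp ?t" "d = rep ?t y" by blast
      then show ?thesis using G_rep q.rep_commute_iff[OF gt gi] by simp
    next
      case False
      then show ?thesis using G_T[of c] G_T[of d] by (auto simp: G_def split: if_splits)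
    qed
    have "\<exists>c\<in>supp ?u. rep ?u (G c) \<noteq> rep ?u c"
      using g(3) g(4)[of 6] n by (intro q2.cycle_moved[OF _ _ G_inj _ neq] G_S) auto
    then obtain c where c: "c \<in> supp ?u" "rep ?u (G c) \<noteq> rep ?u c" by blast
    then have cT: "c \<in> ?T" using q2.supp_t_subset by blast
    interpret e: nine_strands s X g v c
    proof (intro nine_strands.intro nine_strands_axioms.intro)
      show "braid_action 9 s X" using braid_action_axioms n by simp
      show "c \<in> supp ?t" "rep ?t c = c" using cT q.rep_in_supp q.rep_rep by auto
      show "rep ?u (rep ?t (g c)) \<noteq> rep ?u c" using c(2) cT by (simp add: G_def)
    qed (use n card_X g c in \<open>auto simp: supp_def\<close>)
    show False by (rule e.contradiction)
  qed
  then show ?thesis using Q.equal_on_cycles cT by simp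
qed

lemma three_cycle:
  assumes Y: "card Y = 3" and f: "\<And>x. x \<in> Y \<Longrightarrow> f x \<in> Y" "\<And>x y. f x = f y \<longleftrightarrow> x = y"
    and nofix: "\<And>x. x \<in> Y \<Longrightarrow> f x \<noteq> x"
  shows "\<exists>d :: nat \<Rightarrow> 'a. Y = d ` {..<3} \<and> inj_on d {..<3} \<and> (\<forall>q<3. f (d q) = d ((q + 1) mod 3))"
proof -
  have fin: "finite Y" using Y by (simp add: card_ge_0_finite)
  obtain a where a: "a \<in> Y" using Y by force
  let ?b = "f a" and ?c = "f (f a)"
  have mem: "?b \<in> Y" "?c \<in> Y" using a f(1) by auto
  have ab: "?b \<noteq> a" and bc: "?c \<noteq> ?b" using nofix a mem by auto
  have ca: "?c \<noteq> a"
  proof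
    assume c: "?c = a"
    have "card (Y - {a, ?b}) = 1" using Y ab a mem by (subst card_Diff_subset) auto
    then obtain e where e: "Y - {a, ?b} = {e}" by (rule card_1_singletonE)
    then have eY: "e \<in> Y" "e \<noteq> a" "e \<noteq> ?b" by blast+
    have "f e \<noteq> ?b" "f e \<noteq> a" using f(2) eY c by metis+
    then have "f e \<in> Y - {a, ?b}" using f(1) eY by blast
    then show False using e nofix[OF eY(1)] by simp
  qed
  have "card {a, ?b, ?c} = 3" using ab bc ca by auto
  then have Yeq: "Y = {a, ?b, ?c}" using card_subset_eq[OF fin, of "{a, ?b, ?c}"] a mem Y by auto
  have cyc: "f ?c = a"
  proof -
    have "f ?c \<noteq> ?c" "f ?c \<noteq> ?b" using nofix[OF mem(2)] f(2) ca by auto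
    then show ?thesis using f(1)[OF mem(2)] Yeq by blast
  qed
  define d where "d q = (f ^^ q) a" for q
  have d: "d 0 = a" "d 1 = ?b" "d 2 = ?c" by (simp_all add: d_def numeral_2_eq_2)
  have lt3: "{..<3::nat} = {0, 1, 2}" by auto
  show ?thesis
  proof (intro exI[of _ d] conjI allI impI)
    show "Y = d ` {..<3}" unfolding lt3 using Yeq d by auto
    show "inj_on d {..<3}" unfolding lt3 inj_on_def using d ab bc ca by auto
    fix q :: nat assume "q < 3"
    show "f (d q) = d ((q + 1) mod 3)"
    proof -
      consider "q = 0" | "q = 1" | "q = 2" using \<open>q < 3\<close> by linarith
      then show ?thesis using d cyc by cases (simp_all add: numeral_2_eq_2)
    qed
  qed
qed

section \<open>Labelling the blocks\<close>

text \<open>Going up keeps the label and going down adds 1, so \<open>s i\<close> runs through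
  \<open>e i 0\<close>, \<open>e (Suc i) 0\<close>, \<open>e i 1\<close>,
  \<open>e (Suc i) 1\<close>, \<open>e i 2\<close>, \<open>e (Suc i) 2\<close>: the 6-cycle of the
  first model.\<close>

definition psi_labels :: "nat \<Rightarrow> (nat \<Rightarrow> 'a \<Rightarrow> 'a) \<Rightarrow> (nat \<Rightarrow> nat \<Rightarrow> 'a) \<Rightarrow> bool" where
  "psi_labels n s e \<longleftrightarrow> (\<forall>i q. 1 \<le> i \<longrightarrow> i < n \<longrightarrow> q < 3 \<longrightarrow>
    s i (e i q) = e (Suc i) q \<and> s i (e (Suc i) q) = e i ((q + 1) mod 3) \<and>
    (\<forall>b. 1 \<le> b \<longrightarrow> b \<le> n \<longrightarrow> b \<noteq> i \<longrightarrow> b \<noteq> Suc i \<longrightarrow> s i (e b q) = e b q))"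

text \<open>The shift by 1 that occurs everywhere is that of \<open>z\<close>; the square of
  \<open>y i\<close> contributes the further shift \<open>\<tau>\<close> on the way down.\<close>

definition phi_labels ::
  "nat \<Rightarrow> (nat \<Rightarrow> 'a \<Rightarrow> 'a) \<Rightarrow> (nat \<Rightarrow> nat \<Rightarrow> 'a) \<Rightarrow> nat \<Rightarrow> bool" where
  "phi_labels n s e \<tau> \<longleftrightarrow> (\<forall>i q. 1 \<le> i \<longrightarrow> i < n \<longrightarrow> q < 3 \<longrightarrow>
    s i (e i q) = e (Suc i) ((q + 1) mod 3) \<and> s i (e (Suc i) q) = e i ((q + \<tau> + 1) mod 3) \<and>
    (\<forall>b. 1 \<le> b \<longrightarrow> b \<le> n \<longrightarrow> b \<noteq> i \<longrightarrow> b \<noteq> Suc i \<longrightarrow> s i (e b q) = e b ((q + 1) mod 3)))"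

text \<open>A common frame for both kinds of good homomorphisms: \<open>z\<close> is the identity if
  far supports are disjoint, and the central factor otherwise. Transitivity enters as
  \<open>invariant\<close>.\<close>

locale factored_action = braid_action n s X + y: braid_action n y X
  for n :: nat and s :: "nat \<Rightarrow> 'a \<Rightarrow> 'a" and X :: "'a set" and y +
  fixes z :: "'a \<Rightarrow> 'a" and D
  assumes n: "n \<ge> 4" and card_X: "card X = 3 * n"
    and invariant: "\<And>Z. Z \<subseteq> X \<Longrightarrow> Z \<noteq> {} \<Longrightarrow>
      (\<And>i x. 1 \<le> i \<Longrightarrow> i < n \<Longrightarrow> x \<in> Z \<Longrightarrow> s i x \<in> Z) \<Longrightarrow> Z = X"
    and z: "z permutes X"
    and sz: "\<And>i x. 1 \<le> i \<Longrightarrow> i < n \<Longrightarrow> s i x = z (y i x)"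
    and yz: "\<And>i x. 1 \<le> i \<Longrightarrow> i < n \<Longrightarrow> y i (z x) = z (y i x)"
    and blocks: "block_system n y X D"
    and D1: "card (D 1) \<ge> 1"
begin

lemma z_inj: "z u = z w \<longleftrightarrow> u = w"
  using permutes_inj[OF z] by (auto dest: injD)

lemmas D = block_systemD[OF blocks]

lemma D_nonempty: "D 1 \<noteq> {}"
  using D1 by auto

lemma z_supp: "1 \<le> i \<Longrightarrow> i < n \<Longrightarrow> z x \<in> supp (y i) \<longleftrightarrow> x \<in> supp (y i)"
  using yz[of i x] z_inj by (simp add: supp_def)

lemma y_fixes:
  assumes "1 \<le> i" "i < n" "1 \<le> b" "b \<le> n" "b \<noteq> i" "b \<noteq> Suc i" "x \<in> D b"
  shows "y i x = x"
proof -
  have "D b \<inter> D i = {}" using D(3)[of b i] D(3)[of i b] assms by (cases "b < i") auto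
  moreover have "D b \<inter> D (Suc i) = {}"
    using D(3)[of b "Suc i"] D(3)[of "Suc i" b] assms by (cases "b < Suc i") auto
  ultimately have "x \<notin> supp (y i)" using D(4)[OF assms(1,2)] assms(7) by blast
  then show ?thesis by (simp add: supp_def)
qed

text \<open>\<open>z\<close> commutes with the \<open>y i\<close> and so preserves their supports,
  and \<open>D 1\<close> is the part of the support of \<open>y 1\<close> outside that of
  \<open>y 2\<close>.\<close>

lemma z_D1: "x \<in> D 1 \<Longrightarrow> z x \<in> D 1"
proof -
  assume x: "x \<in> D 1"
  have S: "supp (y 1) = D 1 \<union> D 2" "supp (y 2) = D 2 \<union> D 3" "D 1 \<inter> D 2 = {}" "D 1 \<inter> D 3 = {}"
    using D(4)[of 1] D(4)[of 2] D(3)[of 1 2] D(3)[of 1 3] n by (simp_all add: numeral_2_eq_2 numeral_3_eq_3)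
  have "z x \<in> supp (y 1)" "z x \<notin> supp (y 2)"
    using z_supp[of 1 x] z_supp[of 2 x] S x n by auto
  then show ?thesis using S by blast
qed

text \<open>The union of the blocks is the union of the supports of the \<open>y i\<close>, which is
  invariant under all \<open>y i\<close> and under \<open>z\<close>.\<close>

lemma UN_D: "(\<Union>b\<in>{1..n}. D b) = X"
proof (rule invariant)
  let ?B = "\<Union>b\<in>{1..n}. D b"
  show "?B \<subseteq> X" using D(2) by (intro UN_least) simp
  show "?B \<noteq> {}" using D_nonempty n by fastforce
  have mem: "x \<in> ?B \<longleftrightarrow> (\<exists>i. 1 \<le> i \<and> i < n \<and> x \<in> supp (y i))" for x
  proof
    assume "x \<in> ?B"
    then obtain b where b: "1 \<le> b" "b \<le> n" "x \<in> D b" by auto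
    show "\<exists>i. 1 \<le> i \<and> i < n \<and> x \<in> supp (y i)"
    proof (cases "b < n")
      case True
      then show ?thesis using b D(4)[of b] by blast
    next
      case False
      then have "Suc (n - 1) = b" using b n by simp
      then show ?thesis using b D(4)[of "n - 1"] n by (intro exI[of _ "n - 1"]) auto
    qed
  next
    assume "\<exists>i. 1 \<le> i \<and> i < n \<and> x \<in> supp (y i)"
    then obtain i where i: "1 \<le> i" "i < n" "x \<in> D i \<or> x \<in> D (Suc i)" using D(4) by blast
    then show "x \<in> ?B" using n by (elim disjE) (auto intro!: UN_I)
  qed
  fix i x assume i: "1 \<le> i" "i < n" and x: "x \<in> ?B"
  have "y i x \<in> ?B"
  proof (cases "x \<in> supp (y i)")
    case True
    then have "\<exists>k. 1 \<le> k \<and> k < n \<and> y i x \<in> supp (y k)" using y.supp_step[OF i] i by blast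
    then show ?thesis using mem[of "y i x"] by simp
  next
    case False
    then show ?thesis using x by (simp add: supp_def)
  qed
  then obtain k where "1 \<le> k" "k < n" "y i x \<in> supp (y k)" using mem[of "y i x"] by blast
  then have "\<exists>k. 1 \<le> k \<and> k < n \<and> z (y i x) \<in> supp (y k)" using z_supp by blast
  then show "s i x \<in> ?B" using sz[OF i] mem[of "s i x"] by simp
qed

lemma card_D1: "card (D 1) = 3"
  using y.card_blocks(1)[OF blocks] UN_D card_X n by simp

text \<open>The product of \<open>y i\<close> down to \<open>y 1\<close>. The index is off by one:
  \<open>L i\<close> carries \<open>D 1\<close> to \<open>D (Suc i)\<close>.\<close>

definition L where "L = rec_nat (\<lambda>x. x) (\<lambda>i f x. y (Suc i) (f x))"

lemma L_0: "L 0 x = x"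
  by (simp add: L_def)

lemma L_Suc: "L (Suc i) x = y (Suc i) (L i x)"
  by (simp add: L_def)

lemma L_image: "i < n \<Longrightarrow> L i ` D 1 = D (Suc i)"
proof (induction i)
  case 0
  then show ?case by (simp add: L_0)
next
  case (Suc i)
  have "L (Suc i) ` D 1 = y (Suc i) ` (L i ` D 1)" by (simp add: L_Suc image_comp comp_def)
  then show ?case using Suc D(5)[of "Suc i"] by simp
qed

lemma L_D: "i < n \<Longrightarrow> x \<in> D 1 \<Longrightarrow> L i x \<in> D (Suc i)"
  using L_image by blast

lemma L_inj: "i < n \<Longrightarrow> L i x = L i x' \<longleftrightarrow> x = x'"
  by (induction i) (simp_all add: L_0 L_Suc y.inj)

lemma L_z: "i < n \<Longrightarrow> z (L i x) = L i (z x)"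
  by (induction i) (simp_all add: L_0 L_Suc yz[symmetric])

text \<open>If \<open>L i\<close> is used to identify the block of index \<open>i + 1\<close> with the first one, every \<open>y\<^sub>i\<^sup>2\<close>
  becomes the same permutation \<open>sq\<close> of the first block.\<close>

definition sq where "sq x = y 1 (y 1 x)"

lemma sq_D1: "x \<in> D 1 \<Longrightarrow> sq x \<in> D 1"
proof -
  assume "x \<in> D 1"
  then have "y 1 x \<in> D (Suc 1)" using D(5)[of 1] n by auto
  then show "sq x \<in> D 1" unfolding sq_def using D(6)[of 1] n by auto
qed

lemma sq_inj: "sq x = sq x' \<longleftrightarrow> x = x'"
  unfolding sq_def using y.inj[of 1] n by simp

text \<open>At a point of \<open>D (Suc (Suc i))\<close>, the block moved by both
  \<open>y (Suc i)\<close> and \<open>y (Suc (Suc i))\<close>, one factor on each side of the braid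
  relation acts trivially. What remains says that their squares agree there.\<close>

lemma L_sq: "Suc i < n \<Longrightarrow> x \<in> D 1 \<Longrightarrow> y (Suc i) (L (Suc i) x) = L i (sq x)"
proof (induction i)
  case 0
  then show ?case by (simp add: L_0 L_Suc sq_def)
next
  case (Suc i)
  let ?u = "L (Suc i) x"
  have u: "?u \<in> D (Suc (Suc i))" using L_D Suc.prems by simp
  have "y (Suc i) ?u \<in> D (Suc i)" using D(6)[of "Suc i"] u Suc.prems by auto
  then have 1: "y (Suc (Suc i)) (y (Suc i) ?u) = y (Suc i) ?u"
    using Suc.prems by (intro y_fixes[of _ "Suc i"]) auto
  have "y (Suc (Suc i)) ?u \<in> D (Suc (Suc (Suc i)))" using D(5)[of "Suc (Suc i)"] u Suc.prems by auto
  then have 2: "y (Suc i) (y (Suc (Suc i)) ?u) = y (Suc (Suc i)) ?u"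
    using Suc.prems by (intro y_fixes[of _ "Suc (Suc (Suc i))"]) auto
  have "y (Suc (Suc i)) (L (Suc (Suc i)) x) = y (Suc i) (y (Suc i) ?u)"
    using y.braid[of "Suc i" ?u] Suc.prems 1 2 by (simp add: L_Suc[of "Suc i"])
  also have "\<dots> = L (Suc i) (sq x)" using Suc by (simp add: L_Suc)
  finally show ?case .
qed

lemma L_other:
  "1 \<le> i \<Longrightarrow> i < n \<Longrightarrow> b < n \<Longrightarrow> Suc b \<noteq> i \<Longrightarrow> b \<noteq> i \<Longrightarrow> x \<in> D 1 \<Longrightarrow> y i (L b x) = L b x"
  using L_D[of b x] by (intro y_fixes[of i "Suc b"]) auto

lemma labels_bij:
  assumes "D 1 = d ` {..<3}" "inj_on d {..<3::nat}"
  shows "bij_betw (\<lambda>(b, q). L (b - 1) (d q)) ({1..n} \<times> {..<3}) X"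
  unfolding bij_betw_def
proof
  show "inj_on (\<lambda>(b, q). L (b - 1) (d q)) ({1..n} \<times> {..<3})"
  proof (rule inj_onI)
    fix u u' :: "nat \<times> nat"
    assume uu: "u \<in> {1..n} \<times> {..<3}" "u' \<in> {1..n} \<times> {..<3}"
      "(case u of (b, q) \<Rightarrow> L (b - 1) (d q)) = (case u' of (b, q) \<Rightarrow> L (b - 1) (d q))"
    obtain b q b' q' where u: "u = (b, q)" "u' = (b', q')" by (cases u; cases u')
    have h: "b \<in> {1..n}" "b' \<in> {1..n}" "q \<in> {..<3}" "q' \<in> {..<3}"
      and e: "L (b - 1) (d q) = L (b' - 1) (d q')" using uu by (simp_all add: u)
    have dq: "d q \<in> D 1" "d q' \<in> D 1" using h assms(1) by auto
    have m: "L (b - 1) (d q) \<in> D b" "L (b' - 1) (d q') \<in> D b'"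
      using L_D[OF _ dq(1), of "b - 1"] L_D[OF _ dq(2), of "b' - 1"] h n by auto
    have "b = b'"
    proof (rule ccontr)
      assume "b \<noteq> b'"
      then have "D b \<inter> D b' = {}" using D(3)[of b b'] D(3)[of b' b] h by (cases "b < b'") auto
      then show False using m e by auto
    qed
    moreover from this have "d q = d q'" using e L_inj[of "b - 1"] h n by auto
    then have "q = q'" using inj_onD[OF assms(2)] h by blast
    ultimately show "u = u'" by (simp add: u)
  qed
  have img: "L (b - 1) ` d ` {..<3} = D b" if "b \<in> {1..n}" for b
  proof -
    have "L (b - 1) ` D 1 = D (Suc (b - 1))" using that n by (intro L_image) auto
    then show ?thesis using that assms(1) by simp
  qed
  have "(\<lambda>(b, q). L (b - 1) (d q)) ` ({1..n} \<times> {..<3}) = (\<Union>b\<in>{1..n}. L (b - 1) ` d ` {..<3})"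
    by auto
  also have "\<dots> = (\<Union>b\<in>{1..n}. D b)" using img by (simp cong: image_cong_simp)
  finally show "(\<lambda>(b, q). L (b - 1) (d q)) ` ({1..n} \<times> {..<3}) = X" using UN_D by simp
qed

lemma label_cases:
  assumes zc: "z = id \<or> (\<forall>x\<in>D 1. z x \<noteq> x)"
  obtains e where "bij_betw (\<lambda>(b, q). e b q) ({1..n} \<times> {..<3}) X"
    "psi_labels n s e \<or> (\<exists>\<tau>. phi_labels n s e \<tau>)"
proof -
  have y_up: "y i (L (i - 1) x) = L i x" if "1 \<le> i" for i x
    using L_Suc[of "i - 1" x] that by simp
  have y_down: "y i (L i x) = L (i - 1) (sq x)" if "1 \<le> i" "i < n" "x \<in> D 1" for i x
    using L_sq[of "i - 1" x] that by simp
  show thesis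
    using zc
  proof
    assume z_id: "z = id"
    \<comment> \<open>A fixed point of \<open>sq\<close> would give an invariant set with a single
      point in each block.\<close>
    have nofix: "sq x \<noteq> x" if x: "x \<in> D 1" for x
    proof
      assume fix_x: "sq x = x"
      have "(\<lambda>b. L b x) ` {..<n} = X"
      proof (rule invariant)
        have "L b x \<in> X" if "b < n" for b using L_D[OF that x] D(2)[of "Suc b"] that by auto
        then show "(\<lambda>b. L b x) ` {..<n} \<subseteq> X" by auto
        show "(\<lambda>b. L b x) ` {..<n} \<noteq> {}" using n by (simp add: lessThan_empty_iff)
        fix i u assume i: "1 \<le> i" "i < n" and "u \<in> (\<lambda>b. L b x) ` {..<n}"
        then obtain b where b: "b < n" "u = L b x" by auto
        have "y i u \<in> (\<lambda>b. L b x) ` {..<n}"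
        proof -
          consider "b = i" | "Suc b = i" | "b \<noteq> i" "Suc b \<noteq> i" by blast
          then show ?thesis
          proof cases
            case 1
            then have "y i u = L (i - 1) x" using y_down[OF i x] b fix_x by simp
            then show ?thesis using i by auto
          next
            case 2
            then have "y i u = L i x" using y_up[OF i(1), of x] b by auto
            then show ?thesis using i by auto
          next
            case 3
            then have "y i u = u" using L_other[OF i b(1) _ _ x] b by simp
            then show ?thesis using b by auto
          qed
        qed
        then show "s i u \<in> (\<lambda>b. L b x) ` {..<n}" using sz[OF i] z_id by simp
      qed
      then have "card X \<le> n" using card_image_le[of "{..<n}" "\<lambda>b. L b x"] by simp
      then show False using card_X n by simp
    qed
    have "\<exists>d :: nat \<Rightarrow> 'a. D 1 = d ` {..<3} \<and> inj_on d {..<3} \<and>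
        (\<forall>q<3. sq (d q) = d ((q + 1) mod 3))"
      by (rule three_cycle, rule card_D1, erule sq_D1, rule sq_inj, erule nofix)
    then obtain d :: "nat \<Rightarrow> 'a" where d0: "D 1 = d ` {..<3} \<and> inj_on d {..<3} \<and>
        (\<forall>q<3. sq (d q) = d ((q + 1) mod 3))" ..
    then have d: "D 1 = d ` {..<3}" "inj_on d {..<3}" "\<And>q. q < 3 \<Longrightarrow> sq (d q) = d ((q + 1) mod 3)"
      by simp_all
    have dD: "d q \<in> D 1" if "q < 3" for q using d(1) that by auto
    show thesis
    proof (rule that[OF labels_bij[OF d(1,2)]], rule disjI1, unfold psi_labels_def, intro allI impI conjI)
      fix i q assume i: "1 \<le> i" "i < n" and q: "q < (3::nat)"
      have s: "s i u = y i u" for u using sz[OF i] z_id by simp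
      show "s i (L (i - 1) (d q)) = L (Suc i - 1) (d q)" using s y_up[OF i(1)] by simp
      show "s i (L (Suc i - 1) (d q)) = L (i - 1) (d ((q + 1) mod 3))"
        using s y_down[OF i dD[OF q]] d(3)[OF q] by simp
      fix b assume "1 \<le> b" "b \<le> n" "b \<noteq> i" "b \<noteq> Suc i"
      then show "s i (L (b - 1) (d q)) = L (b - 1) (d q)"
        using s L_other[OF i _ _ _ dD[OF q], of "b - 1"] by (cases b) auto
    qed
  next
    assume "\<forall>x\<in>D 1. z x \<noteq> x"
    then have nofix: "z x \<noteq> x" if "x \<in> D 1" for x using that by (rule bspec)
    have "\<exists>d :: nat \<Rightarrow> 'a. D 1 = d ` {..<3} \<and> inj_on d {..<3} \<and>
        (\<forall>q<3. z (d q) = d ((q + 1) mod 3))"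
      by (rule three_cycle, rule card_D1, erule z_D1, rule z_inj, erule nofix)
    then obtain d :: "nat \<Rightarrow> 'a" where d0: "D 1 = d ` {..<3} \<and> inj_on d {..<3} \<and>
        (\<forall>q<3. z (d q) = d ((q + 1) mod 3))" ..
    then have d: "D 1 = d ` {..<3}" "inj_on d {..<3}" "\<And>q. q < 3 \<Longrightarrow> z (d q) = d ((q + 1) mod 3)"
      by simp_all
    have dD: "d q \<in> D 1" if "q < 3" for q using d(1) that by auto
    obtain \<tau> where \<tau>: "\<tau> < 3" "sq (d 0) = d \<tau>" using sq_D1[OF dD[of 0]] d(1) by auto
    \<comment> \<open>On \<open>D 1\<close> the map \<open>z\<close> is a 3-cycle, so a map
      commuting with it is determined by one value and is a power of it.\<close>
    have sqz: "sq (z x) = z (sq x)" for x unfolding sq_def using yz[of 1] n by simp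
    have sq_d: "sq (d q) = d ((q + \<tau>) mod 3)" if "q < 3" for q
      using that
    proof (induction q)
      case 0
      then show ?case using \<tau> by simp
    next
      case (Suc q)
      have "d (Suc q) = z (d q)" using d(3)[of q] Suc.prems by simp
      then have "sq (d (Suc q)) = z (d ((q + \<tau>) mod 3))" using sqz Suc by simp
      also have "\<dots> = d (((q + \<tau>) mod 3 + 1) mod 3)" by (rule d(3)) simp
      also have "((q + \<tau>) mod 3 + 1) mod 3 = (Suc q + \<tau>) mod 3" by (simp add: mod_Suc_eq)
      finally show ?case .
    qed
    show thesis
    proof (rule that[OF labels_bij[OF d(1,2)]], rule disjI2, rule exI[of _ \<tau>], unfold phi_labels_def,
        intro allI impI conjI)
      fix i q assume i: "1 \<le> i" "i < n" and q: "q < (3::nat)"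
      have zL: "z (L b (d r)) = L b (d ((r + 1) mod 3))" if "b < n" "r < 3" for b r
        using L_z[OF that(1)] d(3)[OF that(2)] by simp
      show "s i (L (i - 1) (d q)) = L (Suc i - 1) (d ((q + 1) mod 3))"
        using sz[OF i] y_up[OF i(1)] zL[OF i(2) q] by simp
      have "s i (L (Suc i - 1) (d q)) = z (L (i - 1) (d ((q + \<tau>) mod 3)))"
        using sz[OF i] y_down[OF i dD[OF q]] sq_d[OF q] by simp
      also have "\<dots> = L (i - 1) (d (((q + \<tau>) mod 3 + 1) mod 3))" using i by (intro zL) auto
      also have "((q + \<tau>) mod 3 + 1) mod 3 = (q + \<tau> + 1) mod 3" by (simp add: mod_Suc_eq)
      finally show "s i (L (Suc i - 1) (d q)) = L (i - 1) (d ((q + \<tau> + 1) mod 3))" .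
      fix b assume b: "1 \<le> b" "b \<le> n" "b \<noteq> i" "b \<noteq> Suc i"
      then have "y i (L (b - 1) (d q)) = L (b - 1) (d q)"
        using L_other[OF i _ _ _ dD[OF q], of "b - 1"] by (cases b) auto
      then show "s i (L (b - 1) (d q)) = L (b - 1) (d ((q + 1) mod 3))"
        using sz[OF i] zL[of "b - 1" q] b q by simp
    qed
  qed
qed

end

lemma (in braid_action) full_support_factor:
  assumes n: "n \<ge> 9" and card_X: "card X = 3 * n" and full: "\<And>i. 1 \<le> i \<Longrightarrow> i < n \<Longrightarrow> supp (s i) = X"
    and neq: "\<not> gens_equal n s"
  shows "\<exists>z y D. z permutes X \<and>
     (\<forall>i x. 1 \<le> i \<longrightarrow> i < n \<longrightarrow> s i x = z (y i x) \<and> y i (z x) = z (y i x)) \<and>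
     braid_action n y X \<and> block_system n y X D \<and> 2 \<le> card (D 1)"
proof -
  let ?t = "s (n - 1)"
  let ?T = "rep ?t ` supp ?t"
  interpret q: quot_action "n - 2" s X ?t using n by (intro quot_action_last) simp
  interpret Q: braid_action "n - 2" "quot ?t s" ?T by (rule q.quot_action)
  have t_full: "supp ?t = X" using full n by simp
  have cT: "2 * card ?T \<le> 3 * n"
    using q.card_reps card_mono[OF finite_X q.supp_t_subset] card_X by simp
  have "gens_equal (n - 2) (quot ?t s) \<or> (\<exists>a. standard_on (n - 2) (quot ?t s) ?T a)"
  proof -
    consider "n = 9" | "n = 10" | "n \<ge> 11" using n by linarith
    then show ?thesis
    proof cases
      case 1
      then show ?thesis using nine_strands_quot card_X by simp
    next
      case 2
      then show ?thesis using Q.at_most_15_points cT by simp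
    next
      case 3
      then show ?thesis using cT by (intro Q.fewer_than_2n_points) auto
    qed
  qed
  then show ?thesis
  proof
    \<comment> \<open>Equal actions on the cycles are impossible here: every point of
      \<open>X\<close> lies on a nontrivial cycle of \<open>?t\<close>, so the generators themselves
      would be equal.\<close>
    assume eq: "gens_equal (n - 2) (quot ?t s)"
    have "s 1 x = s (Suc 1) x" for x
    proof (cases "x \<in> X")
      case True
      then show ?thesis using q.quot_equal_imp_agree[OF eq, of 1 "Suc 1" x] t_full n by simp
    next
      case False
      then show ?thesis using outside[of 1 x] outside[of "Suc 1" x] n by simp
    qed
    then have "s 1 = s (Suc 1)" by blast
    then show ?thesis using gens_equal_adjacent[of 1] neq n by simp
  next
    assume "\<exists>a. standard_on (n - 2) (quot ?t s) ?T a"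
    then obtain a where a: "standard_on (n - 2) (quot ?t s) ?T a" ..
    interpret sq: standard_quotient n s X a ?t "\<lambda>b. cyc ?t (a b)" "\<Union>b\<in>{1..n - 2}. cyc ?t (a b)"
      by unfold_locales (use n a in auto)
    interpret sc: standard_cycles n s X a ?t "\<lambda>b. cyc ?t (a b)" "\<Union>b\<in>{1..n - 2}. cyc ?t (a b)"
      by unfold_locales (rule sq.agree_off_W_full[OF t_full])
    show ?thesis by (rule sc.central_factor)
  qed
qed

section \<open>The model homomorphisms\<close>

text \<open>Block indices are written as successors below, which removes the truncated
  \<open>i - 1\<close>.\<close>

lemma block_elem_Suc: "block_elem 3 (Suc c) q = 1 + 3 * c + q"
  by (simp add: block_elem_def)

lemma block_elem_exhaust:
  assumes "x \<in> {1..3 * k}"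
  obtains b q where "1 \<le> b" "b \<le> k" "q < 3" "x = block_elem 3 b q"
proof (rule that[of "Suc ((x - 1) div 3)" "(x - 1) mod 3"])
  show "x = block_elem 3 (Suc ((x - 1) div 3)) ((x - 1) mod 3)"
    using assms mult_div_mod_eq[of 3 "x - 1"] by (simp add: block_elem_Suc)
  have "x - 1 < k * 3" using assms by auto
  then show "Suc ((x - 1) div 3) \<le> k" by (simp only: Suc_le_eq less_mult_imp_div_less)
qed simp_all

lemma block_elem_coords:
  assumes "1 \<le> b" "q < 3"
  shows "(block_elem 3 b q - 1) div 3 = b - 1" "(block_elem 3 b q - 1) mod 3 = q"
  using assms by (simp_all add: block_elem_def)

lemma block_elem_range: "1 \<le> b \<Longrightarrow> b \<le> k \<Longrightarrow> q < 3 \<Longrightarrow> block_elem 3 b q \<in> {1..3 * k}"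
  by (cases b) (auto simp: block_elem_Suc)

lemma psi_gen_3:
  assumes i: "1 \<le> i"
  shows "q < 3 \<Longrightarrow> psi_gen 3 i (block_elem 3 i q) = block_elem 3 (Suc i) q"
    and "q < 3 \<Longrightarrow> psi_gen 3 i (block_elem 3 (Suc i) q) = block_elem 3 i ((q + 1) mod 3)"
    and "x \<notin> {3 * (i - 1) + 1..3 * (i + 1)} \<Longrightarrow> psi_gen 3 i x = x"
proof -
  obtain c where c: "i = Suc c" using i by (cases i) auto
  have u: "[0..<3] = [0, 1, 2::nat]" by (simp add: upt_rec)
  have "concat (map (\<lambda>q. [block_elem 3 i q, block_elem 3 (i + 1) q]) [0..<3]) =
      [1 + 3 * c, 4 + 3 * c, 2 + 3 * c, 5 + 3 * c, 3 + 3 * c, 6 + 3 * c]"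
    by (simp add: u c block_elem_Suc)
  then have p: "psi_gen 3 i = cycle_of_list [1 + 3 * c, 4 + 3 * c, 2 + 3 * c, 5 + 3 * c, 3 + 3 * c, 6 + 3 * c]"
    by (simp only: psi_gen_def)
  have q3: "q = 0 \<or> q = 1 \<or> q = 2" if "q < 3" for q :: nat using that by linarith
  show "q < 3 \<Longrightarrow> psi_gen 3 i (block_elem 3 i q) = block_elem 3 (Suc i) q"
    by (drule q3, elim disjE) (auto simp: p[unfolded c] c block_elem_Suc transpose_def)
  show "q < 3 \<Longrightarrow> psi_gen 3 i (block_elem 3 (Suc i) q) = block_elem 3 i ((q + 1) mod 3)"
    by (drule q3, elim disjE) (auto simp: p[unfolded c] c block_elem_Suc transpose_def)
  show "x \<notin> {3 * (i - 1) + 1..3 * (i + 1)} \<Longrightarrow> psi_gen 3 i x = x"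
    unfolding p by (rule id_outside_supp) (auto simp: c)
qed

lemma psi_gen_1:
  assumes "1 \<le> i"
  shows "psi_gen 1 i i = Suc i" "psi_gen 1 i (Suc i) = i"
  using assms by (simp_all add: psi_gen_def block_elem_def)

lemma block_cycle_3:
  assumes b: "1 \<le> b"
  shows "q < 3 \<Longrightarrow> block_cycle 3 b (block_elem 3 b q) = block_elem 3 b ((q + 1) mod 3)"
    and "x \<notin> {3 * (b - 1) + 1..3 * b} \<Longrightarrow> block_cycle 3 b x = x"
proof -
  obtain c where c: "b = Suc c" using b by (cases b) auto
  have "[1 + 3 * (b - 1)..<3 * b + 1] = [1 + 3 * c, 2 + 3 * c, 3 + 3 * c]"
    by (simp add: c upt_rec)
  then have p: "block_cycle 3 b = cycle_of_list [1 + 3 * c, 2 + 3 * c, 3 + 3 * c]"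
    by (simp only: block_cycle_def)
  have q3: "q = 0 \<or> q = 1 \<or> q = 2" if "q < 3" for q :: nat using that by linarith
  show "q < 3 \<Longrightarrow> block_cycle 3 b (block_elem 3 b q) = block_elem 3 b ((q + 1) mod 3)"
    by (drule q3, elim disjE) (auto simp: p[unfolded c] c block_elem_Suc transpose_def)
  show "x \<notin> {3 * (b - 1) + 1..3 * b} \<Longrightarrow> block_cycle 3 b x = x"
    unfolding p by (rule id_outside_supp) (auto simp: c)
qed

text \<open>Each factor touches its own block only, so at a point of block \<open>c\<close> at most
  one of them matters.\<close>

lemma block_cycles_3:
  assumes "distinct is" "\<forall>b\<in>set is. 1 \<le> b" "1 \<le> c" "q < 3"
  shows "block_cycles 3 is (block_elem 3 c q) =
    (if c \<in> set is then block_elem 3 c ((q + 1) mod 3) else block_elem 3 c q)"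
  using assms(1,2)
proof (induction "is")
  case Nil
  then show ?case by (simp add: block_cycles_def)
next
  case (Cons b "is")
  have step: "block_cycles 3 (b # is) x = block_cycle 3 b (block_cycles 3 is x)" for x
    by (simp add: block_cycles_def)
  have other: "block_cycle 3 b (block_elem 3 c r) = block_elem 3 c r" if "c \<noteq> b" "r < 3" for r
  proof (rule block_cycle_3(2))
    show "1 \<le> b" using Cons.prems by simp
    show "block_elem 3 c r \<notin> {3 * (b - 1) + 1..3 * b}"
      using that assms(3) Cons.prems by (cases b; cases c) (auto simp: block_elem_Suc)
  qed
  show ?case
  proof (cases "c = b")
    case True
    then show ?thesis using Cons assms(4) block_cycle_3(1)[of b q] by (simp add: step)
  next
    case False
    then show ?thesis using Cons other assms(4) by (simp add: step)
  qed
qed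

lemma block_cycles_3_outside:
  assumes "\<forall>b\<in>set is. 1 \<le> b \<and> b \<le> k" "x \<notin> {1..3 * k}"
  shows "block_cycles 3 is x = x"
  using assms(1)
proof (induction "is")
  case (Cons b "is")
  have "x \<notin> {3 * (b - 1) + 1..3 * b}" using Cons.prems assms(2) by (cases b) auto
  then have "block_cycle 3 b x = x" using Cons.prems by (intro block_cycle_3(2)) auto
  then show ?case using Cons by (simp add: block_cycles_def)
qed (simp add: block_cycles_def)

lemma phi_gen_3_1:
  assumes i: "1 \<le> i" "i < k"
  shows "phi_gen k 3 1 t i =
    block_cycles 3 [1..<i] \<circ> block_perm 3 i 2 (psi_gen 1 i) (t i) \<circ> block_cycles 3 [i + 2..<k + 1]"
  using i by (simp add: phi_gen_def)

text \<open>For \<open>l = 1\<close> the middle factor exchanges two blocks of three points,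
  shifting by the parameter of the target block: \<open>t i (Suc i)\<close> on the way up,
  \<open>t i i\<close> on the way down.\<close>

lemma phi_gen_3_1_values:
  assumes i: "1 \<le> i" "i < k" and q: "q < 3"
  shows "phi_gen k 3 1 t i (block_elem 3 i q) = block_elem 3 (Suc i) ((q + t i (Suc i)) mod 3)"
    and "phi_gen k 3 1 t i (block_elem 3 (Suc i) q) = block_elem 3 i ((q + t i i) mod 3)"
    and "1 \<le> b \<Longrightarrow> b \<le> k \<Longrightarrow> b \<noteq> i \<Longrightarrow> b \<noteq> Suc i \<Longrightarrow>
      phi_gen k 3 1 t i (block_elem 3 b q) = block_elem 3 b ((q + 1) mod 3)"
    and "x \<notin> {1..3 * k} \<Longrightarrow> phi_gen k 3 1 t i x = x"
proof -
  have bp: "block_perm 3 i 2 (psi_gen 1 i) (t i) (block_elem 3 b r) =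
      block_elem 3 (psi_gen 1 i b) ((r + t i (psi_gen 1 i b)) mod 3)"
    if "b = i \<or> b = Suc i" "r < 3" for b r
    using that i by (intro block_perm_block_elem) auto
  have lo: "block_cycles 3 [1..<i] (block_elem 3 b r) =
      (if b < i then block_elem 3 b ((r + 1) mod 3) else block_elem 3 b r)" if "1 \<le> b" "r < 3" for b r
    using that by (subst block_cycles_3) auto
  have hi: "block_cycles 3 [i + 2..<k + 1] (block_elem 3 b r) =
      (if i + 2 \<le> b \<and> b \<le> k then block_elem 3 b ((r + 1) mod 3) else block_elem 3 b r)"
    if "1 \<le> b" "r < 3" for b r
    using that by (subst block_cycles_3) auto
  note simps = phi_gen_3_1[OF i] comp_apply
  show "phi_gen k 3 1 t i (block_elem 3 i q) = block_elem 3 (Suc i) ((q + t i (Suc i)) mod 3)"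
    unfolding simps using hi[OF i(1) q] bp[of i q] lo[of "Suc i"] q i psi_gen_1[OF i(1)] by simp
  show "phi_gen k 3 1 t i (block_elem 3 (Suc i) q) = block_elem 3 i ((q + t i i) mod 3)"
    unfolding simps using hi[of "Suc i" q] bp[of "Suc i" q] lo[of i] q i psi_gen_1[OF i(1)] by simp
  show "phi_gen k 3 1 t i (block_elem 3 b q) = block_elem 3 b ((q + 1) mod 3)"
    if b: "1 \<le> b" "b \<le> k" "b \<noteq> i" "b \<noteq> Suc i"
  proof -
    have out: "block_perm 3 i 2 (psi_gen 1 i) (t i) (block_elem 3 b r) = block_elem 3 b r"
      if "r < 3" for r
      using that b i by (intro block_perm_outside) (cases b; cases i; auto simp: block_elem_Suc)
    show ?thesis
      unfolding simps using hi[OF b(1) q] lo[OF b(1)] out q b by auto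
  qed
  show "phi_gen k 3 1 t i x = x" if x: "x \<notin> {1..3 * k}"
  proof -
    have "block_cycles 3 [i + 2..<k + 1] x = x" by (rule block_cycles_3_outside[OF _ x]) auto
    moreover have "block_cycles 3 [1..<i] x = x" by (rule block_cycles_3_outside[OF _ x]) (use i in auto)
    moreover have "block_perm 3 i 2 (psi_gen 1 i) (t i) x = x"
      using x i by (intro block_perm_outside) (cases i; auto)
    ultimately show ?thesis unfolding simps by simp
  qed
qed

text \<open>For \<open>l = 1\<close> the congruence compares the sums of the two parameters of
  consecutive generators; here both sums are \<open>a + 1\<close>.\<close>

lemma phi_params_3_1:
  assumes "\<And>i. t i i = a" "\<And>i r. r \<noteq> i \<Longrightarrow> t i r = 1" "a < 3"
  shows "phi_params k 3 1 t"
proof -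
  have "t i q < 3" for i q using assms by (cases "q = i") auto
  then show ?thesis
    unfolding phi_params_def using assms by (auto simp: cong_def)
qed

section \<open>From homomorphisms to actions and back\<close>

lemma hom_braid_action:
  assumes \<omega>: "\<omega> \<in> hom (braid_group k) (sym_group N)"
  shows "braid_action k (\<lambda>i. \<omega> (braid_gen k i)) {1..N}"
proof
  have gen: "braid_gen k i \<in> carrier (braid_group k)" if "1 \<le> i" "i < k" for i
    using that by (intro braid_gen_carrier) auto
  have mult: "\<omega> (x \<otimes>\<^bsub>braid_group k\<^esub> y) = \<omega> x \<circ> \<omega> y"
    if "x \<in> carrier (braid_group k)" "y \<in> carrier (braid_group k)" for x y
    using hom_mult[OF \<omega> that] by (simp add: sym_group_mult)
  have closed: "x \<otimes>\<^bsub>braid_group k\<^esub> y \<in> carrier (braid_group k)"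
    if "x \<in> carrier (braid_group k)" "y \<in> carrier (braid_group k)" for x y
    using group.is_monoid[OF braid_group_is_group] monoid.m_closed that by metis
  show "\<omega> (braid_gen k i) permutes {1..N}" if "1 \<le> i" "i < k" for i
    using hom_in_carrier[OF \<omega> gen[OF that]] by (simp add: sym_group_carrier)
  fix i x
  show "\<omega> (braid_gen k i) (\<omega> (braid_gen k j) x) = \<omega> (braid_gen k j) (\<omega> (braid_gen k i) x)"
    if h: "1 \<le> i" "i + 2 \<le> j" "j < k" for j
  proof -
    have "\<omega> (braid_gen k i \<otimes>\<^bsub>braid_group k\<^esub> braid_gen k j) = \<omega> (braid_gen k j \<otimes>\<^bsub>braid_group k\<^esub> braid_gen k i)"
      using h by (subst braid_gen_commute) auto
    then show ?thesis using h mult gen by (simp add: fun_eq_iff)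
  qed
  show "\<omega> (braid_gen k i) (\<omega> (braid_gen k (Suc i)) (\<omega> (braid_gen k i) x)) =
      \<omega> (braid_gen k (Suc i)) (\<omega> (braid_gen k i) (\<omega> (braid_gen k (Suc i)) x))"
    if h: "1 \<le> i" "Suc i < k"
  proof -
    have g: "braid_gen k i \<in> carrier (braid_group k)" "braid_gen k (Suc i) \<in> carrier (braid_group k)"
      using gen h by auto
    have "\<omega> (braid_gen k i \<otimes>\<^bsub>braid_group k\<^esub> braid_gen k (i + 1) \<otimes>\<^bsub>braid_group k\<^esub> braid_gen k i) =
        \<omega> (braid_gen k (i + 1) \<otimes>\<^bsub>braid_group k\<^esub> braid_gen k i \<otimes>\<^bsub>braid_group k\<^esub> braid_gen k (i + 1))"
      using h by (subst braid_gen_braid) auto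
    then show ?thesis using mult closed g by (simp add: fun_eq_iff)
  qed
qed simp

text \<open>Induction on a word for \<open>g\<close>: a new first letter composes on the left with
  the image of a generator or with its inverse.\<close>

lemma braid_hom_induct:
  assumes \<omega>: "\<omega> \<in> hom (braid_group k) (sym_group N)"
    and one: "P id"
    and gen: "\<And>i f. 1 \<le> i \<Longrightarrow> i < k \<Longrightarrow> P f \<Longrightarrow> P (\<omega> (braid_gen k i) \<circ> f)"
    and gen_inv: "\<And>i f. 1 \<le> i \<Longrightarrow> i < k \<Longrightarrow> P f \<Longrightarrow> P (inv' (\<omega> (braid_gen k i)) \<circ> f)"
    and g: "g \<in> carrier (braid_group k)"
  shows "P (\<omega> g)"
proof -
  let ?X = "{1..k - 1}" and ?R = "braid_relations k"
  interpret h: group_hom "braid_group k" "sym_group N" \<omega>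
    by (intro group_hom.intro group_hom_axioms.intro braid_group_is_group sym_group_is_group \<omega>)
  have main: "P (\<omega> (word_class ?X ?R w))" if "w \<in> words ?X" for w
    using that
  proof (induction w)
    case Nil
    have "\<omega> (word_class ?X ?R []) = id"
      using h.hom_one by (simp add: braid_group_def presented_group_one sym_group_one)
    then show ?case using one by (simp only:)
  next
    case (Cons a w)
    obtain i b where a: "a = (i, b)" by force
    have i: "i \<in> ?X" and w: "w \<in> words ?X" using Cons.prems a by auto
    have wc: "word_class ?X ?R v \<in> carrier (braid_group k)" if "v \<in> words ?X" for v
      using that by (simp add: braid_group_def presented_group_carrier)
    have mult: "\<omega> (word_class ?X ?R (u @ v)) = \<omega> (word_class ?X ?R u) \<circ> \<omega> (word_class ?X ?R v)"
      if "u \<in> words ?X" "v \<in> words ?X" for u v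
      using h.hom_mult[OF wc[OF that(1)] wc[OF that(2)]] presented_group_mult[OF that]
      by (simp add: braid_group_def sym_group_mult)
    have step: "\<omega> (word_class ?X ?R (a # w)) = \<omega> (word_class ?X ?R [a]) \<circ> \<omega> (word_class ?X ?R w)"
      using mult[of "[a]" w] i w a by simp
    have IH: "P (\<omega> (word_class ?X ?R w))" using Cons.IH w by simp
    have i': "1 \<le> i" "i < k" using i by auto
    show ?case
    proof (cases b)
      case True
      then have "word_class ?X ?R [a] = braid_gen k i" by (simp add: braid_gen_def a)
      with gen[OF i' IH] show ?thesis by (simp only: step)
    next
      case False
      have "word_eq ?X ?R ([] @ [(i, False), (i, \<not> False)] @ []) ([] @ [])"
        using i by (intro word_eq.cancel) auto
      then have "word_class ?X ?R ([a] @ [(i, True)]) = word_class ?X ?R []"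
        using i False a by (simp add: word_class_eq_iff)
      then have "\<omega> (word_class ?X ?R [a]) \<circ> \<omega> (braid_gen k i) = id"
        using mult[of "[a]" "[(i, True)]"] i a h.hom_one
        by (simp add: braid_gen_def braid_group_def presented_group_one sym_group_one)
      moreover have "\<omega> (braid_gen k i) permutes {1..N}"
        using h.hom_closed[OF braid_gen_carrier[OF i]] by (simp add: sym_group_carrier)
      ultimately have "\<omega> (word_class ?X ?R [a]) = inv' (\<omega> (braid_gen k i))"
        by (metis comp_assoc comp_id id_comp permutes_inv_o(1))
      with gen_inv[OF i' IH] show ?thesis by (simp only: step)
    qed
  qed
  obtain w where "w \<in> words ?X" "g = word_class ?X ?R w"
    using g by (auto simp: braid_group_def presented_group_carrier)
  then show ?thesis using main by simp
qed

lemma braid_hom_invariant: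
  assumes \<omega>: "\<omega> \<in> hom (braid_group k) (sym_group N)"
    and Z: "Z \<subseteq> {1..N}" "\<And>i x. 1 \<le> i \<Longrightarrow> i < k \<Longrightarrow> x \<in> Z \<Longrightarrow> \<omega> (braid_gen k i) x \<in> Z"
    and g: "g \<in> carrier (braid_group k)" and x: "x \<in> Z"
  shows "\<omega> g x \<in> Z"
proof -
  interpret braid_action k "\<lambda>i. \<omega> (braid_gen k i)" "{1..N}" by (rule hom_braid_action[OF \<omega>])
  have "\<forall>x\<in>Z. \<omega> g x \<in> Z"
  proof (rule braid_hom_induct[OF \<omega> _ _ _ g])
    fix i f assume i: "1 \<le> i" "i < k" and f: "\<forall>x\<in>Z. f x \<in> Z"
    let ?s = "\<omega> (braid_gen k i)"
    show "\<forall>x\<in>Z. (?s \<circ> f) x \<in> Z" using Z(2)[OF i] f by simp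
    \<comment> \<open>As \<open>Z\<close> is finite, the generator maps it onto itself, which takes
      care of the inverse.\<close>
    have "finite Z" using Z(1) finite_subset by blast
    moreover have "inj_on ?s Z" using inj[OF i] by (simp add: inj_on_def)
    moreover have "?s ` Z \<subseteq> Z" using Z(2)[OF i] by blast
    ultimately have img: "?s ` Z = Z" by (simp add: endo_inj_surj)
    have "inv' ?s x \<in> Z" if x: "x \<in> Z" for x
    proof -
      have "x \<in> ?s ` Z" using x img by simp
      then obtain u where "u \<in> Z" "x = ?s u" by blast
      then show ?thesis using permutes_inverses(2)[OF perm[OF i]] by simp
    qed
    then show "\<forall>x\<in>Z. (inv' ?s \<circ> f) x \<in> Z" using f by simp
  qed (simp add: id_def)
  then show ?thesis using x by blast
qed

lemma gens_equal_imp_cyclic: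
  assumes \<omega>: "\<omega> \<in> hom (braid_group k) (sym_group N)" and k: "k \<ge> 2"
    and eq: "gens_equal k (\<lambda>i. \<omega> (braid_gen k i))"
  shows "cyclic_hom (braid_group k) (sym_group N) \<omega>"
proof -
  let ?H = "sym_group N"
  interpret h: group_hom "braid_group k" ?H \<omega>
    by (intro group_hom.intro group_hom_axioms.intro braid_group_is_group sym_group_is_group \<omega>)
  define a where "a = \<omega> (braid_gen k 1)"
  have g1: "braid_gen k 1 \<in> carrier (braid_group k)" using k by (intro braid_gen_carrier) auto
  have a: "a \<in> carrier ?H" unfolding a_def using g1 by simp
  have gens: "\<omega> (braid_gen k i) = a" if "1 \<le> i" "i < k" for i
    unfolding a_def using gens_equalD[OF eq that, of 1] k by simp
  have pow: "\<omega> g \<in> range (\<lambda>n::int. a [^]\<^bsub>?H\<^esub> n)" if "g \<in> carrier (braid_group k)" for g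
  proof (rule braid_hom_induct[OF \<omega> _ _ _ that])
    show "id \<in> range (\<lambda>n::int. a [^]\<^bsub>?H\<^esub> n)"
      by (rule range_eqI[of _ _ 0]) (simp add: sym_group_one)
    fix i f assume i: "1 \<le> i" "i < k" and "f \<in> range (\<lambda>n::int. a [^]\<^bsub>?H\<^esub> n)"
    then obtain m :: int where f: "f = a [^]\<^bsub>?H\<^esub> m" by blast
    have "a \<otimes>\<^bsub>?H\<^esub> a [^]\<^bsub>?H\<^esub> m = a [^]\<^bsub>?H\<^esub> (1 + m)"
      using h.H.int_pow_mult[OF a, of 1 m] a by simp
    then show "\<omega> (braid_gen k i) \<circ> f \<in> range (\<lambda>n::int. a [^]\<^bsub>?H\<^esub> n)"
      using gens[OF i] f by (intro range_eqI[of _ _ "1 + m"]) (simp add: sym_group_mult)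
    have "inv\<^bsub>?H\<^esub> a \<otimes>\<^bsub>?H\<^esub> a [^]\<^bsub>?H\<^esub> m = a [^]\<^bsub>?H\<^esub> (- 1 + m)"
      using h.H.int_pow_mult[OF a, of "- 1" m] h.H.int_pow_neg[OF a, of 1] a by simp
    then show "inv' (\<omega> (braid_gen k i)) \<circ> f \<in> range (\<lambda>n::int. a [^]\<^bsub>?H\<^esub> n)"
      using gens[OF i] f a by (intro range_eqI[of _ _ "- 1 + m"]) (simp add: sym_group_mult)
  qed
  have sub: "subgroup (\<omega> ` carrier (braid_group k)) ?H" by (rule h.img_is_subgroup)
  interpret K: group "?H\<lparr>carrier := \<omega> ` carrier (braid_group k)\<rparr>"
    using h.H.subgroup_imp_group[OF sub] .
  have aK: "a \<in> \<omega> ` carrier (braid_group k)" unfolding a_def using g1 by blast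
  have eq': "carrier (?H\<lparr>carrier := \<omega> ` carrier (braid_group k)\<rparr>) =
      range (\<lambda>n::int. a [^]\<^bsub>?H\<lparr>carrier := \<omega> ` carrier (braid_group k)\<rparr>\<^esub> n)"
  proof
    show "carrier (?H\<lparr>carrier := \<omega> ` carrier (braid_group k)\<rparr>) \<subseteq>
        range (\<lambda>n::int. a [^]\<^bsub>?H\<lparr>carrier := \<omega> ` carrier (braid_group k)\<rparr>\<^esub> n)"
      using pow h.H.int_pow_consistent[OF sub aK] by auto
    show "range (\<lambda>n::int. a [^]\<^bsub>?H\<lparr>carrier := \<omega> ` carrier (braid_group k)\<rparr>\<^esub> n) \<subseteq>
        carrier (?H\<lparr>carrier := \<omega> ` carrier (braid_group k)\<rparr>)"
      using K.int_pow_closed[of a] aK by auto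
  qed
  show ?thesis
    unfolding cyclic_hom_def K.cyclic_group by (rule bexI[of _ a], rule eq') (simp add: aK)
qed

lemma labels_imp_standard:
  assumes \<omega>: "\<omega> \<in> hom (braid_group k) (sym_group (3 * k))"
    and bij: "bij_betw (\<lambda>(b, q). e b q) ({1..k} \<times> {..<3}) {1..3 * k}"
    and cases: "psi_labels k (\<lambda>i. \<omega> (braid_gen k i)) e \<or> (\<exists>\<tau>. phi_labels k (\<lambda>i. \<omega> (braid_gen k i)) e \<tau>)"
  shows "standard_hom k 3 \<omega>"
proof -
  define X where "X = {1..3 * k}"
  define s where "s = (\<lambda>i. \<omega> (braid_gen k i))"
  let ?G = "braid_group k" and ?H = "sym_group (3 * k)"
  note bij = bij[folded X_def] and cases = cases[folded s_def]
  interpret A: braid_action k s X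
    using hom_braid_action[OF \<omega>] by (simp add: s_def X_def)
  \<comment> \<open>The conjugating permutation sends \<open>block_elem 3 b q\<close> to the point
    labelled \<open>e b q\<close>; quotient and remainder of \<open>x - 1\<close> recover
    \<open>b - 1\<close> and \<open>q\<close>.\<close>
  define h where "h x = (if x \<in> X then e (Suc ((x - 1) div 3)) ((x - 1) mod 3) else x)" for x
  have h_elem: "h (block_elem 3 b q) = e b q" if "1 \<le> b" "b \<le> k" "q < 3" for b q
    using block_elem_range[OF that] block_elem_coords[OF that(1,3)] that(1) by (simp add: h_def X_def)
  have e_X: "e b q \<in> X" if "1 \<le> b" "b \<le> k" "q < 3" for b q
    using bij_betwE[OF bij] that by auto
  have h_X: "h x \<in> X" if "x \<in> X" for x
  proof -
    obtain b q where "1 \<le> b" "b \<le> k" "q < 3" "x = block_elem 3 b q"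
      using \<open>x \<in> X\<close> unfolding X_def by (rule block_elem_exhaust)
    then show ?thesis using h_elem e_X by simp
  qed
  have "h permutes X"
  proof (rule bij_imp_permutes)
    have "X \<subseteq> h ` X"
    proof
      fix x assume "x \<in> X"
      then obtain b q where bq: "1 \<le> b" "b \<le> k" "q < 3" "x = e b q"
        using bij_betw_imp_surj_on[OF bij] by auto
      then have "x = h (block_elem 3 b q)" using h_elem by simp
      moreover have "block_elem 3 b q \<in> X" unfolding X_def by (rule block_elem_range[OF bq(1-3)])
      ultimately show "x \<in> h ` X" by blast
    qed
    moreover have "h ` X \<subseteq> X" using h_X by blast
    ultimately have "h ` X = X" by blast
    then show "bij_betw h X X" using A.finite_X by (simp add: bij_betw_def finite_surj_inj)
  qed (simp add: h_def)
  then have hH: "h \<in> carrier ?H" by (simp add: sym_group_carrier X_def)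
  interpret H: group ?H by (rule sym_group_is_group)
  define \<phi> where "\<phi> g = inv\<^bsub>?H\<^esub> h \<otimes>\<^bsub>?H\<^esub> \<omega> g \<otimes>\<^bsub>?H\<^esub> h" for g
  have \<phi>_hom: "\<phi> \<in> hom ?G ?H"
  proof (rule homI)
    fix g g' assume g: "g \<in> carrier ?G" "g' \<in> carrier ?G"
    have w: "\<omega> g \<in> carrier ?H" "\<omega> g' \<in> carrier ?H" using hom_in_carrier[OF \<omega>] g by auto
    show "\<phi> g \<in> carrier ?H" unfolding \<phi>_def using w hH by (intro H.m_closed H.inv_closed)
    have "h \<otimes>\<^bsub>?H\<^esub> (inv\<^bsub>?H\<^esub> h \<otimes>\<^bsub>?H\<^esub> (\<omega> g' \<otimes>\<^bsub>?H\<^esub> h)) = \<omega> g' \<otimes>\<^bsub>?H\<^esub> h"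
      using w hH by (simp add: H.m_assoc[symmetric] del: sym_group_inv_equality)
    then show "\<phi> (g \<otimes>\<^bsub>?G\<^esub> g') = \<phi> g \<otimes>\<^bsub>?H\<^esub> \<phi> g'"
      unfolding \<phi>_def hom_mult[OF \<omega> g]
      using w hH by (simp add: H.m_assoc del: sym_group_inv_equality)
  qed
  have \<phi>_gen: "\<phi> (braid_gen k i) = M" if M: "\<And>x. s i (h x) = h (M x)" for i M
  proof
    fix x
    have "\<phi> (braid_gen k i) x = inv' h (s i (h x))"
      unfolding \<phi>_def using hH by (simp add: sym_group_mult s_def)
    also have "\<dots> = M x" using M permutes_inverses(2)[OF \<open>h permutes X\<close>] by simp
    finally show "\<phi> (braid_gen k i) x = M x" .
  qed
  have \<phi>_gen': "\<phi> (braid_gen k i) = M"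
    if i: "1 \<le> i" "i < k" and out: "\<And>x. x \<notin> X \<Longrightarrow> M x = x"
      and bl: "\<And>b q. 1 \<le> b \<Longrightarrow> b \<le> k \<Longrightarrow> q < 3 \<Longrightarrow> s i (e b q) = h (M (block_elem 3 b q))" for i M
  proof (rule \<phi>_gen)
    fix x
    show "s i (h x) = h (M x)"
    proof (cases "x \<in> X")
      case True
      then obtain b q where "1 \<le> b" "b \<le> k" "q < 3" "x = block_elem 3 b q"
        unfolding X_def by (rule block_elem_exhaust)
      then show ?thesis using bl h_elem by simp
    next
      case False
      then show ?thesis using out A.outside[OF i] by (simp add: h_def)
    qed
  qed
  have "model_hom k 3 \<phi>"
    using cases
  proof
    assume c: "psi_labels k s e"
    have "\<phi> (braid_gen k i) = psi_gen 3 i" if i: "1 \<le> i" "i < k" for i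
    proof (rule \<phi>_gen'[OF i])
      show "psi_gen 3 i x = x" if "x \<notin> X" for x
        using that i unfolding X_def by (intro psi_gen_3(3)) auto
      fix b q assume b: "1 \<le> b" "b \<le> k" and q: "q < (3::nat)"
      note ci = c[unfolded psi_labels_def, rule_format, OF i q]
      consider "b = i" | "b = Suc i" | "b \<noteq> i" "b \<noteq> Suc i" by blast
      then show "s i (e b q) = h (psi_gen 3 i (block_elem 3 b q))"
      proof cases
        case 1
        then show ?thesis using ci psi_gen_3(1)[OF i(1) q] h_elem[of "Suc i" q] i q by simp
      next
        case 2
        then show ?thesis using ci psi_gen_3(2)[OF i(1) q] h_elem[of i "(q + 1) mod 3"] i by simp
      next
        case 3
        have "psi_gen 3 i (block_elem 3 b q) = block_elem 3 b q"
        proof (rule psi_gen_3(3)[OF i(1)])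
          obtain b' i' where "b = Suc b'" "i = Suc i'" using b i by (metis Suc_le_D One_nat_def)
          then show "block_elem 3 b q \<notin> {3 * (i - 1) + 1..3 * (i + 1)}"
            using 3 q by (simp add: block_elem_Suc)
        qed
        then show ?thesis using ci 3 b h_elem[OF b q] by simp
      qed
    qed
    then show ?thesis using \<phi>_hom unfolding model_hom_def by auto
  next
    assume "\<exists>\<tau>. phi_labels k s e \<tau>"
    then obtain \<tau> where c: "phi_labels k s e \<tau>" ..
    \<comment> \<open>The entry \<open>\<tau> + 1\<close> belongs to the lower block, the target on
      the way down; it is reduced because parameters must be below 3.\<close>
    define t :: "nat \<Rightarrow> nat \<Rightarrow> nat" where "t i r = (if r = i then (\<tau> + 1) mod 3 else 1)" for i r
    have "phi_params k 3 1 t" by (rule phi_params_3_1[where a = "(\<tau> + 1) mod 3"]) (simp_all add: t_def)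
    moreover have "\<phi> (braid_gen k i) = phi_gen k 3 1 t i" if i: "1 \<le> i" "i < k" for i
    proof (rule \<phi>_gen'[OF i])
      show "phi_gen k 3 1 t i x = x" if "x \<notin> X" for x
        using phi_gen_3_1_values(4)[OF i, of 0] that unfolding X_def by simp
      fix b q assume b: "1 \<le> b" "b \<le> k" and q: "q < (3::nat)"
      note ci = c[unfolded phi_labels_def, rule_format, OF i q] and v = phi_gen_3_1_values[OF i q, where t = t]
      consider "b = i" | "b = Suc i" | "b \<noteq> i" "b \<noteq> Suc i" by blast
      then show "s i (e b q) = h (phi_gen k 3 1 t i (block_elem 3 b q))"
      proof cases
        case 1
        have "h (block_elem 3 (Suc i) ((q + 1) mod 3)) = e (Suc i) ((q + 1) mod 3)"
          using i by (intro h_elem) auto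
        then show ?thesis using ci v(1) 1 by (simp add: t_def)
      next
        case 2
        have "(q + (\<tau> + 1) mod 3) mod 3 = (q + \<tau> + 1) mod 3" by (simp add: mod_add_right_eq add.assoc)
        moreover have "h (block_elem 3 i ((q + \<tau> + 1) mod 3)) = e i ((q + \<tau> + 1) mod 3)"
          using i by (intro h_elem) auto
        ultimately show ?thesis using ci v(2) 2 by (simp add: t_def)
      next
        case 3
        have "h (block_elem 3 b ((q + 1) mod 3)) = e b ((q + 1) mod 3)"
          using b by (intro h_elem) auto
        then show ?thesis using ci v(3)[OF b 3] b 3 by simp
      qed
    qed
    ultimately show ?thesis using \<phi>_hom unfolding model_hom_def
      by (intro conjI disjI2 exI[of _ 1] exI[of _ t]) auto
  qed
  moreover have "conjugate_homs ?G ?H \<omega> \<phi>"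
    unfolding conjugate_homs_def using hH by (intro bexI[of _ h]) (simp_all add: \<phi>_def)
  ultimately show ?thesis
    unfolding standard_hom_def using \<omega> by blast
qed

theorem theorem5p6:
  fixes k :: nat and \<omega> :: "nat word set \<Rightarrow> nat \<Rightarrow> nat"
  assumes "k > 8"
    and "\<omega> \<in> hom (braid_group k) (sym_group (3 * k))"
    and "good_hom k \<omega>"
    and "transitive_hom (braid_group k) (3 * k) \<omega>"
    and "\<not> cyclic_hom (braid_group k) (sym_group (3 * k)) \<omega>"
  shows "standard_hom k 3 \<omega>"
proof -
  define X where "X = {1..3 * k}"
  define s where "s i = \<omega> (braid_gen k i)" for i
  let ?G = "braid_group k" and ?H = "sym_group (3 * k)"
  interpret A: braid_action k s X
    using hom_braid_action[OF assms(2)] by (simp add: s_def[abs_def] X_def)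
  have k: "k \<ge> 9" using assms(1) by simp
  have card_X: "card X = 3 * k" by (simp add: X_def)
  have neq: "\<not> gens_equal k s"
    using gens_equal_imp_cyclic[OF assms(2)] assms(5) k by (auto simp: s_def[abs_def])
  have invariant: "Z = X" if Z: "Z \<subseteq> X" "Z \<noteq> {}" "\<And>i x. 1 \<le> i \<Longrightarrow> i < k \<Longrightarrow> x \<in> Z \<Longrightarrow> s i x \<in> Z" for Z
  proof
    show "X \<subseteq> Z"
    proof
      fix x assume x: "x \<in> X"
      obtain w where w: "w \<in> Z" using Z(2) by blast
      obtain g where g: "g \<in> carrier ?G" "\<omega> g w = x"
        using assms(4) w x Z(1) unfolding transitive_hom_def X_def by blast
      have "\<omega> g w \<in> Z"
        by (rule braid_hom_invariant[OF assms(2) _ _ g(1) w]) (use Z(1,3) in \<open>simp_all add: X_def s_def\<close>)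
      then show "x \<in> Z" using g(2) by simp
    qed
  qed (rule Z(1))
  have some_moved: "supp (s i) \<noteq> {}" if i: "1 \<le> i" "i < k" for i
  proof
    assume "supp (s i) = {}"
    then have "card (supp (s 1)) = 0" using A.single_invariant[OF conj_inv_supp_card i] by simp
    then have "supp (s j) = {}" if "1 \<le> j" "j < k" for j
      using A.single_invariant[OF conj_inv_supp_card that] A.finite_supp[OF that] by simp
    then have "s j = id" if "1 \<le> j" "j < k" for j using that by (auto simp: supp_def)
    then show False using neq unfolding gens_equal_def by metis
  qed
  have "\<exists>z y D. z permutes X \<and>
     (\<forall>i x. 1 \<le> i \<longrightarrow> i < k \<longrightarrow> s i x = z (y i x) \<and> y i (z x) = z (y i x)) \<and>
     braid_action k y X \<and> block_system k y X D \<and> 1 \<le> card (D 1) \<and> (z = id \<or> (\<forall>x\<in>D 1. z x \<noteq> x))"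
    using assms(3) unfolding good_hom_def
  proof
    assume h: "\<forall>i\<in>{1..k - 1}. \<forall>j\<in>{1..k - 1}. \<bar>int i - int j\<bar> > 1 \<longrightarrow>
       supp (\<omega> (braid_gen k i)) \<inter> supp (\<omega> (braid_gen k j)) = {}"
    have disj: "supp (s i) \<inter> supp (s j) = {}" if "1 \<le> i" "i + 2 \<le> j" "j < k" for i j
      using h[rule_format, of i j] that unfolding s_def by auto
    have k4: "k \<ge> 4" using k by simp
    obtain D where D: "block_system k s X D" using A.disjoint_supports_blocks[OF k4 disj] by blast
    have "2 * card (D 1) = card (supp (s 1))" using block_systemD(1)[OF D, of 1] k by simp
    moreover have "card (supp (s 1)) \<noteq> 0" using some_moved[of 1] A.finite_supp[of 1] k by simp
    ultimately have "1 \<le> card (D 1)" by linarith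
    then show ?thesis
      using D A.braid_action_axioms permutes_id[of X]
      by (intro exI[of _ id] exI[of _ s] exI[of _ D]) simp
  next
    assume h: "\<forall>i\<in>{1..k - 1}. \<forall>j\<in>{1..k - 1}.
       supp (\<omega> (braid_gen k i)) = supp (\<omega> (braid_gen k j))"
    have same: "supp (s i) = supp (s 1)" if "1 \<le> i" "i < k" for i
      unfolding s_def using h[rule_format, of i 1] that by auto
    \<comment> \<open>Outside the common support every generator fixes every point, so the
      complement is invariant.\<close>
    have full1: "supp (s 1) = X"
    proof (rule ccontr)
      assume "supp (s 1) \<noteq> X"
      moreover have sub: "supp (s 1) \<subseteq> X" by (rule A.supp_subset) (use k in auto)
      ultimately have ne: "X - supp (s 1) \<noteq> {}" by auto
      have inv: "s i x \<in> X - supp (s 1)" if i: "1 \<le> i" "i < k" and x: "x \<in> X - supp (s 1)" for i x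
      proof -
        have "x \<notin> supp (s i)" using same[OF i] x by blast
        then have "s i x = x" by (simp add: supp_def)
        then show ?thesis using x by simp
      qed
      have "X - supp (s 1) = X" by (rule invariant[OF Diff_subset ne inv])
      then have "supp (s 1) = {}" using sub by blast
      then show False using some_moved[of 1] k by simp
    qed
    have full: "supp (s i) = X" if "1 \<le> i" "i < k" for i using same[OF that] full1 by simp
    have "\<exists>z y D. z permutes X \<and>
        (\<forall>i x. 1 \<le> i \<longrightarrow> i < k \<longrightarrow> s i x = z (y i x) \<and> y i (z x) = z (y i x)) \<and>
        braid_action k y X \<and> block_system k y X D \<and> 2 \<le> card (D 1)"
      by (rule A.full_support_factor[OF k card_X _ neq]) (rule full)
    then obtain z y D where zyD: "z permutes X"
      "\<forall>i x. 1 \<le> i \<longrightarrow> i < k \<longrightarrow> s i x = z (y i x) \<and> y i (z x) = z (y i x)"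
      "braid_action k y X" "block_system k y X D" "2 \<le> card (D 1)"
      by (elim exE conjE)
    \<comment> \<open>On \<open>D 1\<close> the generator \<open>y 3\<close> is trivial, so
      \<open>z\<close> agrees there with \<open>s 3\<close>, which moves every point of
      \<open>X\<close>.\<close>
    have "z x \<noteq> x" if x: "x \<in> D 1" for x
    proof -
      have D: "supp (y 3) = D 3 \<union> D 4" "D 1 \<inter> D 3 = {}" "D 1 \<inter> D 4 = {}" "D 1 \<subseteq> X"
        using block_systemD(2)[OF zyD(4), of 1] block_systemD(3)[OF zyD(4), of 1 3]
          block_systemD(3)[OF zyD(4), of 1 4] block_systemD(4)[OF zyD(4), of 3] k by simp_all
      have "x \<notin> supp (y 3)" using D x by blast
      then have "y 3 x = x" by (simp add: supp_def)
      then have "s 3 x = z x" using zyD(2)[rule_format, of 3 x] k by simp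
      moreover have "x \<in> supp (s 3)" using full[of 3] D(4) x k by auto
      ultimately show ?thesis by (simp add: supp_def)
    qed
    then show ?thesis using zyD by (intro exI[of _ z] exI[of _ y] exI[of _ D]) simp
  qed
  then obtain z y D where zyD: "z permutes X"
    "\<forall>i x. 1 \<le> i \<longrightarrow> i < k \<longrightarrow> s i x = z (y i x) \<and> y i (z x) = z (y i x)"
    "braid_action k y X" "block_system k y X D" "1 \<le> card (D 1)" "z = id \<or> (\<forall>x\<in>D 1. z x \<noteq> x)"
    by (elim exE conjE)
  interpret F: factored_action k s X y z D
  proof (intro factored_action.intro factored_action_axioms.intro A.braid_action_axioms zyD)
    show "Z = X" if "Z \<subseteq> X" "Z \<noteq> {}" "\<And>i x. 1 \<le> i \<Longrightarrow> i < k \<Longrightarrow> x \<in> Z \<Longrightarrow> s i x \<in> Z" for Z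
      using that by (rule invariant)
  qed (use k card_X zyD in simp_all)
  obtain e where "bij_betw (\<lambda>(b, q). e b q) ({1..k} \<times> {..<3}) X"
    "psi_labels k s e \<or> (\<exists>\<tau>. phi_labels k s e \<tau>)"
    using F.label_cases[OF zyD(6)] by blast
  then show ?thesis
    unfolding X_def s_def[abs_def] by (intro labels_imp_standard[OF assms(2)])
qed

end
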